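(* There is an absolute constant $A>0$ (independent of $p$ and $f$) such that the following holds. Let $1<p<\infty$, let $p'=p/(p-1)$, let $f\in L^p([0,1]^2)$ and assume that $I_p(f)<\infty$. Then there exist a continuous function $g\in H_p^{(2)}$ and univariate functions $\phi_1,\phi_2$ such that for a.e. $(x,y)\in\mathbb{R}^2$ $$f(x,y)=g(x,y)+\phi_1(x)+\phi_2(y),$$ and moreover $$v_p^{(2)}(g)\le A\left[\omega(f;1,1)_p+\frac{1}{pp'}K_p(f)+\left(\frac{1}{pp'}\right)^2I_p(f)\right].$$ If $f\in L^p_0([0,1]^2)$, then one may take $\phi_1=\phi_2=0$.
   Context: Functions are real-valued. $L^p([0,1]^2)$ is the class of measurable functions $f$ on $\mathbb{R}^2$ that are 1-periodic in each variable with $\|f\|_p=(\int_{[0,1]^2}|f|^p)^{1/p}<\infty$. $L^p_0([0,1]^2)$ is the subspace of those $f\in L^p([0,1]^2)$ with $\int_0^1f(x,t)\,dt=\int_0^1f(t,y)\,dt=0$ for a.e. $x,y\in\mathbb{R}$. For $s,t\in\mathbb{R}$, $\Delta(s,t)f(x,y)=f(x+s,y+t)-f(x+s,y)-f(x,y+t)+f(x,y)$, and $\omega(f;u,v)_p=\sup_{0\le s\le u,\,0\le t\le v}\|\Delta(s,t)f\|_p$ is the mixed $L^p$-modulus of continuity. Set $$K_p(f)=\int_0^1t^{-1/p}[\omega(f;t,1)_p+\omega(f;1,t)_p]\frac{dt}{t},\qquad I_p(f)=\int_0^1\int_0^1(uv)^{-1/p}\omega(f;u,v)_p\frac{du}{u}\frac{dv}{v}.$$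 For a 1-periodic function $h$ on $\mathbb{R}$, $v_p(h)=\sup_\Pi\big(\sum_{k=0}^{n-1}|h(x_{k+1})-h(x_k)|^p\big)^{1/p}$, the supremum over all partitions $\Pi=\{x_0<x_1<\dots<x_n=x_0+1\}$; $h\in V_p$ means $v_p(h)<\infty$. For a function $g(x,y)$ on $\mathbb{R}^2$, 1-periodic in both variables, $$v_p^{(2)}(g)=\sup_{\mathcal N}\Big(\sum_{i=0}^{m-1}\sum_{j=0}^{n-1}|g(x_{i+1},y_{j+1})-g(x_{i+1},y_j)-g(x_i,y_{j+1})+g(x_i,y_j)|^p\Big)^{1/p},$$ the supremum over all nets $\mathcal N=\{(x_i,y_j):0\le i\le m,\,0\le j\le n\}$ with $x_0<x_1<\dots<x_m=x_0+1$ and $y_0<y_1<\dots<y_n=y_0+1$. The space $H_p^{(2)}$ consists of all functions $g$, 1-periodic in both variables, such that $v_p^{(2)}(g)<\infty$ and, for every $x\in\mathbb{R}$ and every $y\in\mathbb{R}$, the sections $g(x,\cdot)$ and $g(\cdot,y)$ belong to $V_p$. *)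

theory Defs
  imports "HOL-Analysis.Analysis"
begin

definition periodic1 :: "(real \<Rightarrow> real) \<Rightarrow> bool" where
  "periodic1 h \<longleftrightarrow> (\<forall>x. h (x + 1) = h x)"

definition periodic2 :: "(real \<times> real \<Rightarrow> real) \<Rightarrow> bool" where
  "periodic2 f \<longleftrightarrow> (\<forall>x y. f (x + 1, y) = f (x, y) \<and> f (x, y + 1) = f (x, y))"

text \<open>Norms, moduli of continuity and variations take values in \<open>ennreal\<close>, so that an infinite
  supremum or integral really has the value \<open>\<infinity>\<close>.\<close>

definition proot :: "real \<Rightarrow> ennreal \<Rightarrow> ennreal" where
  "proot p a = (if a = \<infinity> then \<infinity> else ennreal (enn2real a powr (1 / p)))"

definition Lp_norm :: "real \<Rightarrow> (real \<times> real \<Rightarrow> real) \<Rightarrow> ennreal" where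
  "Lp_norm p f = proot p (\<integral>\<^sup>+ z \<in> {0..1} \<times> {0..1}. ennreal (\<bar>f z\<bar> powr p) \<partial>lebesgue)"

definition Lp :: "real \<Rightarrow> (real \<times> real \<Rightarrow> real) set" where
  "Lp p = {f. f \<in> borel_measurable lebesgue \<and> periodic2 f \<and> Lp_norm p f < \<infinity>}"

text \<open>By Fubini almost every section of a function in \<open>Lp p\<close>, \<open>p \<ge> 1\<close>, is integrable over
  \<open>[0, 1]\<close>, so the value 0 of the Bochner integral of a non-integrable function plays no role.\<close>

definition Lp0 :: "real \<Rightarrow> (real \<times> real \<Rightarrow> real) set" where
  "Lp0 p = {f \<in> Lp p.
     (AE x in lebesgue. (LINT t:{0..1}|lebesgue. f (x, t)) = 0) \<and>
     (AE y in lebesgue. (LINT t:{0..1}|lebesgue. f (t, y)) = 0)}"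

definition mixed_diff :: "real \<Rightarrow> real \<Rightarrow> (real \<times> real \<Rightarrow> real) \<Rightarrow> real \<times> real \<Rightarrow> real" where
  "mixed_diff s t f = (\<lambda>(x, y). f (x + s, y + t) - f (x + s, y) - f (x, y + t) + f (x, y))"

definition mixed_modulus :: "real \<Rightarrow> (real \<times> real \<Rightarrow> real) \<Rightarrow> real \<Rightarrow> real \<Rightarrow> ennreal" where
  "mixed_modulus p f u v = (SUP (s, t) \<in> {0..u} \<times> {0..v}. Lp_norm p (mixed_diff s t f))"

definition K_fun :: "real \<Rightarrow> (real \<times> real \<Rightarrow> real) \<Rightarrow> ennreal" where
  "K_fun p f = (\<integral>\<^sup>+ t \<in> {0<..1}.
     ennreal (t powr (- 1 / p) / t) * (mixed_modulus p f t 1 + mixed_modulus p f 1 t) \<partial>lborel)"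

definition I_fun :: "real \<Rightarrow> (real \<times> real \<Rightarrow> real) \<Rightarrow> ennreal" where
  "I_fun p f = (\<integral>\<^sup>+ v \<in> {0<..1}. (\<integral>\<^sup>+ u \<in> {0<..1}.
     ennreal ((u * v) powr (- 1 / p) / (u * v)) * mixed_modulus p f u v \<partial>lborel) \<partial>lborel)"

text \<open>A partition \<open>x\<^sub>0 < \<dots> < x\<^sub>n = x\<^sub>0 + 1\<close> is a pair of \<open>n\<close> and a sequence of which only the
  values at \<open>0, \<dots>, n\<close> matter; the condition forces \<open>n \<ge> 1\<close>.\<close>

definition period_partitions :: "(nat \<times> (nat \<Rightarrow> real)) set" where
  "period_partitions = {(n, x). strict_mono_on {0..n} x \<and> x n = x 0 + 1}"

definition p_variation :: "real \<Rightarrow> (real \<Rightarrow> real) \<Rightarrow> ennreal" where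
  "p_variation p h = (SUP (n, x) \<in> period_partitions.
     ennreal ((\<Sum>k<n. \<bar>h (x (Suc k)) - h (x k)\<bar> powr p) powr (1 / p)))"

definition V_space :: "real \<Rightarrow> (real \<Rightarrow> real) set" where
  "V_space p = {h. periodic1 h \<and> p_variation p h < \<infinity>}"

definition p_variation2 :: "real \<Rightarrow> (real \<times> real \<Rightarrow> real) \<Rightarrow> ennreal" where
  "p_variation2 p g = (SUP ((m, x), (n, y)) \<in> period_partitions \<times> period_partitions.
     ennreal ((\<Sum>i<m. \<Sum>j<n.
       \<bar>g (x (Suc i), y (Suc j)) - g (x (Suc i), y j) - g (x i, y (Suc j)) + g (x i, y j)\<bar> powr p)
         powr (1 / p)))"

definition H2_space :: "real \<Rightarrow> (real \<times> real \<Rightarrow> real) set" where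
  "H2_space p = {g. periodic2 g \<and> p_variation2 p g < \<infinity> \<and>
     (\<forall>x. (\<lambda>y. g (x, y)) \<in> V_space p) \<and> (\<forall>y. (\<lambda>x. g (x, y)) \<in> V_space p)}"

end

theory Submission
  imports Defs
begin

text \<open>Write \<open>S\<^sub>h\<close> and \<open>T\<^sub>k\<close> for the Steklov means of steps \<open>h\<close> and \<open>k\<close> in the first and the second variable.
By periodicity \<open>S\<^sub>1\<close> and \<open>T\<^sub>1\<close> are the averages over a period, so that \<open>f\<close> differs from
\<open>F = (1 - S\<^sub>1)(1 - T\<^sub>1) f\<close> only by a function of \<open>x\<close> plus a function of \<open>y\<close>, and by nothing at all
if \<open>f\<close> has vanishing means. The function \<open>g\<close> is the continuous representative of \<open>F\<close>. It is the sum of the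
double telescoping series of the blocks \<open>(S\<^bsub>h(n+1)\<^esub> - S\<^bsub>h(n)\<^esub>)(T\<^bsub>h(m+1)\<^esub> - T\<^bsub>h(m)\<^esub>) f\<close>
on the geometric mesh \<open>h(n) = L\<^bsup>-n\<^esup>\<close>.

One estimate on the line carries the proof: the \<open>p\<close>-variation of \<open>S\<^sub>a G\<close> is at most
\<open>4 a\<^bsup>-1/p\<^esup>\<close> times the \<open>p\<close>-norm of \<open>G\<close> (lemma \<open>steklov_variation\<close>). When \<open>h = L k\<close> with an integer \<open>L\<close>, the
difference \<open>S\<^sub>k G - S\<^sub>h G\<close> is, up to sign, the average over \<open>j < L\<close> of
\<open>S\<^sub>k (\<Delta>\<^bsub>jk\<^esub> G) = j S\<^bsub>jk\<^esub> (\<Delta>\<^sub>k G)\<close>. The first form bounds its variation by the modulus at the coarse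
step \<open>h\<close>, the second by the modulus at the fine step \<open>k\<close> (lemma \<open>steklov_diff_p_variation\<close>). Both bounds are linear
in \<open>p\<close>-th powers, so Tonelli turns them into bounds for the blocks in two variables.

The factor \<open>1/(p p')\<close> comes from the choice of \<open>L\<close>. With \<open>L\<close> near \<open>2\<^sup>p\<close> the weight
\<open>t\<^bsup>-1/p\<^esup> / t\<close> has on each octave \<open>(h(n+1), h(n)]\<close> a mass at least \<open>p/2\<close> times \<open>h(n+1)\<^bsup>-1/p\<^esup>\<close>,
which yields a factor \<open>1/p\<close> in each variable. With \<open>L\<close> near \<open>2\<^bsup>p'\<^esup>\<close> the same happens with
\<open>1/p'\<close>, now because \<open>\<omega>(t)/t\<close> is almost decreasing. The first choice is made for \<open>p \<ge> 2\<close> and the second for \<open>p < 2\<close>;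
in either case the gain is comparable with \<open>1/(p p')\<close> (lemma \<open>block_bounds\<close>).

The blocks have mean zero in each variable, so their \<open>v\<^sub>p\<^sup>(\<^sup>2\<^sup>)\<close>-variation dominates their supremum
(lemma \<open>mean_zero_sup_le\<close>) and the series converges uniformly to a continuous function. Its partial sums also
converge to \<open>F\<close> in the mean: their distance to \<open>F\<close> is bounded by \<open>2 \<omega>(h, 1) + \<omega>(1, h)\<close> with \<open>h = h(N)\<close>, which tends to
zero because \<open>I\<^sub>p(f)\<close> is finite (lemma \<open>uniform_limit_eq_centered\<close>). Hence \<open>g = F\<close> almost everywhere.\<close>

section \<open>Power inequalities and periodic functions\<close>

text \<open>The graph of a convex power lies above its tangent at \<open>c\<close>. Jensen's, Minkowski's and Young's inequalities below
are all obtained by integrating or adding this one inequality for a suitable \<open>c\<close>.\<close>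
lemma powr_tangent:
  fixes t c p :: real
  assumes "0 \<le> t" "0 < c" "1 \<le> p"
  shows "c powr p + p * c powr (p - 1) * (t - c) \<le> t powr p"
proof (cases "t = 0")
  case True
  have "c powr p = c powr (p - 1) * c"
    using assms by (simp add: powr_diff)
  then have "c powr p + p * c powr (p - 1) * (t - c) = (1 - p) * c powr p"
    using True by (simp add: algebra_simps)
  also have "\<dots> \<le> 0"
    using assms by (simp add: mult_nonpos_nonneg)
  finally show ?thesis using True by simp
next
  case False
  have "t powr p - c powr p \<ge> (p * c powr (p - 1)) * (t - c)"
  proof (rule convex_on_imp_above_tangent)
    show "convex_on {0<..} (\<lambda>x. x powr p)" by (rule powr_convex[OF assms(3)])
    show "connected {0::real<..}" by simp
    show "c \<in> interior {0<..}" using assms by (simp add: interior_open)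
    show "t \<in> {0<..}" using False assms by simp
    have "((\<lambda>x. x powr p) has_real_derivative p * c powr (p - 1)) (at c)"
      using assms by (auto intro!: derivative_eq_intros simp: powr_diff)
    then show "((\<lambda>x. x powr p) has_real_derivative p * c powr (p - 1)) (at c within {0<..})"
      by (rule has_field_derivative_at_within)
  qed
  then show ?thesis by linarith
qed

text \<open>The tangent is taken at the mean of \<open>\<bar>g\<bar>\<close>. The right-hand side may be infinite.\<close>
lemma jensen_powr:
  fixes g :: "'a \<Rightarrow> real"
  assumes M: "emeasure M (space M) = 1" and g: "integrable M g" and p: "1 \<le> p"
  shows "ennreal (\<bar>\<integral>x. g x \<partial>M\<bar> powr p) \<le> (\<integral>\<^sup>+x. ennreal (\<bar>g x\<bar> powr p) \<partial>M)"
proof -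
  interpret finite_measure M by (rule finite_measureI) (simp add: M)
  have m1: "measure M (space M) = 1" by (simp add: measure_def M)
  note [measurable] = borel_measurable_integrable[OF g]
  define c where "c = (\<integral>x. \<bar>g x\<bar> \<partial>M)"
  have c: "\<bar>\<integral>x. g x \<partial>M\<bar> \<le> c" unfolding c_def by (rule integral_abs_bound)
  show ?thesis
  proof (cases "c = 0 \<or> (\<integral>\<^sup>+x. ennreal (\<bar>g x\<bar> powr p) \<partial>M) = \<infinity>")
    case True
    then show ?thesis using c by auto
  next
    case False
    then have c0: "c > 0" using c by linarith
    have fin: "(\<integral>\<^sup>+x. ennreal (\<bar>g x\<bar> powr p) \<partial>M) < \<infinity>" using False by (simp add: less_top)
    have int: "integrable M (\<lambda>x. \<bar>g x\<bar> powr p)"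
      by (rule integrableI_bounded) (use fin in auto)
    have "c powr p = (\<integral>x. c powr p + p * c powr (p - 1) * (\<bar>g x\<bar> - c) \<partial>M)"
      using g by (simp add: m1 c_def)
    also have "\<dots> \<le> (\<integral>x. \<bar>g x\<bar> powr p \<partial>M)"
      using g int by (intro integral_mono powr_tangent) (auto simp: c0 p)
    finally have "c powr p \<le> (\<integral>x. \<bar>g x\<bar> powr p \<partial>M)" .
    then have "\<bar>\<integral>x. g x \<partial>M\<bar> powr p \<le> (\<integral>x. \<bar>g x\<bar> powr p \<partial>M)"
      using c p by (meson abs_ge_zero order_trans powr_mono2 zero_le_one)
    then show ?thesis
      by (simp add: nn_integral_eq_integral[OF int] ennreal_leI)
  qed
qed

lemma jensen_powr_sum:
  fixes a :: "'a \<Rightarrow> real"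
  assumes I: "finite I" and p: "1 \<le> p"
  shows "\<bar>\<Sum>i\<in>I. a i\<bar> powr p \<le> real (card I) powr (p - 1) * (\<Sum>i\<in>I. \<bar>a i\<bar> powr p)"
proof (cases "(\<Sum>i\<in>I. \<bar>a i\<bar>) = 0")
  case True
  then have "\<bar>\<Sum>i\<in>I. a i\<bar> = 0" using sum_abs[of a I] by linarith
  then show ?thesis by (simp add: sum_nonneg)
next
  case False
  define s where "s = (\<Sum>i\<in>I. \<bar>a i\<bar>)"
  define n where "n = real (card I)"
  have s: "s > 0" using False by (simp add: s_def order_less_le sum_nonneg)
  have n: "n > 0" using False I unfolding n_def by (cases "I = {}") (auto simp: card_gt_0_iff)
  have "(\<Sum>i\<in>I. (s/n) powr p + p * (s/n) powr (p - 1) * (\<bar>a i\<bar> - s/n)) \<le> (\<Sum>i\<in>I. \<bar>a i\<bar> powr p)"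
    using s n p by (intro sum_mono powr_tangent) auto
  also have "(\<Sum>i\<in>I. (s/n) powr p + p * (s/n) powr (p - 1) * (\<bar>a i\<bar> - s/n)) = n * (s/n) powr p"
    using n by (simp add: sum.distrib sum_subtractf flip: sum_distrib_left s_def n_def)
  finally have "n powr (p-1) * (n * (s/n) powr p) \<le> n powr (p-1) * (\<Sum>i\<in>I. \<bar>a i\<bar> powr p)"
    using n by (intro mult_left_mono) auto
  moreover have "n powr (p-1) * (n * (s/n) powr p) = s powr p"
    using n s by (simp add: powr_divide powr_diff)
  moreover have "\<bar>\<Sum>i\<in>I. a i\<bar> powr p \<le> s powr p"
    using p unfolding s_def by (intro powr_mono2 sum_abs) auto
  ultimately show ?thesis unfolding n_def by linarith
qed

lemma minkowski_sum:
  fixes a b :: "'a \<Rightarrow> real"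
  assumes p: "1 \<le> p"
  shows "(\<Sum>i\<in>I. \<bar>a i + b i\<bar> powr p) powr (1/p)
    \<le> (\<Sum>i\<in>I. \<bar>a i\<bar> powr p) powr (1/p) + (\<Sum>i\<in>I. \<bar>b i\<bar> powr p) powr (1/p)"
proof (cases "finite I")
  case I: True
  define A where "A = (\<Sum>i\<in>I. \<bar>a i\<bar> powr p) powr (1/p)"
  define B where "B = (\<Sum>i\<in>I. \<bar>b i\<bar> powr p) powr (1/p)"
  have AB: "A \<ge> 0" "B \<ge> 0" by (auto simp: A_def B_def)
  have Ap: "(\<Sum>i\<in>I. \<bar>a i\<bar> powr p) = A powr p" and Bp: "(\<Sum>i\<in>I. \<bar>b i\<bar> powr p) = B powr p"
    using p by (simp_all add: A_def B_def powr_powr sum_nonneg)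
  have "(\<Sum>i\<in>I. \<bar>a i + b i\<bar> powr p) \<le> (A + B) powr p"
  proof (cases "A = 0 \<or> B = 0")
    case True
    then show ?thesis
    proof
      assume "A = 0"
      then have "\<forall>i\<in>I. a i = 0" using Ap I by (simp add: sum_nonneg_eq_0_iff)
      then show ?thesis using Bp \<open>A = 0\<close> by simp
    next
      assume "B = 0"
      then have "\<forall>i\<in>I. b i = 0" using Bp I by (simp add: sum_nonneg_eq_0_iff)
      then show ?thesis using Ap \<open>B = 0\<close> by simp
    qed
  next
    case False
    then have pos: "A > 0" "B > 0" using AB by auto
    \<comment> \<open>Tangent at \<open>c = (x + y) / (A + B)\<close> taken at the two points \<open>x / A\<close> and \<open>y / B\<close>.\<close>
    have key: "(x + y) powr p \<le> (A + B) powr (p - 1) * (A * (x / A) powr p + B * (y / B) powr p)"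
      if xy: "x \<ge> 0" "y \<ge> 0" for x y
    proof (cases "x + y = 0")
      case True then show ?thesis using pos by simp
    next
      case False
      define c where "c = (x + y) / (A + B)"
      have c: "c > 0" using False xy pos unfolding c_def by (intro divide_pos_pos) auto
      have "A * (c powr p + p * c powr (p - 1) * (x / A - c))
          + B * (c powr p + p * c powr (p - 1) * (y / B - c)) \<le> A * (x / A) powr p + B * (y / B) powr p"
        using pos xy c p by (intro add_mono mult_left_mono powr_tangent) auto
      also have "A * (c powr p + p * c powr (p - 1) * (x / A - c))
          + B * (c powr p + p * c powr (p - 1) * (y / B - c))
          = (A + B) * c powr p + p * c powr (p - 1) * (x + y - (A + B) * c)"
        using pos by (simp add: field_simps)
      also have "\<dots> = (A + B) * c powr p" using pos by (simp add: c_def)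
      finally have "(A + B) powr (p-1) * ((A + B) * c powr p)
          \<le> (A + B) powr (p-1) * (A * (x / A) powr p + B * (y / B) powr p)"
        by (intro mult_left_mono) auto
      moreover have "(A + B) powr (p-1) * ((A + B) * c powr p) = (x + y) powr p"
        using pos xy unfolding c_def by (simp add: powr_divide powr_diff)
      ultimately show ?thesis by simp
    qed
    have "(\<Sum>i\<in>I. \<bar>a i + b i\<bar> powr p) \<le> (\<Sum>i\<in>I. (\<bar>a i\<bar> + \<bar>b i\<bar>) powr p)"
      using p by (intro sum_mono powr_mono2 abs_triangle_ineq) auto
    also have "\<dots> \<le> (\<Sum>i\<in>I. (A + B) powr (p - 1) * (A * (\<bar>a i\<bar> / A) powr p + B * (\<bar>b i\<bar> / B) powr p))"
      by (intro sum_mono key) auto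
    also have "\<dots> = (A + B) powr (p - 1) * (A * ((\<Sum>i\<in>I. \<bar>a i\<bar> powr p) / A powr p)
        + B * ((\<Sum>i\<in>I. \<bar>b i\<bar> powr p) / B powr p))"
      unfolding sum_distrib_left[symmetric]
      by (simp add: powr_divide sum.distrib sum_distrib_left sum_divide_distrib)
    also have "\<dots> = (A + B) powr (p - 1) * (A + B)"
      using pos by (simp add: Ap Bp)
    also have "\<dots> = (A + B) powr p" using pos by (simp add: powr_diff)
    finally show ?thesis .
  qed
  then have "(\<Sum>i\<in>I. \<bar>a i + b i\<bar> powr p) powr (1/p) \<le> ((A + B) powr p) powr (1/p)"
    using p by (intro powr_mono2) (auto simp: sum_nonneg)
  then show ?thesis using p AB by (simp add: powr_powr flip: A_def B_def)
qed simp

text \<open>Averages over a period are integrals against this probability measure. It lives on the whole line and carries the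
Borel sets, so that translations and dilations of the argument stay measurable without side conditions.\<close>
definition unit_leb :: "real measure" where
  "unit_leb = density lborel (\<lambda>x. ennreal (indicator {0..1} x))"

lemma sets_unit_leb [simp, measurable_cong]: "sets unit_leb = sets borel"
  by (simp add: unit_leb_def)

lemma space_unit_leb [simp]: "space unit_leb = UNIV"
  by (simp add: unit_leb_def)

lemma nn_integral_unit_leb:
  assumes [measurable]: "g \<in> borel_measurable borel"
  shows "(\<integral>\<^sup>+x. g x \<partial>unit_leb) = (\<integral>\<^sup>+x\<in>{0..1}. g x \<partial>lborel)"
  unfolding unit_leb_def
  by (subst nn_integral_density) (auto simp: mult.commute ennreal_indicator)

lemma emeasure_unit_leb [simp]: "emeasure unit_leb UNIV = 1"
  using nn_integral_unit_leb[of "\<lambda>_. 1"] by simp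

interpretation unit_leb: finite_measure unit_leb
  by (rule finite_measureI) simp

lemma measure_unit_leb [simp]: "measure unit_leb UNIV = 1"
  by (simp add: measure_def)

interpretation unit_pair: pair_sigma_finite unit_leb unit_leb ..

lemma AE_unit_leb:
  "Measurable.pred borel P \<Longrightarrow> (AE x in unit_leb. P x) \<longleftrightarrow> (AE x in lborel. x \<in> {0..1} \<longrightarrow> P x)"
  unfolding unit_leb_def by (subst AE_density) (auto simp: indicator_def)

lemma AE_unit_measureI:
  "(AE x in lborel. P x) \<Longrightarrow> (AE x in unit_leb. P x)"
  unfolding unit_leb_def by (subst AE_density) auto


lemma periodic_of_int:
  fixes g :: "real \<Rightarrow> 'a"
  assumes "\<And>x. g (x + 1) = g x"
  shows "g (x + of_int k) = g x"
proof (induction k arbitrary: x rule: int_induct[where k=0])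
  case base then show ?case by simp
next
  case (step1 i)
  then show ?case using assms[of "x + of_int i"] by (simp add: add.assoc)
next
  case (step2 i)
  then show ?case using assms[of "x + of_int (i - 1)"] by (simp add: algebra_simps)
qed

lemma nn_integral_period:
  fixes g :: "real \<Rightarrow> ennreal"
  assumes [measurable]: "g \<in> borel_measurable borel" and per: "\<And>x. g (x + 1) = g x"
  shows "(\<integral>\<^sup>+x\<in>{a..a+1}. g x \<partial>lborel) = (\<integral>\<^sup>+x. g x \<partial>unit_leb)"
proof -
  define r where "r = frac a"
  have r: "0 \<le> r" "r < 1" by (auto simp: r_def frac_lt_1)
  have a: "a = of_int \<lfloor>a\<rfloor> + r" by (simp add: r_def frac_def)
  have "(\<integral>\<^sup>+x\<in>{a..a+1}. g x \<partial>lborel) = (\<integral>\<^sup>+x. g (of_int \<lfloor>a\<rfloor> + x) * indicator {a..a+1} (of_int \<lfloor>a\<rfloor> + x) \<partial>lborel)"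
    using nn_integral_real_affine[of "\<lambda>x. g x * indicator {a..a+1} x" 1 "of_int \<lfloor>a\<rfloor>"] by simp
  also have "\<dots> = (\<integral>\<^sup>+x. g x * indicator {r..r+1} x \<partial>lborel)"
  proof (rule nn_integral_cong)
    fix x
    have "g (of_int \<lfloor>a\<rfloor> + x) = g x" using periodic_of_int[of g, OF per] by (simp add: add.commute)
    moreover have "(of_int \<lfloor>a\<rfloor> + x \<in> {a..a+1}) = (x \<in> {r..r+1})" using a by auto
    ultimately show "g (of_int \<lfloor>a\<rfloor> + x) * indicator {a..a+1} (of_int \<lfloor>a\<rfloor> + x) = g x * indicator {r..r+1} x"
      by (simp add: indicator_def)
  qed
  also have "\<dots> = (\<integral>\<^sup>+x. g x * indicator {r..1} x + g x * indicator {1..r+1} x \<partial>lborel)"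
    using AE_lborel_singleton[of 1] r
    by (intro nn_integral_cong_AE) (auto elim!: eventually_mono simp: indicator_def)
  also have "\<dots> = (\<integral>\<^sup>+x. g x * indicator {r..1} x \<partial>lborel) + (\<integral>\<^sup>+x. g x * indicator {1..r+1} x \<partial>lborel)"
    by (rule nn_integral_add) auto
  also have "(\<integral>\<^sup>+x. g x * indicator {1..r+1} x \<partial>lborel) = (\<integral>\<^sup>+x. g (1 + x) * indicator {1..r+1} (1 + x) \<partial>lborel)"
    using nn_integral_real_affine[of "\<lambda>x. g x * indicator {1..r+1} x" 1 1] by simp
  also have "\<dots> = (\<integral>\<^sup>+x. g x * indicator {0..r} x \<partial>lborel)"
    using per by (intro nn_integral_cong) (auto simp: indicator_def add.commute)
  also have "(\<integral>\<^sup>+x. g x * indicator {r..1} x \<partial>lborel) + (\<integral>\<^sup>+x. g x * indicator {0..r} x \<partial>lborel)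
    = (\<integral>\<^sup>+x. g x * indicator {r..1} x + g x * indicator {0..r} x \<partial>lborel)"
    by (rule nn_integral_add[symmetric]) auto
  also have "\<dots> = (\<integral>\<^sup>+x\<in>{0..1}. g x \<partial>lborel)"
    using AE_lborel_singleton[of r] r
    by (intro nn_integral_cong_AE) (auto elim!: eventually_mono simp: indicator_def)
  finally show ?thesis by (simp add: nn_integral_unit_leb)
qed

lemma nn_integral_unit_affine:
  fixes g :: "real \<Rightarrow> ennreal"
  assumes [measurable]: "g \<in> borel_measurable borel" and h: "h > 0"
  shows "ennreal h * (\<integral>\<^sup>+s. g (x + h * s) \<partial>unit_leb) = (\<integral>\<^sup>+y\<in>{x..x+h}. g y \<partial>lborel)"
proof -
  have "(\<integral>\<^sup>+y\<in>{x..x+h}. g y \<partial>lborel) = ennreal h * (\<integral>\<^sup>+s. g (x + h * s) * indicator {x..x+h} (x + h * s) \<partial>lborel)"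
    using nn_integral_real_affine[of "\<lambda>y. g y * indicator {x..x+h} y" h x] h by simp
  also have "(\<integral>\<^sup>+s. g (x + h * s) * indicator {x..x+h} (x + h * s) \<partial>lborel) = (\<integral>\<^sup>+s\<in>{0..1}. g (x + h * s) \<partial>lborel)"
    using h by (intro nn_integral_cong) (auto simp: indicator_def mult_le_cancel_left1 zero_le_mult_iff)
  finally show ?thesis by (simp add: nn_integral_unit_leb)
qed

lemma nn_integral_unit_shift:
  fixes g :: "real \<Rightarrow> ennreal"
  assumes [measurable]: "g \<in> borel_measurable borel" and per: "\<And>x. g (x + 1) = g x"
  shows "(\<integral>\<^sup>+s. g (s + c) \<partial>unit_leb) = (\<integral>\<^sup>+s. g s \<partial>unit_leb)"
  using nn_integral_unit_affine[of g 1 c] nn_integral_period[of g c] per by (simp add: add.commute)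

section \<open>Variation of Steklov means on the line\<close>

text \<open>Integrability over one period amounts to local integrability, by \<open>Lper1_set_integrable\<close>.\<close>
definition Lper1 :: "(real \<Rightarrow> real) set" where
  "Lper1 = {G. G \<in> borel_measurable borel \<and> periodic1 G \<and> integrable unit_leb G}"

text \<open>The Steklov mean \<open>h\<^sup>-\<^sup>1 \<integral> G\<close> over \<open>[x, x + h]\<close>, rescaled to the unit interval. For \<open>h = 1\<close> it is
the mean value over a period.\<close>
definition steklov :: "real \<Rightarrow> (real \<Rightarrow> real) \<Rightarrow> real \<Rightarrow> real" where
  "steklov h G x = (\<integral>s. G (x + h * s) \<partial>unit_leb)"

definition primitive :: "(real \<Rightarrow> real) \<Rightarrow> real \<Rightarrow> real" where
  "primitive G x = (LBINT y=0..x. G y)"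

lemma Lper1_measurable [measurable_dest]: "G \<in> Lper1 \<Longrightarrow> G \<in> borel_measurable borel"
  and Lper1_periodic: "G \<in> Lper1 \<Longrightarrow> G (x + 1) = G x"
  and Lper1_integrable: "G \<in> Lper1 \<Longrightarrow> integrable unit_leb G"
  by (auto simp: Lper1_def periodic1_def)

lemma nn_integral_Icc_split:
  fixes g :: "real \<Rightarrow> ennreal"
  assumes [measurable]: "g \<in> borel_measurable borel" and "a \<le> b" "b \<le> c"
  shows "(\<integral>\<^sup>+x\<in>{a..c}. g x \<partial>lborel) = (\<integral>\<^sup>+x\<in>{a..b}. g x \<partial>lborel) + (\<integral>\<^sup>+x\<in>{b..c}. g x \<partial>lborel)"
proof -
  have "(\<integral>\<^sup>+x\<in>{a..c}. g x \<partial>lborel) = (\<integral>\<^sup>+x. g x * indicator {a..b} x + g x * indicator {b..c} x \<partial>lborel)"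
    using AE_lborel_singleton[of b] assms(2,3)
    by (intro nn_integral_cong_AE) (auto elim!: eventually_mono simp: indicator_def)
  then show ?thesis by (simp add: nn_integral_add)
qed

lemma nn_integral_partition:
  fixes g :: "real \<Rightarrow> ennreal"
  assumes [measurable]: "g \<in> borel_measurable borel" and x: "strict_mono_on {0..n} x"
  shows "(\<Sum>i<n. \<integral>\<^sup>+y\<in>{x i + c..x (Suc i) + c}. g y \<partial>lborel) = (\<integral>\<^sup>+y\<in>{x 0 + c..x n + c}. g y \<partial>lborel)"
proof -
  have mono: "i \<le> j \<Longrightarrow> j \<le> n \<Longrightarrow> x i \<le> x j" for i j
    using strict_mono_on_leD[OF x, of i j] by auto
  have "k \<le> n \<Longrightarrow> (\<Sum>i<k. \<integral>\<^sup>+y\<in>{x i + c..x (Suc i) + c}. g y \<partial>lborel) = (\<integral>\<^sup>+y\<in>{x 0 + c..x k + c}. g y \<partial>lborel)" for k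
  proof (induction k)
    case 0
    have "(\<integral>\<^sup>+y\<in>{x 0 + c..x 0 + c}. g y \<partial>lborel) = (\<integral>\<^sup>+y. 0 \<partial>(lborel::real measure))"
      using AE_lborel_singleton[of "x 0 + c"]
      by (intro nn_integral_cong_AE) (auto elim!: eventually_mono simp: indicator_def)
    then show ?case by simp
  next
    case (Suc k)
    have "x 0 + c \<le> x k + c" "x k + c \<le> x (Suc k) + c" using mono[of 0 k] mono[of k "Suc k"] Suc.prems by auto
    from nn_integral_Icc_split[OF assms(1) this] show ?case
      using Suc by (simp only: sum.lessThan_Suc Suc_leD)
  qed
  then show ?thesis by blast
qed

lemma Lper1_set_integrable:
  assumes G: "G \<in> Lper1"
  shows "set_integrable lborel {a..b} G"
proof -
  note [measurable] = Lper1_measurable[OF G]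
  define I where "I n = (\<integral>\<^sup>+x\<in>{a..a + real n}. ennreal \<bar>G x\<bar> \<partial>lborel)" for n
  have fin: "(\<integral>\<^sup>+x. ennreal \<bar>G x\<bar> \<partial>unit_leb) < \<infinity>"
    using Lper1_integrable[OF G] by (simp add: integrable_iff_bounded)
  have "I n < \<infinity>" for n
  proof (induction n)
    case 0
    have "I 0 = (\<integral>\<^sup>+y. 0 \<partial>(lborel::real measure))" unfolding I_def
      using AE_lborel_singleton[of a]
      by (intro nn_integral_cong_AE) (auto elim!: eventually_mono simp: indicator_def)
    then show ?case by simp
  next
    case (Suc n)
    have "I (Suc n) = I n + (\<integral>\<^sup>+x\<in>{a + real n..a + real n + 1}. ennreal \<bar>G x\<bar> \<partial>lborel)"
      unfolding I_def using nn_integral_Icc_split[of "\<lambda>x. ennreal \<bar>G x\<bar>" a "a + real n" "a + real n + 1"]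
      by (simp add: add_ac)
    also have "\<dots> = I n + (\<integral>\<^sup>+x. ennreal \<bar>G x\<bar> \<partial>unit_leb)"
      by (subst nn_integral_period) (auto simp: Lper1_periodic[OF G])
    also have "\<dots> < \<infinity>" using Suc fin by simp
    finally show ?case .
  qed
  moreover obtain n where "b \<le> a + real n" using real_arch_simple[of "b - a"] by (auto simp: algebra_simps)
  then have "(\<integral>\<^sup>+x\<in>{a..b}. ennreal \<bar>G x\<bar> \<partial>lborel) \<le> I n"
    unfolding I_def by (intro nn_integral_mono) (auto simp: indicator_def)
  ultimately have "(\<integral>\<^sup>+x\<in>{a..b}. ennreal \<bar>G x\<bar> \<partial>lborel) < \<infinity>" by (meson order_le_less_trans)
  moreover have "(\<integral>\<^sup>+x. ennreal (norm (indicator {a..b} x *\<^sub>R G x)) \<partial>lborel) = (\<integral>\<^sup>+x\<in>{a..b}. ennreal \<bar>G x\<bar> \<partial>lborel)"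
    by (intro nn_integral_cong) (auto simp: indicator_def)
  ultimately show ?thesis
    unfolding set_integrable_def by (intro integrableI_bounded) auto
qed

text \<open>Through a primitive, every identity between Steklov means and their differences becomes linear algebra in values of
one function.\<close>
lemma primitive_diff:
  assumes G: "G \<in> Lper1" and "a \<le> b"
  shows "primitive G b - primitive G a = (LINT y:{a..b}|lborel. G y)"
proof -
  have *: "interval_lebesgue_integrable lborel (ereal c) (ereal d) G" for c d
    using set_integrable_subset[OF Lper1_set_integrable[OF G, of c d], of "{c<..<d}", OF _ greaterThanLessThan_subseteq_atLeastAtMost_iff[THEN iffD2]]
      set_integrable_subset[OF Lper1_set_integrable[OF G, of d c], of "{d<..<c}", OF _ greaterThanLessThan_subseteq_atLeastAtMost_iff[THEN iffD2]]
    by (auto simp: interval_lebesgue_integrable_def)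
  have "(LBINT y=ereal 0..ereal a. G y) + (LBINT y=ereal a..ereal b. G y) = (LBINT y=ereal 0..ereal b. G y)"
    by (rule interval_integral_sum) (metis * ereal_max ereal_min)
  then show ?thesis using assms(2) by (simp add: primitive_def interval_integral_Icc zero_ereal_def)
qed

lemma Lper1_affine_integrable:
  assumes G: "G \<in> Lper1" and h: "h > 0"
  shows "integrable unit_leb (\<lambda>s. G (x + h * s))"
    and "(\<integral>s. G (x + h * s) \<partial>unit_leb) = (LINT y:{x..x+h}|lborel. G y) / h"
proof -
  note [measurable] = Lper1_measurable[OF G]
  have ind: "indicator {0..1} s *\<^sub>R G (x + h * s) = indicator {x..x+h} (x + h * s) *\<^sub>R G (x + h * s)" for s
    using h by (auto simp: indicator_def mult_le_cancel_left1 zero_le_mult_iff)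
  have "integrable lborel (\<lambda>s. indicator {x..x+h} (x + h * s) *\<^sub>R G (x + h * s))"
    using lborel_integrable_real_affine[of "\<lambda>y. indicator {x..x+h} y *\<^sub>R G y" h x]
      Lper1_set_integrable[OF G, of x "x+h"] h unfolding set_integrable_def by simp
  then show "integrable unit_leb (\<lambda>s. G (x + h * s))"
    unfolding unit_leb_def by (subst integrable_density) (auto simp: ind[unfolded real_scaleR_def])
  have "(\<integral>s. G (x + h * s) \<partial>unit_leb) = (\<integral>s. indicator {x..x+h} (x + h * s) *\<^sub>R G (x + h * s) \<partial>lborel)"
    unfolding unit_leb_def by (subst integral_density) (auto simp: ind[unfolded real_scaleR_def])
  then show "(\<integral>s. G (x + h * s) \<partial>unit_leb) = (LINT y:{x..x+h}|lborel. G y) / h"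
    using lborel_integral_real_affine[of h "\<lambda>y. indicator {x..x+h} y *\<^sub>R G y" x] h
    unfolding set_lebesgue_integral_def by simp
qed

lemma steklov_eq_primitive:
  assumes G: "G \<in> Lper1" and h: "h > 0"
  shows "steklov h G x = (primitive G (x + h) - primitive G x) / h"
  using Lper1_affine_integrable(2)[OF assms] primitive_diff[OF G, of x "x+h"] h by (simp add: steklov_def)

lemma Lper1_shift:
  assumes G: "G \<in> Lper1" shows "(\<lambda>x. G (x + c)) \<in> Lper1"
proof -
  have "integrable unit_leb (\<lambda>s. G (c + 1 * s))" by (rule Lper1_affine_integrable[OF G]) simp
  then show ?thesis using Lper1_measurable[OF G] Lper1_periodic[OF G, of "_ + c"]
    by (auto simp: Lper1_def periodic1_def add_ac)
qed

lemma Lper1_diff: "F \<in> Lper1 \<Longrightarrow> G \<in> Lper1 \<Longrightarrow> (\<lambda>x. F x - G x) \<in> Lper1"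
  by (auto simp: Lper1_def periodic1_def)

lemma steklov_minus:
  assumes "F \<in> Lper1" "G \<in> Lper1" "h > 0"
  shows "steklov h (\<lambda>x. F x - G x) x = steklov h F x - steklov h G x"
  using assms by (simp add: steklov_def Lper1_affine_integrable)

lemma steklov_sum:
  assumes "\<And>i. i \<in> I \<Longrightarrow> F i \<in> Lper1" "h > 0"
  shows "steklov h (\<lambda>x. \<Sum>i\<in>I. F i x) x = (\<Sum>i\<in>I. steklov h (F i) x)"
  using assms by (simp add: steklov_def Lper1_affine_integrable)

lemma steklov_shift: "steklov h (\<lambda>x. G (x + c)) x = steklov h G (x + c)"
  by (simp add: steklov_def add_ac)

lemma primitive_jensen:
  assumes G: "G \<in> Lper1" and "a \<le> b" and p: "1 < p"
  shows "ennreal (\<bar>primitive G b - primitive G a\<bar> powr p)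
    \<le> ennreal ((b - a) powr (p - 1)) * (\<integral>\<^sup>+y\<in>{a..b}. ennreal (\<bar>G y\<bar> powr p) \<partial>lborel)"
proof (cases "a = b")
  case True then show ?thesis by simp
next
  case False
  define h where "h = b - a"
  have h: "h > 0" using False assms(2) by (simp add: h_def)
  have b: "b = a + h" by (simp add: h_def)
  note [measurable] = Lper1_measurable[OF G]
  have "primitive G b - primitive G a = h * steklov h G a" using steklov_eq_primitive[OF G h] h b by simp
  then have "ennreal (\<bar>primitive G b - primitive G a\<bar> powr p) = ennreal (h powr p) * ennreal (\<bar>steklov h G a\<bar> powr p)"
    using h by (simp add: abs_mult powr_mult ennreal_mult)
  also have "\<dots> \<le> ennreal (h powr p) * (\<integral>\<^sup>+s. ennreal (\<bar>G (a + h * s)\<bar> powr p) \<partial>unit_leb)"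
    unfolding steklov_def using p by (intro mult_left_mono jensen_powr Lper1_affine_integrable[OF G h]) auto
  also have "h powr p = h powr (p - 1) * h" using h by (simp add: powr_diff)
  also have "ennreal (h powr (p - 1) * h) * (\<integral>\<^sup>+s. ennreal (\<bar>G (a + h * s)\<bar> powr p) \<partial>unit_leb)
    = ennreal (h powr (p - 1)) * (ennreal h * (\<integral>\<^sup>+s. ennreal (\<bar>G (a + h * s)\<bar> powr p) \<partial>unit_leb))"
    using h by (simp add: ennreal_mult mult.assoc)
  also have "ennreal h * (\<integral>\<^sup>+s. ennreal (\<bar>G (a + h * s)\<bar> powr p) \<partial>unit_leb) = (\<integral>\<^sup>+y\<in>{a..b}. ennreal (\<bar>G y\<bar> powr p) \<partial>lborel)"
    using nn_integral_unit_affine[of "\<lambda>y. ennreal (\<bar>G y\<bar> powr p)" h a] h b by simp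
  finally show ?thesis by (simp add: h_def)
qed

definition powint1 :: "real \<Rightarrow> (real \<Rightarrow> real) \<Rightarrow> ennreal" where
  "powint1 p G = (\<integral>\<^sup>+s. ennreal (\<bar>G s\<bar> powr p) \<partial>unit_leb)"

text \<open>The two integrals over intervals of length \<open>a\<close> that make up the increment overlap if \<open>z - x < a\<close>. What
survives in all cases are two integrals over intervals of length \<open>d = min a (z - x)\<close>, one inside \<open>[x, z]\<close> and
one inside its translate by \<open>a\<close>. Their lengths are at most \<open>a\<close>, which gives the factor \<open>a\<^bsup>p-1\<^esup>\<close> in
Jensen's inequality, and being confined to \<open>[x, z]\<close> they can be added over a partition.\<close>
lemma steklov_increment:
  assumes G: "G \<in> Lper1" and a: "a > 0" and p: "1 < p" and xz: "x \<le> z"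
  shows "ennreal (\<bar>steklov a G z - steklov a G x\<bar> powr p) \<le> ennreal (2 powr p / a) *
    ((\<integral>\<^sup>+y\<in>{x + a..z + a}. ennreal (\<bar>G y\<bar> powr p) \<partial>lborel) + (\<integral>\<^sup>+y\<in>{x..z}. ennreal (\<bar>G y\<bar> powr p) \<partial>lborel))"
    (is "_ \<le> _ * (?I2 + ?I1)")
proof -
  note [measurable] = Lper1_measurable[OF G]
  define d where "d = min a (z - x)"
  have d: "0 \<le> d" "d \<le> a" "d \<le> z - x" using a xz by (auto simp: d_def)
  define A where "A = primitive G (z + a) - primitive G (z + a - d)"
  define B where "B = primitive G (x + d) - primitive G x"
  have eq: "steklov a G z - steklov a G x = (A - B) / a"
    using a unfolding steklov_eq_primitive[OF G a] A_def B_def d_def by (auto simp: min_def field_simps)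
  have A: "ennreal (\<bar>A\<bar> powr p) \<le> ennreal (a powr (p - 1)) * ?I2"
  proof -
    have "ennreal (\<bar>A\<bar> powr p) \<le> ennreal ((z + a - (z + a - d)) powr (p - 1)) * (\<integral>\<^sup>+y\<in>{z + a - d..z + a}. ennreal (\<bar>G y\<bar> powr p) \<partial>lborel)"
      unfolding A_def using d p by (intro primitive_jensen G) auto
    also have "\<dots> \<le> ennreal (a powr (p - 1)) * ?I2"
      using d p by (intro mult_mono ennreal_leI powr_mono2 nn_integral_mono) (auto simp: indicator_def)
    finally show ?thesis .
  qed
  have B: "ennreal (\<bar>B\<bar> powr p) \<le> ennreal (a powr (p - 1)) * ?I1"
  proof -
    have "ennreal (\<bar>B\<bar> powr p) \<le> ennreal ((x + d - x) powr (p - 1)) * (\<integral>\<^sup>+y\<in>{x..x + d}. ennreal (\<bar>G y\<bar> powr p) \<partial>lborel)"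
      unfolding B_def using d p by (intro primitive_jensen G) auto
    also have "\<dots> \<le> ennreal (a powr (p - 1)) * ?I1"
      using d p by (intro mult_mono ennreal_leI powr_mono2 nn_integral_mono) (auto simp: indicator_def)
    finally show ?thesis .
  qed
  have "\<bar>A - B\<bar> powr p \<le> 2 powr p * (\<bar>A\<bar> powr p + \<bar>B\<bar> powr p)"
  proof -
    have "\<bar>A - B\<bar> powr p \<le> (2 * max \<bar>A\<bar> \<bar>B\<bar>) powr p" using p by (intro powr_mono2) auto
    also have "\<dots> = 2 powr p * max \<bar>A\<bar> \<bar>B\<bar> powr p" by (simp add: powr_mult)
    also have "\<dots> \<le> 2 powr p * (\<bar>A\<bar> powr p + \<bar>B\<bar> powr p)" by (intro mult_left_mono) (auto simp: max_def)
    finally show ?thesis .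
  qed
  then have "\<bar>(A - B) / a\<bar> powr p \<le> 2 powr p / a powr p * (\<bar>A\<bar> powr p + \<bar>B\<bar> powr p)"
    using a by (simp add: powr_divide divide_right_mono)
  then have "ennreal (\<bar>steklov a G z - steklov a G x\<bar> powr p) \<le> ennreal (2 powr p / a powr p) * (ennreal (\<bar>A\<bar> powr p) + ennreal (\<bar>B\<bar> powr p))"
    unfolding eq by (metis ennreal_leI ennreal_mult ennreal_plus powr_ge_zero divide_nonneg_nonneg add_nonneg_nonneg)
  also have "\<dots> \<le> ennreal (2 powr p / a powr p) * (ennreal (a powr (p - 1)) * ?I2 + ennreal (a powr (p - 1)) * ?I1)"
    by (intro mult_left_mono add_mono A B) auto
  also have "\<dots> = ennreal (2 powr p / a powr p * a powr (p - 1)) * (?I2 + ?I1)"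
    by (subst ennreal_mult) (auto simp: distrib_left mult.assoc)
  also have "2 powr p / a powr p * a powr (p - 1) = 2 powr p / a"
    using a by (simp add: powr_diff)
  finally show ?thesis .
qed

text \<open>The basic estimate: passing to a Steklov mean of step \<open>a\<close> gains bounded \<open>p\<close>-variation at the price of a factor
\<open>a\<^bsup>-1/p\<^esup>\<close>. The bounds of \<open>steklov_increment\<close> for long and for short intervals have the same form, so they add up
over any partition to two integrals over a period.\<close>
lemma steklov_variation:
  assumes G: "G \<in> Lper1" and a: "a > 0" and p: "1 < p" and part: "(n, x) \<in> period_partitions"
  shows "(\<Sum>i<n. ennreal (\<bar>steklov a G (x (Suc i)) - steklov a G (x i)\<bar> powr p)) \<le> ennreal (4 powr p / a) * powint1 p G"
proof -
  note [measurable] = Lper1_measurable[OF G]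
  let ?g = "\<lambda>y. ennreal (\<bar>G y\<bar> powr p)"
  have x: "strict_mono_on {0..n} x" and xn: "x n = x 0 + 1" using part by (auto simp: period_partitions_def)
  have mono: "i < n \<Longrightarrow> x i \<le> x (Suc i)" for i
    using x by (simp add: strict_mono_on_leD)
  have per: "(\<integral>\<^sup>+y\<in>{c..c + 1}. ?g y \<partial>lborel) = powint1 p G" for c
    unfolding powint1_def by (rule nn_integral_period) (auto simp: Lper1_periodic[OF G])
  have "(\<Sum>i<n. ennreal (\<bar>steklov a G (x (Suc i)) - steklov a G (x i)\<bar> powr p))
    \<le> (\<Sum>i<n. ennreal (2 powr p / a) * ((\<integral>\<^sup>+y\<in>{x i + a..x (Suc i) + a}. ?g y \<partial>lborel) + (\<integral>\<^sup>+y\<in>{x i + 0..x (Suc i) + 0}. ?g y \<partial>lborel)))"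
    using mono by (intro sum_mono, subst add_0_right, subst add_0_right, intro steklov_increment[OF G a p]) auto
  also have "\<dots> = ennreal (2 powr p / a) * ((\<integral>\<^sup>+y\<in>{x 0 + a..x n + a}. ?g y \<partial>lborel) + (\<integral>\<^sup>+y\<in>{x 0 + 0..x n + 0}. ?g y \<partial>lborel))"
    unfolding sum_distrib_left[symmetric] sum.distrib
    by (subst nn_integral_partition[OF _ x], measurable, subst nn_integral_partition[OF _ x], measurable)
  also have "\<dots> = ennreal (2 powr p / a) * (powint1 p G + powint1 p G)"
    using per[of "x 0 + a"] per[of "x 0"] by (simp add: xn add_ac)
  also have "\<dots> = ennreal (2 powr p / a * 2) * powint1 p G"
    using a by (subst ennreal_mult) (auto simp: mult.assoc mult_2)
  also have "\<dots> \<le> ennreal (4 powr p / a) * powint1 p G"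
  proof (intro mult_right_mono ennreal_leI)
    have "2 powr p * 2 powr 1 \<le> 2 powr p * 2 powr p" using p by (intro mult_left_mono powr_mono) auto
    also have "\<dots> = 4 powr p" by (simp flip: powr_mult)
    finally show "2 powr p / a * 2 \<le> 4 powr p / a" using a by (simp add: divide_right_mono)
  qed auto
  finally show ?thesis .
qed

definition shift_diff :: "real \<Rightarrow> (real \<Rightarrow> real) \<Rightarrow> real \<Rightarrow> real" where
  "shift_diff s G x = G (x + s) - G x"

lemma Lper1_shift_diff: "G \<in> Lper1 \<Longrightarrow> shift_diff s G \<in> Lper1"
  using Lper1_diff[OF Lper1_shift] by (simp add: shift_diff_def[abs_def])

lemma steklov_shift_diff:
  assumes "G \<in> Lper1" "h > 0" shows "steklov h (shift_diff s G) x = steklov h G (x + s) - steklov h G x"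
  using steklov_minus[OF Lper1_shift[OF assms(1)] assms] by (simp add: shift_diff_def[abs_def] steklov_shift)

text \<open>Both sides are the second difference of a primitive with steps \<open>h\<close> and \<open>s\<close>, which is symmetric.\<close>
lemma steklov_shift_diff_swap:
  assumes G: "G \<in> Lper1" and "h > 0" "s > 0"
  shows "h * steklov h (shift_diff s G) x = s * steklov s (shift_diff h G) x"
  unfolding steklov_shift_diff[OF G assms(2)] steklov_shift_diff[OF G assms(3)] steklov_eq_primitive[OF G assms(2)] steklov_eq_primitive[OF G assms(3)]
  using assms(2,3) by (simp only: diff_divide_distrib[symmetric]) (simp add: add_ac)

text \<open>A mean of step \<open>l h\<close> is the average of \<open>l\<close> translated means of step \<open>h\<close>. This is why the ratio of consecutive
scales is taken to be an integer.\<close>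
lemma steklov_telescope:
  assumes G: "G \<in> Lper1" and h: "h > 0" and l: "l > 0"
  shows "steklov h G x - steklov (real l * h) G x = - (\<Sum>j<l. steklov h (shift_diff (real j * h) G) x) / real l"
proof -
  have "(\<Sum>j<l. primitive G (x + h + real j * h) - primitive G (x + real j * h)) = primitive G (x + real l * h) - primitive G x"
    by (induction l) (auto simp: algebra_simps)
  then have "(\<Sum>j<l. steklov h G (x + real j * h)) = (primitive G (x + real l * h) - primitive G x) / h"
    using steklov_eq_primitive[OF G h] by (simp add: sum_divide_distrib[symmetric] add_ac)
  also have "\<dots> = real l * steklov (real l * h) G x"
    using steklov_eq_primitive[OF G, of "real l * h"] h l by simp
  finally show ?thesis using l by (simp add: steklov_shift_diff[OF G h] sum_subtractf field_simps)
qed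

text \<open>Two bounds for one function, obtained from the two forms of the terms of \<open>steklov_telescope\<close> related by
\<open>steklov_shift_diff_swap\<close>. The first involves differences up to the coarse step with a constant \<open>4\<^sup>p / h\<close>; it is efficient for
large \<open>p\<close>. The second involves only the fine step with a constant \<open>4\<^sup>p l\<^bsup>p-1\<^esup> / h\<close>; it is efficient for \<open>p\<close>
near 1.\<close>
lemma steklov_diff_p_variation:
  assumes G: "G \<in> Lper1" and h: "h > 0" and l: "l > 0" and p: "1 < p" and part: "(n, x) \<in> period_partitions"
  defines "U \<equiv> \<lambda>x. steklov h G x - steklov (real l * h) G x"
  shows "(\<Sum>i<n. ennreal (\<bar>U (x (Suc i)) - U (x i)\<bar> powr p))
     \<le> (\<Sum>j<l. ennreal (4 powr p / (h * real l)) * powint1 p (shift_diff (real j * h) G))" (is "?L \<le> ?R1")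
    and "(\<Sum>i<n. ennreal (\<bar>U (x (Suc i)) - U (x i)\<bar> powr p))
     \<le> ennreal (4 powr p * real l powr (p - 1) / h) * powint1 p (shift_diff h G)" (is "?L \<le> ?R2")
proof -
  define E where "E j y = steklov h (shift_diff (real j * h) G) y" for j y
  have U: "U z - U y = - (\<Sum>j<l. E j z - E j y) / real l" for z y
    unfolding U_def steklov_telescope[OF G h l] E_def by (simp add: sum_subtractf diff_divide_distrib)
  have "\<bar>U z - U y\<bar> powr p \<le> (\<Sum>j<l. \<bar>E j z - E j y\<bar> powr p) / real l" for z y
  proof -
    have "\<bar>U z - U y\<bar> powr p = \<bar>\<Sum>j<l. E j z - E j y\<bar> powr p / real l powr p"
      unfolding U using l by (simp add: powr_divide)
    also have "\<dots> \<le> (real (card {..<l}) powr (p - 1) * (\<Sum>j<l. \<bar>E j z - E j y\<bar> powr p)) / real l powr p"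
      using p by (intro divide_right_mono jensen_powr_sum) auto
    also have "\<dots> = (\<Sum>j<l. \<bar>E j z - E j y\<bar> powr p) / real l"
      using l by (simp add: powr_diff)
    finally show ?thesis .
  qed
  then have "?L \<le> (\<Sum>i<n. ennreal ((\<Sum>j<l. \<bar>E j (x (Suc i)) - E j (x i)\<bar> powr p) / real l))"
    by (intro sum_mono ennreal_leI)
  also have "\<dots> = (\<Sum>i<n. ennreal (1 / real l) * (\<Sum>j<l. ennreal (\<bar>E j (x (Suc i)) - E j (x i)\<bar> powr p)))"
  proof (rule sum.cong[OF refl])
    fix i
    have "(\<Sum>j<l. \<bar>E j (x (Suc i)) - E j (x i)\<bar> powr p) / real l = 1 / real l * (\<Sum>j<l. \<bar>E j (x (Suc i)) - E j (x i)\<bar> powr p)" by simp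
    then show "ennreal ((\<Sum>j<l. \<bar>E j (x (Suc i)) - E j (x i)\<bar> powr p) / real l) = ennreal (1 / real l) * (\<Sum>j<l. ennreal (\<bar>E j (x (Suc i)) - E j (x i)\<bar> powr p))"
      by (simp only:) (subst ennreal_mult, auto intro!: sum_nonneg)
  qed
  also have "\<dots> = ennreal (1 / real l) * (\<Sum>j<l. \<Sum>i<n. ennreal (\<bar>E j (x (Suc i)) - E j (x i)\<bar> powr p))"
    unfolding sum_distrib_left[symmetric] by (subst sum.swap) simp
  finally have L: "?L \<le> ennreal (1 / real l) * (\<Sum>j<l. \<Sum>i<n. ennreal (\<bar>E j (x (Suc i)) - E j (x i)\<bar> powr p))" .
  also have "\<dots> \<le> ennreal (1 / real l) * (\<Sum>j<l. ennreal (4 powr p / h) * powint1 p (shift_diff (real j * h) G))"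
    unfolding E_def by (intro mult_left_mono sum_mono steklov_variation Lper1_shift_diff G h p part) auto
  also have "\<dots> = ?R1"
    using h by (simp add: sum_distrib_left ennreal_mult[symmetric] mult.assoc[symmetric] mult.commute)
  finally show "?L \<le> ?R1" .
  have E2: "(\<Sum>i<n. ennreal (\<bar>E j (x (Suc i)) - E j (x i)\<bar> powr p))
      \<le> ennreal (4 powr p * real l powr (p - 1) / h) * powint1 p (shift_diff h G)" if j: "j < l" for j
  proof (cases "j = 0")
    case True
    then have "E j y = 0" for y by (simp add: E_def steklov_def shift_diff_def)
    then show ?thesis by simp
  next
    case False
    then have jh: "real j * h > 0" using h by simp
    have E: "E j y = real j * steklov (real j * h) (shift_diff h G) y" for y
      using steklov_shift_diff_swap[OF G h jh, of y] h by (simp add: E_def)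
    have "(\<Sum>i<n. ennreal (\<bar>E j (x (Suc i)) - E j (x i)\<bar> powr p))
      = (\<Sum>i<n. ennreal (real j powr p) * ennreal (\<bar>steklov (real j * h) (shift_diff h G) (x (Suc i)) - steklov (real j * h) (shift_diff h G) (x i)\<bar> powr p))"
      unfolding E by (intro sum.cong) (auto simp: abs_mult powr_mult ennreal_mult simp flip: right_diff_distrib)
    also have "\<dots> \<le> ennreal (real j powr p) * (ennreal (4 powr p / (real j * h)) * powint1 p (shift_diff h G))"
      unfolding sum_distrib_left[symmetric] by (intro mult_left_mono steklov_variation Lper1_shift_diff G jh p part) auto
    also have "\<dots> = ennreal (real j powr p * (4 powr p / (real j * h))) * powint1 p (shift_diff h G)"
      using jh by (subst ennreal_mult) (auto simp: mult.assoc)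
    also have "real j powr p * (4 powr p / (real j * h)) = 4 powr p * real j powr (p - 1) / h"
      using False h by (simp add: powr_diff field_simps)
    also have "ennreal (4 powr p * real j powr (p - 1) / h) * powint1 p (shift_diff h G) \<le> ennreal (4 powr p * real l powr (p - 1) / h) * powint1 p (shift_diff h G)"
      using j h p by (intro mult_right_mono ennreal_leI divide_right_mono mult_left_mono powr_mono2) auto
    finally show ?thesis .
  qed
  have "?L \<le> ennreal (1 / real l) * (\<Sum>j<l. ?R2)"
    using L by (rule order_trans) (intro mult_left_mono sum_mono E2, auto)
  also have "\<dots> = (ennreal (1 / real l) * ennreal (real l)) * ?R2"
    by (simp add: mult.assoc ennreal_of_nat_eq_real_of_nat)
  also have "ennreal (1 / real l) * ennreal (real l) = 1"
    using l by (simp flip: ennreal_mult)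
  finally show "?L \<le> ?R2" by simp
qed

section \<open>Steklov differences in two variables\<close>

text \<open>The steps \<open>h\<close> and \<open>l h\<close> are consecutive scales of a mesh of ratio \<open>l\<close>.\<close>
definition steklov_diff :: "real \<Rightarrow> nat \<Rightarrow> (real \<Rightarrow> real) \<Rightarrow> real \<Rightarrow> real" where
  "steklov_diff h l G x = steklov h G x - steklov (real l * h) G x"

text \<open>Tonelli's iterated integral instead of integrability on the product: it hands over the sections directly.\<close>
definition Lper2 :: "(real \<times> real \<Rightarrow> real) set" where
  "Lper2 = {f. f \<in> borel_measurable borel \<and> periodic2 f \<and>
     (\<integral>\<^sup>+x. (\<integral>\<^sup>+y. ennreal \<bar>f (x, y)\<bar> \<partial>unit_leb) \<partial>unit_leb) < \<infinity>}"

definition powint2 :: "real \<Rightarrow> (real \<times> real \<Rightarrow> real) \<Rightarrow> ennreal" where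
  "powint2 p f = (\<integral>\<^sup>+x. (\<integral>\<^sup>+y. ennreal (\<bar>f (x, y)\<bar> powr p) \<partial>unit_leb) \<partial>unit_leb)"

text \<open>The point \<open>y\<close> comes before \<open>x\<close>, so that \<open>steklov_y k f y\<close> is a function of the first variable, of which Steklov
means can be taken again.\<close>
definition steklov_y :: "real \<Rightarrow> (real \<times> real \<Rightarrow> real) \<Rightarrow> real \<Rightarrow> real \<Rightarrow> real" where
  "steklov_y k f y x = steklov k (\<lambda>t. f (x, t)) y"

lemma Lper2_measurable [measurable_dest]: "f \<in> Lper2 \<Longrightarrow> f \<in> borel_measurable borel"
  and Lper2_periodic: "f \<in> Lper2 \<Longrightarrow> f (x + 1, y) = f (x, y)" "f \<in> Lper2 \<Longrightarrow> f (x, y + 1) = f (x, y)"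
  by (auto simp: Lper2_def periodic2_def)

lemma AE_lborel_affine:
  fixes P :: "real \<Rightarrow> bool"
  assumes "AE x in lborel. P x" "c \<noteq> 0"
  shows "AE x in lborel. P (a + c * x)"
proof -
  obtain N where N: "{x \<in> space lborel. \<not> P x} \<subseteq> N" "emeasure lborel N = 0" "N \<in> sets lborel"
    using assms(1) by (rule AE_E)
  have "AE x in lborel. x \<notin> N" using N by (intro AE_not_in) auto
  then have "AE x in lborel. a + c * x \<notin> N"
    using N(3) assms(2) by (intro AE_borel_affine[where P="\<lambda>x. x \<notin> N"]) auto
  then show ?thesis using N(1) by (auto elim!: eventually_mono)
qed

lemma AE_unit_periodic:
  assumes [measurable]: "Measurable.pred borel P" and per: "\<And>x. P (x + 1) = P x"
    and ae: "AE x in unit_leb. P x"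
  shows "AE x in lborel. P x"
proof -
  have *: "AE x in lborel. x \<in> {of_int k..of_int k + 1} \<longrightarrow> P x" for k :: int
  proof -
    have "(\<integral>\<^sup>+x\<in>{of_int k..of_int k + 1}. indicator {x. \<not> P x} x \<partial>lborel) = (\<integral>\<^sup>+x. indicator {x. \<not> P x} x \<partial>unit_leb)"
      by (rule nn_integral_period) (auto simp: per indicator_def)
    also have "\<dots> = (\<integral>\<^sup>+x. 0 \<partial>unit_leb)"
      using ae by (intro nn_integral_cong_AE) (auto simp: indicator_def)
    finally have "(\<integral>\<^sup>+x\<in>{of_int k..of_int k + 1}. indicator {x. \<not> P x} x \<partial>lborel) = 0" by simp
    then have "AE x in lborel. (indicator {x. \<not> P x} x * indicator {of_int k..of_int k + 1} x :: ennreal) = 0"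
      by (subst (asm) nn_integral_0_iff_AE) auto
    then show ?thesis by (rule eventually_mono) (auto simp: indicator_def split: if_splits)
  qed
  have "AE x in lborel. \<forall>k::int. x \<in> {of_int k..of_int k + 1} \<longrightarrow> P x"
    unfolding AE_all_countable using * by blast
  then show ?thesis
  proof (rule eventually_mono)
    fix x :: real
    assume *: "\<forall>k::int. x \<in> {of_int k..of_int k + 1} \<longrightarrow> P x"
    have "x \<in> {of_int \<lfloor>x\<rfloor>..of_int \<lfloor>x\<rfloor> + 1}" by (simp add: less_imp_le)
    then show "P x" using * by blast
  qed
qed

lemma nn_integral_unit_swap:
  fixes g :: "real \<Rightarrow> real \<Rightarrow> ennreal"
  assumes "(\<lambda>z. g (fst z) (snd z)) \<in> borel_measurable borel"
  shows "(\<integral>\<^sup>+x. (\<integral>\<^sup>+y. g x y \<partial>unit_leb) \<partial>unit_leb) = (\<integral>\<^sup>+y. (\<integral>\<^sup>+x. g x y \<partial>unit_leb) \<partial>unit_leb)"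
proof (rule unit_pair.Fubini'[symmetric])
  have "sets (unit_leb \<Otimes>\<^sub>M unit_leb) = sets (borel :: (real \<times> real) measure)"
    unfolding borel_prod[symmetric] by (intro sets_pair_measure_cong) auto
  then show "case_prod g \<in> borel_measurable (unit_leb \<Otimes>\<^sub>M unit_leb)"
    using assms by (simp add: case_prod_beta' cong: measurable_cong_sets)
qed

lemma borel_measurable_swap:
  fixes f :: "real \<times> real \<Rightarrow> real"
  assumes [measurable]: "f \<in> borel_measurable borel"
  shows "(\<lambda>z. f (snd z, fst z)) \<in> borel_measurable borel"
proof -
  have "(\<lambda>z. f (snd z, fst z)) \<in> borel_measurable (borel \<Otimes>\<^sub>M borel)" by measurable
  then show ?thesis by (simp add: borel_prod)
qed

lemma Lper2_swap: "f \<in> Lper2 \<Longrightarrow> (\<lambda>z. f (snd z, fst z)) \<in> Lper2"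
  using nn_integral_unit_swap[of "\<lambda>x y. ennreal \<bar>f (x, y)\<bar>"] borel_measurable_swap[of f]
  by (auto simp: Lper2_def periodic2_def borel_prod)

text \<open>Only almost every section of \<open>f\<close> is integrable. This is why averages are taken in \<open>y\<close> first: for every \<open>y\<close> the
result is then an integrable function of \<open>x\<close> (\<open>steklov_y_Lper1\<close>).\<close>
lemma Lper2_AE_section:
  assumes f: "f \<in> Lper2"
  shows "AE x in lborel. (\<lambda>y. f (x, y)) \<in> Lper1"
proof -
  note [measurable] = Lper2_measurable[OF f]
  have fin: "(\<integral>\<^sup>+x. (\<integral>\<^sup>+y. ennreal \<bar>f (x, y)\<bar> \<partial>unit_leb) \<partial>unit_leb) \<noteq> \<infinity>"
    using f by (auto simp: Lper2_def)
  have "AE x in unit_leb. (\<integral>\<^sup>+y. ennreal \<bar>f (x, y)\<bar> \<partial>unit_leb) \<noteq> \<infinity>"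
    by (rule nn_integral_noteq_infinite) (use fin in auto)
  then have "AE x in lborel. (\<integral>\<^sup>+y. ennreal \<bar>f (x, y)\<bar> \<partial>unit_leb) \<noteq> \<infinity>"
    by (intro AE_unit_periodic) (auto simp: Lper2_periodic[OF f])
  then show ?thesis
  proof (rule eventually_mono)
    fix x assume "(\<integral>\<^sup>+y. ennreal \<bar>f (x, y)\<bar> \<partial>unit_leb) \<noteq> \<infinity>"
    then show "(\<lambda>y. f (x, y)) \<in> Lper1"
      by (auto simp: Lper1_def periodic1_def Lper2_periodic[OF f] integrable_iff_bounded less_top)
  qed
qed

lemma Lper2_AE_section':
  "f \<in> Lper2 \<Longrightarrow> AE y in lborel. (\<lambda>x. f (x, y)) \<in> Lper1"
  using Lper2_AE_section[OF Lper2_swap] by simp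

lemma nn_integral_affine_le:
  fixes g :: "real \<Rightarrow> ennreal"
  assumes [measurable]: "g \<in> borel_measurable borel" and per: "\<And>x. g (x + 1) = g x" and k: "0 < k" "k \<le> 1"
  shows "(\<integral>\<^sup>+s. g (y + k * s) \<partial>unit_leb) \<le> ennreal (1 / k) * (\<integral>\<^sup>+s. g s \<partial>unit_leb)"
proof -
  have "(\<integral>\<^sup>+s. g (y + k * s) \<partial>unit_leb) = ennreal (1 / k) * (ennreal k * (\<integral>\<^sup>+s. g (y + k * s) \<partial>unit_leb))"
    using k by (simp add: mult.assoc[symmetric] ennreal_mult[symmetric])
  also have "\<dots> = ennreal (1 / k) * (\<integral>\<^sup>+z\<in>{y..y+k}. g z \<partial>lborel)"
    using k by (simp add: nn_integral_unit_affine)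
  also have "\<dots> \<le> ennreal (1 / k) * (\<integral>\<^sup>+z\<in>{y..y+1}. g z \<partial>lborel)"
    using k by (intro mult_left_mono nn_integral_mono) (auto simp: indicator_def)
  finally show ?thesis by (simp add: nn_integral_period per)
qed

lemma steklov_y_measurable [measurable]:
  assumes [measurable]: "f \<in> borel_measurable borel"
  shows "(\<lambda>z. steklov_y k f (snd z) (fst z)) \<in> borel_measurable borel"
proof -
  have "(\<lambda>z. \<integral>s. f (fst z, snd z + k * s) \<partial>unit_leb) \<in> borel_measurable (borel \<Otimes>\<^sub>M borel)"
    by (rule unit_leb.borel_measurable_lebesgue_integral) measurable
  then show ?thesis by (simp add: steklov_y_def steklov_def borel_prod)
qed

lemma steklov_y_bound:
  assumes f: "f \<in> Lper2" and k: "0 < k" "k \<le> 1"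
  shows "ennreal \<bar>steklov_y k f y x\<bar> \<le> ennreal (1 / k) * (\<integral>\<^sup>+t. ennreal \<bar>f (x, t)\<bar> \<partial>unit_leb)"
proof -
  note [measurable] = Lper2_measurable[OF f]
  have "ennreal \<bar>steklov_y k f y x\<bar> \<le> (\<integral>\<^sup>+s. ennreal \<bar>f (x, y + k * s)\<bar> \<partial>unit_leb)"
    unfolding steklov_y_def steklov_def
    by (cases "integrable unit_leb (\<lambda>s. f (x, y + k * s))")
      (use integral_norm_bound_ennreal[of unit_leb "\<lambda>s. f (x, y + k * s)"] in \<open>auto simp: not_integrable_integral_eq\<close>)
  also have "\<dots> \<le> ennreal (1 / k) * (\<integral>\<^sup>+t. ennreal \<bar>f (x, t)\<bar> \<partial>unit_leb)"
    by (intro nn_integral_affine_le k) (auto simp: Lper2_periodic[OF f])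
  finally show ?thesis .
qed

lemma steklov_y_Lper1:
  assumes f: "f \<in> Lper2" and k: "0 < k" "k \<le> 1"
  shows "steklov_y k f y \<in> Lper1"
proof -
  note [measurable] = Lper2_measurable[OF f]
  have m: "steklov_y k f y \<in> borel_measurable borel"
    using measurable_compose[OF _ steklov_y_measurable[of f k], of "\<lambda>x. (x, y)" borel] by simp
  have "(\<integral>\<^sup>+x. ennreal \<bar>steklov_y k f y x\<bar> \<partial>unit_leb) \<le> (\<integral>\<^sup>+x. ennreal (1 / k) * (\<integral>\<^sup>+t. ennreal \<bar>f (x, t)\<bar> \<partial>unit_leb) \<partial>unit_leb)"
    by (intro nn_integral_mono steklov_y_bound f k)
  also have "\<dots> = ennreal (1 / k) * (\<integral>\<^sup>+x. (\<integral>\<^sup>+t. ennreal \<bar>f (x, t)\<bar> \<partial>unit_leb) \<partial>unit_leb)"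
    by (rule nn_integral_cmult) measurable
  also have "\<dots> < \<infinity>" using f by (auto simp: Lper2_def ennreal_mult_less_top)
  finally have "integrable unit_leb (steklov_y k f y)"
    using m by (auto simp: integrable_iff_bounded)
  then show ?thesis using m by (auto simp: Lper1_def periodic1_def steklov_y_def Lper2_periodic[OF f])
qed

definition steklov_diff_y :: "real \<Rightarrow> nat \<Rightarrow> (real \<times> real \<Rightarrow> real) \<Rightarrow> real \<Rightarrow> real \<Rightarrow> real" where
  "steklov_diff_y k l f y x = steklov_diff k l (\<lambda>t. f (x, t)) y"

definition steklov_diff2 :: "real \<Rightarrow> nat \<Rightarrow> real \<Rightarrow> nat \<Rightarrow> (real \<times> real \<Rightarrow> real) \<Rightarrow> real \<times> real \<Rightarrow> real" where
  "steklov_diff2 h l k m f = (\<lambda>(x, y). steklov_diff h l (steklov_diff_y k m f y) x)"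

lemma steklov_diff_y_eq: "steklov_diff_y k l f y x = steklov_y k f y x - steklov_y (real l * k) f y x"
  by (simp add: steklov_diff_y_def steklov_y_def steklov_diff_def)

lemma steklov_diff_y_Lper1:
  assumes "f \<in> Lper2" "0 < k" "0 < l" "real l * k \<le> 1"
  shows "steklov_diff_y k l f y \<in> Lper1"
proof -
  have "1 * k \<le> real l * k" using assms by (intro mult_right_mono) auto
  then have "k \<le> 1" using assms by linarith
  then have "steklov_y k f y \<in> Lper1" "steklov_y (real l * k) f y \<in> Lper1"
    using assms by (auto intro!: steklov_y_Lper1)
  from Lper1_diff[OF this] show ?thesis by (simp add: steklov_diff_y_eq[abs_def])
qed

lemma steklov_diff_minus:
  assumes "F \<in> Lper1" "G \<in> Lper1" "0 < h" "0 < l"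
  shows "steklov_diff h l (\<lambda>x. F x - G x) x = steklov_diff h l F x - steklov_diff h l G x"
  using assms by (simp add: steklov_diff_def steklov_minus)

text \<open>The shape common to both bounds of \<open>steklov_diff_p_variation\<close>. Since it is additive in \<open>p\<close>-th powers, two of them
can be composed in two variables, whichever bound is used.\<close>
definition variation_bound :: "real \<Rightarrow> real \<Rightarrow> nat \<Rightarrow> nat \<Rightarrow> (nat \<Rightarrow> real) \<Rightarrow> ennreal \<Rightarrow> bool" where
  "variation_bound p h l N s c \<longleftrightarrow> (\<forall>G\<in>Lper1. \<forall>(n, x)\<in>period_partitions.
     (\<Sum>i<n. ennreal (\<bar>steklov_diff h l G (x (Suc i)) - steklov_diff h l G (x i)\<bar> powr p))
       \<le> (\<Sum>j<N. c * powint1 p (shift_diff (s j) G)))"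

lemma variation_boundD:
  "variation_bound p h l N s c \<Longrightarrow> G \<in> Lper1 \<Longrightarrow> (n, x) \<in> period_partitions \<Longrightarrow>
     (\<Sum>i<n. ennreal (\<bar>steklov_diff h l G (x (Suc i)) - steklov_diff h l G (x i)\<bar> powr p))
       \<le> (\<Sum>j<N. c * powint1 p (shift_diff (s j) G))"
  unfolding variation_bound_def by fast

lemma variation_bound_many:
  assumes "0 < h" "0 < l" "1 < p"
  shows "variation_bound p h l l (\<lambda>j. real j * h) (ennreal (4 powr p / (h * real l)))"
  unfolding variation_bound_def steklov_diff_def using steklov_diff_p_variation(1)[OF _ assms(1,2,3)] by blast

lemma variation_bound_one:
  assumes "0 < h" "0 < l" "1 < p"
  shows "variation_bound p h l 1 (\<lambda>j. h) (ennreal (4 powr p * real l powr (p - 1) / h))"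
  unfolding variation_bound_def steklov_diff_def using steklov_diff_p_variation(2)[OF _ assms(1,2,3)] by auto

text \<open>Composition of two one-dimensional bounds. The increments in \<open>y\<close> are frozen first, which leaves a function of
\<open>x\<close>; the bound in \<open>x\<close> produces an integral in which, for almost every \<open>x\<close>, the bound in \<open>y\<close> can be applied to the
difference of two sections of \<open>f\<close>.\<close>
lemma steklov_diff2_variation:
  assumes f: "f \<in> Lper2" and h: "0 < h" "0 < l" and k: "0 < k" "0 < m" "real m * k \<le> 1"
    and H: "variation_bound p h l N s c" and K: "variation_bound p k m M t d"
    and px: "(a, x) \<in> period_partitions" and py: "(b, y) \<in> period_partitions"
  defines "\<phi> \<equiv> steklov_diff2 h l k m f"
  shows "(\<Sum>i<a. \<Sum>j<b. ennreal (\<bar>\<phi> (x (Suc i), y (Suc j)) - \<phi> (x (Suc i), y j) - \<phi> (x i, y (Suc j)) + \<phi> (x i, y j)\<bar> powr p))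
    \<le> (\<Sum>i<N. \<Sum>j<M. c * d * powint2 p (mixed_diff (s i) (t j) f))"
proof -
  note [measurable] = Lper2_measurable[OF f]
  define W where "W j = (\<lambda>x'. steklov_diff_y k m f (y (Suc j)) x' - steklov_diff_y k m f (y j) x')" for j
  have W: "W j \<in> Lper1" for j
    unfolding W_def using f k by (intro Lper1_diff steklov_diff_y_Lper1) auto
  have m: "(\<lambda>z. mixed_diff s' t' f z) \<in> borel_measurable borel" for s' t'

  proof -
    have "(\<lambda>z. mixed_diff s' t' f z) \<in> borel_measurable (borel \<Otimes>\<^sub>M borel)"
      unfolding mixed_diff_def case_prod_beta' by measurable
    then show ?thesis by (simp add: borel_prod)
  qed
  note [measurable] = Lper1_measurable[OF W] m
  have \<phi>: "\<phi> (x', y (Suc j)) - \<phi> (x', y j) = steklov_diff h l (W j) x'" for x' j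
    unfolding \<phi>_def steklov_diff2_def W_def using f h k by (simp add: steklov_diff_minus steklov_diff_y_Lper1)
  have eq: "\<phi> (x (Suc i), y (Suc j)) - \<phi> (x (Suc i), y j) - \<phi> (x i, y (Suc j)) + \<phi> (x i, y j)
     = steklov_diff h l (W j) (x (Suc i)) - steklov_diff h l (W j) (x i)" for i j
    unfolding \<phi>[symmetric] by simp
  have "(\<Sum>i<a. \<Sum>j<b. ennreal (\<bar>\<phi> (x (Suc i), y (Suc j)) - \<phi> (x (Suc i), y j) - \<phi> (x i, y (Suc j)) + \<phi> (x i, y j)\<bar> powr p))
    = (\<Sum>j<b. \<Sum>i<a. ennreal (\<bar>steklov_diff h l (W j) (x (Suc i)) - steklov_diff h l (W j) (x i)\<bar> powr p))"
    unfolding eq by (rule sum.swap)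
  also have "\<dots> \<le> (\<Sum>j<b. \<Sum>i<N. c * powint1 p (shift_diff (s i) (W j)))"
    by (intro sum_mono variation_boundD[OF H W px])
  also have "\<dots> = (\<Sum>i<N. c * (\<Sum>j<b. powint1 p (shift_diff (s i) (W j))))"
    unfolding sum_distrib_left by (rule sum.swap)
  also have "\<dots> \<le> (\<Sum>i<N. c * (\<Sum>j<M. d * powint2 p (mixed_diff (s i) (t j) f)))"
  proof (intro sum_mono mult_left_mono)
    fix i
    have "(\<Sum>j<b. powint1 p (shift_diff (s i) (W j))) = (\<integral>\<^sup>+x. (\<Sum>j<b. ennreal (\<bar>shift_diff (s i) (W j) x\<bar> powr p)) \<partial>unit_leb)"
      unfolding powint1_def shift_diff_def by (subst nn_integral_sum) auto
    also have "\<dots> \<le> (\<integral>\<^sup>+x. (\<Sum>j<M. d * (\<integral>\<^sup>+y. ennreal (\<bar>mixed_diff (s i) (t j) f (x, y)\<bar> powr p) \<partial>unit_leb)) \<partial>unit_leb)"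
    proof (intro nn_integral_mono_AE AE_unit_measureI)
      note AE_lborel_affine[OF Lper2_AE_section[OF f], of 1 "s i", simplified]
      with Lper2_AE_section[OF f]
      show "AE x in lborel. (\<Sum>j<b. ennreal (\<bar>shift_diff (s i) (W j) x\<bar> powr p)) \<le> (\<Sum>j<M. d * (\<integral>\<^sup>+y. ennreal (\<bar>mixed_diff (s i) (t j) f (x, y)\<bar> powr p) \<partial>unit_leb))"
      proof eventually_elim
        fix x' assume 1: "(\<lambda>y. f (x', y)) \<in> Lper1" and "(\<lambda>y. f (s i + x', y)) \<in> Lper1"
        then have 2: "(\<lambda>y. f (x' + s i, y)) \<in> Lper1" by (simp add: add.commute)
        define G where "G = (\<lambda>y. f (x' + s i, y) - f (x', y))"
        have G: "G \<in> Lper1" unfolding G_def by (rule Lper1_diff[OF 2 1])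
        have "shift_diff (s i) (W j) x' = steklov_diff k m G (y (Suc j)) - steklov_diff k m G (y j)" for j
          using 1 2 k unfolding shift_diff_def W_def G_def by (simp add: steklov_diff_y_def steklov_diff_minus)
        then have "(\<Sum>j<b. ennreal (\<bar>shift_diff (s i) (W j) x'\<bar> powr p)) \<le> (\<Sum>j<M. d * powint1 p (shift_diff (t j) G))"
          using variation_boundD[OF K G py] by simp
        moreover have "shift_diff (t j) G = (\<lambda>y. mixed_diff (s i) (t j) f (x', y))" for j
          by (auto simp: fun_eq_iff shift_diff_def G_def mixed_diff_def)
        ultimately show "(\<Sum>j<b. ennreal (\<bar>shift_diff (s i) (W j) x'\<bar> powr p)) \<le> (\<Sum>j<M. d * (\<integral>\<^sup>+y. ennreal (\<bar>mixed_diff (s i) (t j) f (x', y)\<bar> powr p) \<partial>unit_leb))"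
          by (simp add: powint1_def)
      qed
    qed
    also have "\<dots> = (\<Sum>j<M. d * powint2 p (mixed_diff (s i) (t j) f))"
      unfolding powint2_def by (subst nn_integral_sum) (auto simp: nn_integral_cmult)
    finally show "(\<Sum>j<b. powint1 p (shift_diff (s i) (W j))) \<le> (\<Sum>j<M. d * powint2 p (mixed_diff (s i) (t j) f))" .
  qed auto
  also have "\<dots> = (\<Sum>i<N. \<Sum>j<M. c * d * powint2 p (mixed_diff (s i) (t j) f))"
    by (simp add: sum_distrib_left mult.assoc)
  finally show ?thesis .
qed

section \<open>The mixed modulus of continuity\<close>

lemma Lp_norm_eq_powint2:
  assumes f: "f \<in> borel_measurable borel"
  shows "Lp_norm p f = proot p (powint2 p f)"
proof -
  have [measurable]: "f \<in> borel_measurable (borel \<Otimes>\<^sub>M borel)" using f by (simp add: borel_prod)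
  let ?g = "\<lambda>z. ennreal (\<bar>f z\<bar> powr p) * indicator ({0..1} \<times> {0..1}) z"
  have "(\<integral>\<^sup>+z. ?g z \<partial>lebesgue) = (\<integral>\<^sup>+z. ?g z \<partial>(lborel \<Otimes>\<^sub>M lborel))"
    by (simp add: nn_integral_completion lborel_prod)
  also have "\<dots> = (\<integral>\<^sup>+x. (\<integral>\<^sup>+y. ?g (x, y) \<partial>lborel) \<partial>lborel)"
    by (rule lborel.nn_integral_fst[symmetric]) measurable
  also have "\<dots> = (\<integral>\<^sup>+x. (\<integral>\<^sup>+y\<in>{0..1}. ennreal (\<bar>f (x, y)\<bar> powr p) \<partial>lborel) * indicator {0..1} x \<partial>lborel)"
    by (intro nn_integral_cong, subst nn_integral_multc[symmetric], measurable)
      (auto intro!: nn_integral_cong simp: indicator_def)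
  also have "\<dots> = powint2 p f"
    unfolding powint2_def by (simp add: nn_integral_unit_leb)
  finally show ?thesis by (simp add: Lp_norm_def)
qed

lemma powint2_translate:
  assumes f: "f \<in> borel_measurable borel" and per: "periodic2 f"
  shows "powint2 p (\<lambda>(x, y). f (x + a, y + b)) = powint2 p f"
proof -
  have [measurable]: "f \<in> borel_measurable (borel \<Otimes>\<^sub>M borel)" using f by (simp add: borel_prod)
  have p: "f (x + 1, y) = f (x, y)" "f (x, y + 1) = f (x, y)" for x y using per by (auto simp: periodic2_def)
  have p': "f (x + 1 + a, y) = f (x + a, y)" "f (x, y + 1 + b) = f (x, y + b)" for x y
    using p(1)[of "x + a" y] p(2)[of x "y + b"] by (simp_all add: add_ac)
  have "powint2 p (\<lambda>(x, y). f (x + a, y + b)) = (\<integral>\<^sup>+x. (\<integral>\<^sup>+y. ennreal (\<bar>f (x + a, y)\<bar> powr p) \<partial>unit_leb) \<partial>unit_leb)"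
    unfolding powint2_def prod.case
    by (intro nn_integral_cong nn_integral_unit_shift[of "\<lambda>y. ennreal (\<bar>f (_, y)\<bar> powr p)"]) (auto simp: p)
  also have "\<dots> = powint2 p f"
    unfolding powint2_def
    by (intro nn_integral_unit_shift[of "\<lambda>x. \<integral>\<^sup>+y. ennreal (\<bar>f (x, y)\<bar> powr p) \<partial>unit_leb"]) (auto simp: p)
  finally show ?thesis .
qed

lemma powint2_sum_le:
  assumes p: "1 \<le> p" and I: "finite I" and m: "\<And>i. i \<in> I \<Longrightarrow> F i \<in> borel_measurable borel"
    and g: "\<And>z. g z = (\<Sum>i\<in>I. F i z)"
  shows "powint2 p g \<le> ennreal (real (card I) powr (p - 1)) * (\<Sum>i\<in>I. powint2 p (F i))"
proof -
  have [measurable]: "i \<in> I \<Longrightarrow> F i \<in> borel_measurable (borel \<Otimes>\<^sub>M borel)" for i using m by (simp add: borel_prod)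
  let ?C = "ennreal (real (card I) powr (p - 1))"
  have "powint2 p g \<le> (\<integral>\<^sup>+x. (\<integral>\<^sup>+y. ?C * (\<Sum>i\<in>I. ennreal (\<bar>F i (x, y)\<bar> powr p)) \<partial>unit_leb) \<partial>unit_leb)"
    unfolding powint2_def g
  proof (intro nn_integral_mono)
    fix x y
    have "ennreal (\<bar>\<Sum>i\<in>I. F i (x, y)\<bar> powr p) \<le> ennreal (real (card I) powr (p - 1) * (\<Sum>i\<in>I. \<bar>F i (x, y)\<bar> powr p))"
      by (intro ennreal_leI jensen_powr_sum I p)
    then show "ennreal (\<bar>\<Sum>i\<in>I. F i (x, y)\<bar> powr p) \<le> ?C * (\<Sum>i\<in>I. ennreal (\<bar>F i (x, y)\<bar> powr p))"
      by (subst (asm) ennreal_mult) (auto simp: sum_nonneg)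
  qed
  also have "\<dots> = (\<integral>\<^sup>+x. ?C * (\<integral>\<^sup>+y. (\<Sum>i\<in>I. ennreal (\<bar>F i (x, y)\<bar> powr p)) \<partial>unit_leb) \<partial>unit_leb)"
    by (intro nn_integral_cong nn_integral_cmult) measurable
  also have "\<dots> = ?C * (\<integral>\<^sup>+x. (\<integral>\<^sup>+y. (\<Sum>i\<in>I. ennreal (\<bar>F i (x, y)\<bar> powr p)) \<partial>unit_leb) \<partial>unit_leb)"
    by (rule nn_integral_cmult) measurable
  also have "(\<integral>\<^sup>+x. (\<integral>\<^sup>+y. (\<Sum>i\<in>I. ennreal (\<bar>F i (x, y)\<bar> powr p)) \<partial>unit_leb) \<partial>unit_leb)
    = (\<integral>\<^sup>+x. (\<Sum>i\<in>I. (\<integral>\<^sup>+y. ennreal (\<bar>F i (x, y)\<bar> powr p) \<partial>unit_leb)) \<partial>unit_leb)"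
    by (intro nn_integral_cong nn_integral_sum) measurable
  also have "\<dots> = (\<Sum>i\<in>I. powint2 p (F i))"
    unfolding powint2_def by (intro nn_integral_sum) measurable
  finally show ?thesis .
qed

lemma mixed_diff_measurable:
  assumes f: "f \<in> borel_measurable borel"
  shows "mixed_diff s t f \<in> borel_measurable borel"
proof -
  have [measurable]: "f \<in> borel_measurable (borel \<Otimes>\<^sub>M borel)" using f by (simp add: borel_prod)
  have "mixed_diff s t f \<in> borel_measurable (borel \<Otimes>\<^sub>M borel)"
    unfolding mixed_diff_def case_prod_beta' by measurable
  then show ?thesis by (simp add: borel_prod)
qed

lemma translate_measurable:
  fixes f :: "real \<times> real \<Rightarrow> real"
  assumes f: "f \<in> borel_measurable borel"
  shows "(\<lambda>(x, y). f (x + a, y + b)) \<in> borel_measurable borel"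
proof -
  have [measurable]: "f \<in> borel_measurable (borel \<Otimes>\<^sub>M borel)" using f by (simp add: borel_prod)
  have "(\<lambda>(x, y). f (x + a, y + b)) \<in> borel_measurable (borel \<Otimes>\<^sub>M borel)"
    unfolding case_prod_beta' by measurable
  then show ?thesis by (simp add: borel_prod)
qed

lemma mixed_diff_periodic: "periodic2 f \<Longrightarrow> periodic2 (mixed_diff s t f)"
proof -
  assume f: "periodic2 f"
  have "f (x + 1 + s, y) = f (x + s, y)" "f (x, y + 1 + t) = f (x, y + t)" for x y
    using f unfolding periodic2_def by (metis add.assoc add.commute)+
  then show ?thesis using f by (auto simp: periodic2_def mixed_diff_def)
qed

lemma powint2_uminus: "powint2 p (\<lambda>z. - g z) = powint2 p g" by (simp add: powint2_def)

lemma powint2_mixed_diff_le: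
  assumes p: "1 \<le> p" and f: "f \<in> borel_measurable borel" and per: "periodic2 f"
  shows "powint2 p (mixed_diff s t f) \<le> ennreal (4 powr p) * powint2 p f"
proof -
  define T where "T a b = (\<lambda>(x, y). f (x + a, y + b))" for a b
  define F where "F i = (if i = (0::nat) then T s t else if i = 1 then (\<lambda>z. - T s 0 z) else if i = 2 then (\<lambda>z. - T 0 t z) else T 0 0)" for i
  have "powint2 p (mixed_diff s t f) \<le> ennreal (real (card {..<4::nat}) powr (p - 1)) * (\<Sum>i\<in>{..<4}. powint2 p (F i))"
  proof (rule powint2_sum_le[OF p])
    have "T a b \<in> borel_measurable borel" for a b
      unfolding T_def by (rule translate_measurable[OF f])
    then show "F i \<in> borel_measurable borel" for i
      unfolding F_def by (auto intro!: borel_measurable_uminus)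
    show "mixed_diff s t f z = (\<Sum>i<4. F i z)" for z
      by (cases z) (simp add: mixed_diff_def F_def T_def numeral_eq_Suc)
  qed auto
  also
  have qT: "powint2 p (T a b) = powint2 p f" for a b
    unfolding T_def by (rule powint2_translate[OF f per])
  have "powint2 p (F i) = powint2 p f" for i
    using qT unfolding F_def by (simp add: powint2_uminus)
  then have "(\<Sum>i\<in>{..<4}. powint2 p (F i)) = ennreal 4 * powint2 p f" by simp
  also have "ennreal (real (card {..<4::nat}) powr (p - 1)) * (ennreal 4 * powint2 p f) = ennreal (4 powr (p - 1) * 4) * powint2 p f"
    by (subst ennreal_mult) (auto simp: mult.assoc)
  also have "4 powr (p - 1) * 4 = (4::real) powr p" by (simp add: powr_diff)
  finally show ?thesis .
qed

text \<open>A difference of step \<open>N s\<close> is a sum of \<open>N\<close> translates of a difference of step \<open>s\<close>, all of the same norm.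
The inequality between powers of sums replaces the triangle inequality of \<open>L\<^sup>p\<close>.\<close>
lemma powint2_mixed_diff_scale:
  assumes p: "1 \<le> p" and f: "f \<in> borel_measurable borel" and per: "periodic2 f"
  shows "powint2 p (mixed_diff (real N * s) t f) \<le> ennreal (real N powr p) * powint2 p (mixed_diff s t f)"
proof (cases "N = 0")
  case True
  then show ?thesis by (simp add: powint2_def mixed_diff_def)
next
  case False
  define F where "F i = (\<lambda>(x, y). mixed_diff s t f (x + real i * s, y + 0))" for i
  have "powint2 p (mixed_diff (real N * s) t f) \<le> ennreal (real (card {..<N}) powr (p - 1)) * (\<Sum>i\<in>{..<N}. powint2 p (F i))"
  proof (rule powint2_sum_le[OF p])
    show "F i \<in> borel_measurable borel" for i
      unfolding F_def by (rule translate_measurable[OF mixed_diff_measurable[OF f]])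
    fix z show "mixed_diff (real N * s) t f z = (\<Sum>i<N. F i z)"
    proof (cases z)
      case (Pair x y)
      have "(\<Sum>i<N. F i (x, y)) = mixed_diff (real N * s) t f (x, y)"
        unfolding F_def mixed_diff_def by (induction N) (auto simp: algebra_simps)
      then show ?thesis by (simp add: Pair)
    qed
  qed auto
  also have "powint2 p (F i) = powint2 p (mixed_diff s t f)" for i
    unfolding F_def by (rule powint2_translate[OF mixed_diff_measurable[OF f] mixed_diff_periodic[OF per]])
  then have "(\<Sum>i\<in>{..<N}. powint2 p (F i)) = ennreal (real N) * powint2 p (mixed_diff s t f)"
    by (simp add: ennreal_of_nat_eq_real_of_nat)
  also have "ennreal (real (card {..<N}) powr (p - 1)) * (ennreal (real N) * powint2 p (mixed_diff s t f)) = ennreal (real N powr (p - 1) * real N) * powint2 p (mixed_diff s t f)"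
    by (subst ennreal_mult) (auto simp: mult.assoc)
  also have "real N powr (p - 1) * real N = real N powr p" using False by (simp add: powr_diff)
  finally show ?thesis .
qed

lemma powint2_swap:
  assumes f: "f \<in> borel_measurable borel"
  shows "powint2 p (\<lambda>z. f (snd z, fst z)) = powint2 p f"
  unfolding powint2_def
proof (simp, subst nn_integral_unit_swap)
  show "(\<lambda>z. ennreal (\<bar>f (snd z, fst z)\<bar> powr p)) \<in> borel_measurable borel"
    using borel_measurable_swap[OF f] by measurable
qed simp

lemma mixed_diff_swap: "mixed_diff s t (\<lambda>z. f (snd z, fst z)) = (\<lambda>z. mixed_diff t s f (snd z, fst z))"
  by (auto simp: mixed_diff_def)

lemma powint2_mixed_diff_scale':
  assumes p: "1 \<le> p" and f: "f \<in> borel_measurable borel" and per: "periodic2 f"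
  shows "powint2 p (mixed_diff s (real N * t) f) \<le> ennreal (real N powr p) * powint2 p (mixed_diff s t f)"
  using powint2_mixed_diff_scale[OF p borel_measurable_swap[OF f], of N t s] per
  by (simp add: mixed_diff_swap powint2_swap[OF mixed_diff_measurable[OF f]] periodic2_def)

lemma proot_le_iff:
  assumes "1 \<le> p" "0 \<le> C"
  shows "proot p a \<le> ennreal C \<longleftrightarrow> a \<le> ennreal (C powr p)"
proof (cases a)
  case (real r)
  have "r powr (1 / p) \<le> C \<longleftrightarrow> r \<le> C powr p"
  proof
    assume "r powr (1 / p) \<le> C"
    then have "(r powr (1 / p)) powr p \<le> C powr p" using assms by (intro powr_mono2) auto
    then show "r \<le> C powr p" using real assms by (simp add: powr_powr)
  next
    assume "r \<le> C powr p"
    then have "r powr (1 / p) \<le> (C powr p) powr (1 / p)" using real assms by (intro powr_mono2) auto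
    then show "r powr (1 / p) \<le> C" using assms by (simp add: powr_powr)
  qed
  then show ?thesis using real assms by (simp add: proot_def)
next
  case top
  then show ?thesis by (simp add: proot_def top_unique)
qed

text \<open>Borel measurability makes all sections measurable. \<open>exists_borel_periodic\<close> provides a representative of this kind for a
Lebesgue measurable function.\<close>
locale Lp_periodic =
  fixes p :: real and f :: "real \<times> real \<Rightarrow> real"
  assumes p: "1 < p" and f: "f \<in> borel_measurable borel" and per: "periodic2 f" and qfin: "powint2 p f < \<infinity>"
begin

text \<open>The mixed modulus is finite for \<open>f\<close> in \<open>L\<^sup>p\<close>, so it can be handled as a real number.\<close>
definition \<omega> :: "real \<Rightarrow> real \<Rightarrow> real" where
  "\<omega> u v = enn2real (mixed_modulus p f u v)"

lemma p1: "1 \<le> p" using p by simp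

lemma mixed_modulus_le_iff:
  assumes "0 \<le> C"
  shows "mixed_modulus p f u v \<le> ennreal C \<longleftrightarrow> (\<forall>s\<in>{0..u}. \<forall>t\<in>{0..v}. powint2 p (mixed_diff s t f) \<le> ennreal (C powr p))"
  unfolding mixed_modulus_def SUP_le_iff
  by (auto simp: Lp_norm_eq_powint2[OF mixed_diff_measurable[OF f]] proot_le_iff[OF p1 assms])

lemma mixed_modulus_omega: "mixed_modulus p f u v = ennreal (\<omega> u v)"
proof -
  obtain Q where Q: "powint2 p f = ennreal Q" "Q \<ge> 0" using qfin by (cases "powint2 p f") auto
  \<comment> \<open>A mixed difference is a combination of four translates.\<close>
  define C where "C = 4 * Q powr (1 / p)"
  have C: "C powr p = 4 powr p * Q" using Q p by (simp add: C_def powr_mult powr_powr)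
  have "mixed_modulus p f u v \<le> ennreal C"
  proof (subst mixed_modulus_le_iff, goal_cases)
    case 1 then show ?case by (simp add: C_def)
  next
    case 2 then show ?case
      using powint2_mixed_diff_le[OF p1 f per] Q by (auto simp: C ennreal_mult)
  qed
  then have "mixed_modulus p f u v \<noteq> top" by (auto simp: top_unique)
  then show ?thesis by (simp add: \<omega>_def less_top)
qed

lemma omega_nonneg: "0 \<le> \<omega> u v" by (simp add: \<omega>_def)

lemma omega_bound:
  "0 \<le> s \<Longrightarrow> s \<le> u \<Longrightarrow> 0 \<le> t \<Longrightarrow> t \<le> v \<Longrightarrow> powint2 p (mixed_diff s t f) \<le> ennreal (\<omega> u v powr p)"
  using mixed_modulus_le_iff[OF omega_nonneg[of u v], of u v] mixed_modulus_omega[of u v] by auto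

lemma omega_le:
  assumes "0 \<le> C" "\<And>s t. s \<in> {0..u} \<Longrightarrow> t \<in> {0..v} \<Longrightarrow> powint2 p (mixed_diff s t f) \<le> ennreal (C powr p)"
  shows "\<omega> u v \<le> C"
  using mixed_modulus_le_iff[OF assms(1), of u v] assms unfolding mixed_modulus_omega
  by (simp add: ennreal_le_iff)

lemma omega_mono: "u \<le> u' \<Longrightarrow> v \<le> v' \<Longrightarrow> \<omega> u v \<le> \<omega> u' v'"
  by (rule omega_le[OF omega_nonneg]) (rule omega_bound, auto)

lemma omega_scale1:
  assumes "0 < N" shows "\<omega> (real N * u) v \<le> real N * \<omega> u v"
proof (rule omega_le)
  fix s t assume st: "s \<in> {0..real N * u}" "t \<in> {0..v}"
  have "powint2 p (mixed_diff (real N * (s / real N)) t f) \<le> ennreal (real N powr p) * powint2 p (mixed_diff (s / real N) t f)"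
    by (rule powint2_mixed_diff_scale[OF p1 f per])
  also have "\<dots> \<le> ennreal (real N powr p) * ennreal (\<omega> u v powr p)"
    using st assms by (intro mult_left_mono omega_bound) (auto simp: field_simps)
  also have "\<dots> = ennreal ((real N * \<omega> u v) powr p)" by (simp add: powr_mult ennreal_mult omega_nonneg)
  finally show "powint2 p (mixed_diff s t f) \<le> ennreal ((real N * \<omega> u v) powr p)" using assms by simp
qed (simp add: omega_nonneg)

lemma omega_scale2:
  assumes "0 < N" shows "\<omega> u (real N * v) \<le> real N * \<omega> u v"
proof (rule omega_le)
  fix s t assume st: "s \<in> {0..u}" "t \<in> {0..real N * v}"
  have "powint2 p (mixed_diff s (real N * (t / real N)) f) \<le> ennreal (real N powr p) * powint2 p (mixed_diff s (t / real N) f)"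
    by (rule powint2_mixed_diff_scale'[OF p1 f per])
  also have "\<dots> \<le> ennreal (real N powr p) * ennreal (\<omega> u v powr p)"
    using st assms by (intro mult_left_mono omega_bound) (auto simp: field_simps)
  also have "\<dots> = ennreal ((real N * \<omega> u v) powr p)" by (simp add: powr_mult ennreal_mult omega_nonneg)
  finally show "powint2 p (mixed_diff s t f) \<le> ennreal ((real N * \<omega> u v) powr p)" using assms by simp
qed (simp add: omega_nonneg)

text \<open>The modulus divided by its step is almost decreasing in the step. The factor 2 absorbs the rounding of \<open>u / s\<close> to an
integer.\<close>
lemma omega_doubling1:
  assumes "0 < s" "s \<le> u" shows "\<omega> u v / u \<le> 2 * \<omega> s v / s"
proof -
  define N where "N = nat \<lceil>u / s\<rceil>"
  have ge: "u / s \<ge> 1" using assms by simp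
  have N: "u / s \<le> real N" "real N \<le> u / s + 1" unfolding N_def using ge by linarith+
  then have "0 < N" using ge by (cases N) auto
  have "\<omega> u v \<le> \<omega> (real N * s) v" using N(1) assms by (intro omega_mono) (auto simp: field_simps)
  also have "\<dots> \<le> real N * \<omega> s v" using \<open>0 < N\<close> by (rule omega_scale1)
  also have "\<dots> \<le> (2 * u / s) * \<omega> s v" using N ge by (intro mult_right_mono omega_nonneg) auto
  finally show ?thesis using assms by (simp add: field_simps)
qed

lemma omega_doubling2:
  assumes "0 < s" "s \<le> v" shows "\<omega> u v / v \<le> 2 * \<omega> u s / s"
proof -
  define N where "N = nat \<lceil>v / s\<rceil>"
  have ge: "v / s \<ge> 1" using assms by simp
  have N: "v / s \<le> real N" "real N \<le> v / s + 1" unfolding N_def using ge by linarith+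
  then have "0 < N" using ge by (cases N) auto
  have "\<omega> u v \<le> \<omega> u (real N * s)" using N(1) assms by (intro omega_mono) (auto simp: field_simps)
  also have "\<dots> \<le> real N * \<omega> u s" using \<open>0 < N\<close> by (rule omega_scale2)
  also have "\<dots> \<le> (2 * v / s) * \<omega> u s" using N ge by (intro mult_right_mono omega_nonneg) auto
  finally show ?thesis using assms by (simp add: field_simps)
qed

lemma Lper2: "f \<in> Lper2"
proof -
  have [measurable]: "f \<in> borel_measurable (borel \<Otimes>\<^sub>M borel)" using f by (simp add: borel_prod)
  have le: "\<bar>a\<bar> \<le> 1 + \<bar>a\<bar> powr p" for a :: real
  proof (cases "\<bar>a\<bar> \<le> 1")
    case True then show ?thesis by (simp add: add_increasing2)
  next
    case False
    then have "\<bar>a\<bar> powr 1 \<le> \<bar>a\<bar> powr p" using p by (intro powr_mono) auto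
    then show ?thesis using False by simp
  qed
  have le': "ennreal \<bar>a\<bar> \<le> 1 + ennreal (\<bar>a\<bar> powr p)" for a :: real
    using ennreal_leI[OF le[of a]] by (subst (asm) ennreal_plus) auto
  have "(\<integral>\<^sup>+x. (\<integral>\<^sup>+y. ennreal \<bar>f (x, y)\<bar> \<partial>unit_leb) \<partial>unit_leb) \<le> (\<integral>\<^sup>+x. (\<integral>\<^sup>+y. 1 + ennreal (\<bar>f (x, y)\<bar> powr p) \<partial>unit_leb) \<partial>unit_leb)"
    using le' by (intro nn_integral_mono) auto
  also have "\<dots> = 1 + powint2 p f"
    unfolding powint2_def by (simp add: nn_integral_add)
  also have "\<dots> < \<infinity>" using qfin by simp
  finally show ?thesis using f per by (simp add: Lper2_def)
qed

end

section \<open>The p-variation functionals\<close>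

definition net_diff :: "(real \<times> real \<Rightarrow> real) \<Rightarrow> (nat \<Rightarrow> real) \<Rightarrow> (nat \<Rightarrow> real) \<Rightarrow> nat \<Rightarrow> nat \<Rightarrow> real" where
  "net_diff g x y i j = g (x (Suc i), y (Suc j)) - g (x (Suc i), y j) - g (x i, y (Suc j)) + g (x i, y j)"

lemma powr_root_le_iff:
  fixes S C p :: real
  assumes "0 \<le> S" "0 \<le> C" "1 \<le> p"
  shows "S powr (1 / p) \<le> C \<longleftrightarrow> S \<le> C powr p"
  using proot_le_iff[of p C "ennreal S"] assms by (simp add: proot_def)

lemma p_variation2_le_iff:
  assumes "1 \<le> p" "0 \<le> C"
  shows "p_variation2 p g \<le> ennreal C \<longleftrightarrow>
    (\<forall>(m, x)\<in>period_partitions. \<forall>(n, y)\<in>period_partitions. (\<Sum>i<m. \<Sum>j<n. \<bar>net_diff g x y i j\<bar> powr p) \<le> C powr p)"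
  unfolding p_variation2_def SUP_le_iff net_diff_def split_paired_Ball_Sigma
  using assms by (simp add: powr_root_le_iff sum_nonneg split_beta)

lemma p_variation_le_iff:
  assumes "1 \<le> p" "0 \<le> C"
  shows "p_variation p h \<le> ennreal C \<longleftrightarrow>
    (\<forall>(n, x)\<in>period_partitions. (\<Sum>k<n. \<bar>h (x (Suc k)) - h (x k)\<bar> powr p) \<le> C powr p)"
  unfolding p_variation_def SUP_le_iff
  using assms by (auto simp: powr_root_le_iff sum_nonneg)

lemma p_variation2_leD:
  assumes "p_variation2 p g \<le> ennreal C" "1 \<le> p" "0 \<le> C" "(m, x) \<in> period_partitions" "(n, y) \<in> period_partitions"
  shows "(\<Sum>i<m. \<Sum>j<n. \<bar>net_diff g x y i j\<bar> powr p) \<le> C powr p"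
  using assms(1,4,5) unfolding p_variation2_le_iff[OF assms(2,3)] by fast

lemma p_variation2_leI:
  assumes "1 \<le> p" "0 \<le> C"
    "\<And>m x n y. (m, x) \<in> period_partitions \<Longrightarrow> (n, y) \<in> period_partitions \<Longrightarrow>
      (\<Sum>i<m. \<Sum>j<n. \<bar>net_diff g x y i j\<bar> powr p) \<le> C powr p"
  shows "p_variation2 p g \<le> ennreal C"
  unfolding p_variation2_le_iff[OF assms(1,2)] using assms(3) by blast

text \<open>Minkowski's inequality for the sum over the cells of one net.\<close>
lemma p_variation2_add_le:
  assumes p: "1 \<le> p" and C: "0 \<le> C" "p_variation2 p g \<le> ennreal C" and D: "0 \<le> D" "p_variation2 p h \<le> ennreal D"
  shows "p_variation2 p (\<lambda>z. g z + h z) \<le> ennreal (C + D)"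
proof (rule p_variation2_leI[OF p])
  fix m n :: nat and x y :: "nat \<Rightarrow> real"
  assume xy: "(m, x) \<in> period_partitions" "(n, y) \<in> period_partitions"
  let ?I = "{..<m} \<times> {..<n}"
  have cart: "(\<Sum>i<m. \<Sum>j<n. \<bar>F i j\<bar> powr p) = (\<Sum>(i,j)\<in>?I. \<bar>F i j\<bar> powr p)" for F :: "nat \<Rightarrow> nat \<Rightarrow> real"
    by (rule sum.cartesian_product)
  have g: "(\<Sum>(i,j)\<in>?I. \<bar>net_diff g x y i j\<bar> powr p) powr (1/p) \<le> C"
    using p_variation2_leD[OF C(2) p C(1) xy] C p unfolding cart
    by (subst powr_root_le_iff) (auto intro: sum_nonneg)
  have h: "(\<Sum>(i,j)\<in>?I. \<bar>net_diff h x y i j\<bar> powr p) powr (1/p) \<le> D"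
    using p_variation2_leD[OF D(2) p D(1) xy] D p unfolding cart
    by (subst powr_root_le_iff) (auto intro: sum_nonneg)
  have "net_diff (\<lambda>z. g z + h z) x y i j = net_diff g x y i j + net_diff h x y i j" for i j
    by (simp add: net_diff_def)
  then have "(\<Sum>(i,j)\<in>?I. \<bar>net_diff (\<lambda>z. g z + h z) x y i j\<bar> powr p) powr (1/p) \<le> C + D"
    using minkowski_sum[OF p, of "\<lambda>(i,j). net_diff g x y i j" "\<lambda>(i,j). net_diff h x y i j" ?I] g h
    by (simp add: case_prod_beta')
  then show "(\<Sum>i<m. \<Sum>j<n. \<bar>net_diff (\<lambda>z. g z + h z) x y i j\<bar> powr p) \<le> (C + D) powr p"
    unfolding cart using C D p by (subst (asm) powr_root_le_iff) (auto intro: sum_nonneg)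
qed (use C D in auto)

lemma p_variation2_zero: "1 \<le> p \<Longrightarrow> p_variation2 p (\<lambda>z. 0) \<le> ennreal 0"
  by (rule p_variation2_leI) (auto simp: net_diff_def)

lemma p_variation2_sum_le:
  assumes p: "1 \<le> p" and "finite I" and C: "\<And>i. i \<in> I \<Longrightarrow> 0 \<le> C i" "\<And>i. i \<in> I \<Longrightarrow> p_variation2 p (g i) \<le> ennreal (C i)"
  shows "p_variation2 p (\<lambda>z. \<Sum>i\<in>I. g i z) \<le> ennreal (\<Sum>i\<in>I. C i)"
  using assms(2) C
proof (induction I)
  case empty then show ?case using p_variation2_zero[OF p] by simp
next
  case (insert i I)
  then have "p_variation2 p (\<lambda>z. g i z + (\<Sum>i\<in>I. g i z)) \<le> ennreal (C i + (\<Sum>i\<in>I. C i))"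
    by (intro p_variation2_add_le[OF p] sum_nonneg) auto
  then show ?case using insert by simp
qed

text \<open>Lower semicontinuity: each net involves finitely many values only.\<close>
lemma p_variation2_limit:
  assumes p: "1 \<le> p" and C: "0 \<le> C" "\<And>N. p_variation2 p (G N) \<le> ennreal C" and lim: "\<And>z. (\<lambda>N. G N z) \<longlonglongrightarrow> g z"
  shows "p_variation2 p g \<le> ennreal C"
proof (rule p_variation2_leI[OF p C(1)])
  fix m n :: nat and x y :: "nat \<Rightarrow> real"
  assume xy: "(m, x) \<in> period_partitions" "(n, y) \<in> period_partitions"
  have "(\<lambda>N. \<Sum>i<m. \<Sum>j<n. \<bar>net_diff (G N) x y i j\<bar> powr p) \<longlonglongrightarrow> (\<Sum>i<m. \<Sum>j<n. \<bar>net_diff g x y i j\<bar> powr p)"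
    unfolding net_diff_def using p by (intro tendsto_sum tendsto_powr' tendsto_rabs tendsto_add tendsto_diff lim tendsto_const) auto
  then show "(\<Sum>i<m. \<Sum>j<n. \<bar>net_diff g x y i j\<bar> powr p) \<le> C powr p"
    by (rule LIMSEQ_le_const2) (use p_variation2_leD[OF C(2) p C(1) xy] in auto)
qed

lemma p_variation2_swap:
  assumes p: "1 \<le> p" and C: "0 \<le> C" "p_variation2 p g \<le> ennreal C"
  shows "p_variation2 p (\<lambda>z. g (snd z, fst z)) \<le> ennreal C"
proof (rule p_variation2_leI[OF p C(1)])
  fix m n :: nat and x y :: "nat \<Rightarrow> real"
  assume xy: "(m, x) \<in> period_partitions" "(n, y) \<in> period_partitions"
  have "net_diff (\<lambda>z. g (snd z, fst z)) x y i j = net_diff g y x j i" for i j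
    by (simp add: net_diff_def)
  then show "(\<Sum>i<m. \<Sum>j<n. \<bar>net_diff (\<lambda>z. g (snd z, fst z)) x y i j\<bar> powr p) \<le> C powr p"
    using p_variation2_leD[OF C(2) p C(1) xy(2,1)] by (subst sum.swap) simp
qed

lemma three_point_partition:
  assumes "a < b" "b < a + 1"
  shows "(2, \<lambda>i. if i = 0 then a else if i = 1 then b else a + 1) \<in> period_partitions"
  using assms by (auto simp: period_partitions_def strict_mono_on_def)

text \<open>Any two values can be moved into one period and used as points of a partition.\<close>
lemma p_variation_oscillation:
  assumes p: "1 \<le> p" and C: "0 \<le> C" "p_variation p h \<le> ennreal C" and per: "\<And>x. h (x + 1) = h x"
  shows "\<bar>h s - h t\<bar> \<le> C"
proof (cases "frac (s - t) = 0")
  case True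
  then have "s = t + of_int \<lfloor>s - t\<rfloor>" by (simp add: frac_def)
  then have "h s = h t" using periodic_of_int[of h, OF per] by metis
  then show ?thesis using C by simp
next
  case False
  define s' where "s' = t + frac (s - t)"
  have "s = s' + of_int \<lfloor>s - t\<rfloor>" by (simp add: s'_def frac_def)
  then have hs: "h s = h s'" using periodic_of_int[of h, OF per] by metis
  have s': "t < s'" "s' < t + 1" using False by (auto simp: s'_def frac_lt_1 less_le[of 0] frac_ge_0)
  let ?x = "\<lambda>i. if i = 0 then t else if i = 1 then s' else t + 1"
  have "(\<Sum>k<2. \<bar>h (?x (Suc k)) - h (?x k)\<bar> powr p) \<le> C powr p"
    using C(2) three_point_partition[OF s'] unfolding p_variation_le_iff[OF p C(1)] by fast
  then have "\<bar>h s' - h t\<bar> powr p \<le> C powr p"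
    by (simp add: numeral_2_eq_2) (smt (verit) powr_ge_zero)
  then show ?thesis
    using p C(1) unfolding hs by (meson abs_ge_zero linorder_not_less order_less_le_trans powr_less_mono2 zero_less_one)
qed

text \<open>A section has no reason to be controlled by mixed differences, unless the function has mean zero in the other
variable. In that case the increment of the section at \<open>x\<close> is the average over \<open>s\<close> of mixed differences between
\<open>x\<close> and \<open>s\<close>, and Jensen's inequality applies.\<close>
lemma mean_zero_section_variation:
  assumes p: "1 \<le> p" and C: "0 \<le> C" "p_variation2 p R \<le> ennreal C" and per: "periodic2 R"
    and int: "\<And>y. integrable unit_leb (\<lambda>s. R (s, y))" and mean: "\<And>y. (\<integral>s. R (s, y) \<partial>unit_leb) = 0"
  shows "p_variation p (\<lambda>y. R (x, y)) \<le> ennreal C"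
  unfolding p_variation_le_iff[OF p C(1)]
proof safe
  fix n y assume y: "(n, y :: nat \<Rightarrow> real) \<in> period_partitions"
  have perx: "R (s + 1, t) = R (s, t)" for s t using per by (simp add: periodic2_def)
  define D where "D j s = (R (x, y (Suc j)) - R (x, y j)) - (R (s, y (Suc j)) - R (s, y j))" for j s
  have D: "integrable unit_leb (D j)" "(\<integral>s. D j s \<partial>unit_leb) = R (x, y (Suc j)) - R (x, y j)" for j
    unfolding D_def by (simp_all add: int mean)
  \<comment> \<open>For \<open>s\<close> congruent to \<open>x\<close> the increments vanish; otherwise they are the first row of a net with the points \<open>x\<close>, \<open>s\<close> and \<open>x + 1\<close> in the first variable.\<close>
  have bound: "(\<Sum>j<n. \<bar>D j s\<bar> powr p) \<le> C powr p" for s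
  proof (cases "frac (s - x) = 0")
    case True
    then have s: "s = x + of_int \<lfloor>s - x\<rfloor>" by (simp add: frac_def)
    then have "R (s, t) = R (x, t)" for t
      using periodic_of_int[of "\<lambda>s. R (s, t)" x, OF perx] by metis
    then show ?thesis by (simp add: D_def)
  next
    case False
    \<comment> \<open>The representative of \<open>s\<close> modulo 1 in the period that starts at \<open>x\<close>.\<close>
    define s' where "s' = x + frac (s - x)"
    have "s = s' + of_int \<lfloor>s - x\<rfloor>" by (simp add: s'_def frac_def)
    then have R: "R (s, t) = R (s', t)" for t
      using periodic_of_int[of "\<lambda>s. R (s, t)" s', OF perx] by metis
    have s': "x < s'" "s' < x + 1" using False by (auto simp: s'_def frac_lt_1 less_le[of 0] frac_ge_0)
    let ?x = "\<lambda>i. if i = 0 then x else if i = 1 then s' else x + 1"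
    have "(\<Sum>i<2. \<Sum>j<n. \<bar>net_diff R ?x y i j\<bar> powr p) \<le> C powr p"
      by (rule p_variation2_leD[OF C(2) p C(1) three_point_partition[OF s'] y])
    moreover have "\<bar>net_diff R ?x y 0 j\<bar> = \<bar>D j s\<bar>" for j
      by (simp add: net_diff_def D_def R)
    ultimately have "(\<Sum>j<n. \<bar>D j s\<bar> powr p) + (\<Sum>j<n. \<bar>net_diff R ?x y 1 j\<bar> powr p) \<le> C powr p"
      by (simp add: numeral_2_eq_2)
    moreover have "(\<Sum>j<n. \<bar>net_diff R ?x y 1 j\<bar> powr p) \<ge> 0" by (intro sum_nonneg) auto
    ultimately show ?thesis by linarith
  qed
  note [measurable] = borel_measurable_integrable[OF D(1)]
  have "ennreal (\<Sum>j<n. \<bar>R (x, y (Suc j)) - R (x, y j)\<bar> powr p) = (\<Sum>j<n. ennreal (\<bar>\<integral>s. D j s \<partial>unit_leb\<bar> powr p))"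
    by (simp add: D(2))
  also have "\<dots> \<le> (\<Sum>j<n. \<integral>\<^sup>+s. ennreal (\<bar>D j s\<bar> powr p) \<partial>unit_leb)"
    using p by (intro sum_mono jensen_powr D) auto
  also have "\<dots> = (\<integral>\<^sup>+s. (\<Sum>j<n. ennreal (\<bar>D j s\<bar> powr p)) \<partial>unit_leb)"
    by (rule nn_integral_sum[symmetric]) measurable
  also have "\<dots> \<le> (\<integral>\<^sup>+s. ennreal (C powr p) \<partial>unit_leb)"
    using bound by (intro nn_integral_mono) (simp add: ennreal_leI)
  also have "\<dots> = ennreal (C powr p)" by simp
  finally show "(\<Sum>k<n. \<bar>R (x, y (Suc k)) - R (x, y k)\<bar> powr p) \<le> C powr p"
    by (simp add: ennreal_le_iff)
qed

text \<open>This turns smallness of the variation into uniform smallness, and hence a series that converges in variation into a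
uniformly convergent one.\<close>
lemma mean_zero_sup_le:
  assumes p: "1 \<le> p" and C: "0 \<le> C" "p_variation2 p R \<le> ennreal C" and per: "periodic2 R"
    and int: "\<And>y. integrable unit_leb (\<lambda>s. R (s, y))" and mean: "\<And>y. (\<integral>s. R (s, y) \<partial>unit_leb) = 0"
    and int': "\<And>x. integrable unit_leb (\<lambda>t. R (x, t))" and mean': "\<And>x. (\<integral>t. R (x, t) \<partial>unit_leb) = 0"
  shows "\<bar>R (x, y)\<bar> \<le> C"
proof -
  have osc: "\<bar>R (x, y) - R (x, t)\<bar> \<le> C" for t
    by (rule p_variation_oscillation[OF p C(1) mean_zero_section_variation[OF p C per int mean]])
      (use per in \<open>simp add: periodic2_def\<close>)
  have "\<bar>R (x, y)\<bar> = \<bar>\<integral>t. R (x, y) - R (x, t) \<partial>unit_leb\<bar>"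
    using int' mean' by simp
  also have "\<dots> \<le> (\<integral>t. \<bar>R (x, y) - R (x, t)\<bar> \<partial>unit_leb)" by (rule integral_abs_bound)
  also have "\<dots> \<le> (\<integral>t. C \<partial>unit_leb)"
    using int' osc by (intro integral_mono) auto
  finally show ?thesis by simp
qed

context Lp_periodic begin

lemma steklov_diff2_p_variation2:
  assumes h: "0 < h" "0 < l" and k: "0 < k" "0 < m" "real m * k \<le> 1"
    and H: "variation_bound p h l N s (ennreal c)" and K: "variation_bound p k m M t (ennreal d)" and cd: "0 \<le> c" "0 \<le> d"
    and s: "\<And>i. i < N \<Longrightarrow> 0 \<le> s i \<and> s i \<le> u" and t: "\<And>j. j < M \<Longrightarrow> 0 \<le> t j \<and> t j \<le> v"
  shows "p_variation2 p (steklov_diff2 h l k m f) \<le> ennreal ((real N * c * (real M * d)) powr (1 / p) * \<omega> u v)"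
proof (rule p_variation2_leI[OF p1])
  fix a b :: nat and x y :: "nat \<Rightarrow> real"
  assume xy: "(a, x) \<in> period_partitions" "(b, y) \<in> period_partitions"
  have "ennreal (\<Sum>i<a. \<Sum>j<b. \<bar>net_diff (steklov_diff2 h l k m f) x y i j\<bar> powr p)
    = (\<Sum>i<a. \<Sum>j<b. ennreal (\<bar>net_diff (steklov_diff2 h l k m f) x y i j\<bar> powr p))"
    by (simp add: sum_nonneg)
  also have "\<dots> \<le> (\<Sum>i<N. \<Sum>j<M. ennreal c * ennreal d * powint2 p (mixed_diff (s i) (t j) f))"
    unfolding net_diff_def by (rule steklov_diff2_variation[OF Lper2 h k H K xy])
  also have "\<dots> \<le> (\<Sum>i<N. \<Sum>j<M. ennreal c * ennreal d * ennreal (\<omega> u v powr p))"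
    using s t by (intro sum_mono mult_left_mono omega_bound) auto
  also have "\<dots> = ennreal (real N * c * (real M * d) * \<omega> u v powr p)"
    using cd by (simp add: ennreal_mult[symmetric] ennreal_of_nat_eq_real_of_nat mult_ac)
  also have "real N * c * (real M * d) * \<omega> u v powr p = ((real N * c * (real M * d)) powr (1 / p) * \<omega> u v) powr p"
    using cd p omega_nonneg by (simp add: powr_mult powr_powr)
  finally show "(\<Sum>i<a. \<Sum>j<b. \<bar>net_diff (steklov_diff2 h l k m f) x y i j\<bar> powr p)
    \<le> ((real N * c * (real M * d)) powr (1 / p) * \<omega> u v) powr p"
    by (simp add: ennreal_le_iff)
qed (simp add: omega_nonneg)

text \<open>The constant 16 is \<open>4\<close> from each of the two variables.\<close>
lemma steklov_diff2_p_variation2_coarse: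
  assumes h: "0 < h" "0 < l" and k: "0 < k" "0 < m" "real m * k \<le> 1"
  shows "p_variation2 p (steklov_diff2 h l k m f) \<le> ennreal (16 * (h * k) powr (- 1 / p) * \<omega> (real l * h) (real m * k))"
proof -
  have "p_variation2 p (steklov_diff2 h l k m f) \<le> ennreal ((real l * (4 powr p / (h * real l)) * (real m * (4 powr p / (k * real m)))) powr (1 / p) * \<omega> (real l * h) (real m * k))"
    by (rule steklov_diff2_p_variation2[OF h k variation_bound_many[OF h p] variation_bound_many[OF k(1,2) p]]) (use h k in auto)
  also have "(real l * (4 powr p / (h * real l)) * (real m * (4 powr p / (k * real m)))) powr (1 / p) = 16 * (h * k) powr (- 1 / p)"
    using h k p by (simp add: powr_divide powr_mult powr_powr powr_minus_divide)
  finally show ?thesis .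
qed

lemma steklov_diff2_p_variation2_fine:
  assumes h: "0 < h" "0 < l" and k: "0 < k" "0 < m" "real m * k \<le> 1"
  shows "p_variation2 p (steklov_diff2 h l k m f) \<le> ennreal (16 * (real l powr (1 - 1 / p) * real m powr (1 - 1 / p)) * (h * k) powr (- 1 / p) * \<omega> h k)"
proof -
  have "p_variation2 p (steklov_diff2 h l k m f) \<le> ennreal ((real 1 * (4 powr p * real l powr (p - 1) / h) * (real 1 * (4 powr p * real m powr (p - 1) / k))) powr (1 / p) * \<omega> h k)"
    by (rule steklov_diff2_p_variation2[OF h k variation_bound_one[OF h p] variation_bound_one[OF k(1,2) p]]) (use h k in auto)
  also have "(real 1 * (4 powr p * real l powr (p - 1) / h) * (real 1 * (4 powr p * real m powr (p - 1) / k))) powr (1 / p)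
    = 16 * (real l powr (1 - 1 / p) * real m powr (1 - 1 / p)) * (h * k) powr (- 1 / p)"
    using h k p by (simp add: powr_divide powr_mult powr_powr powr_minus_divide diff_divide_distrib)
  finally show ?thesis .
qed

end

section \<open>Geometric meshes and the integrals K and I\<close>

text \<open>An integer ratio near \<open>2\<^sup>q\<close>. The lower bound makes the mass of an octave large, the upper bound makes
the change of scale from one mesh point to the next cost only a constant.\<close>
lemma exists_scale:
  fixes q :: real
  assumes "1 \<le> q"
  shows "\<exists>L::nat. 2 \<le> L \<and> 2 \<le> real L powr (1 / q) \<and> real L powr (1 / q) \<le> 3"
proof -
  \<comment> \<open>The upper bound holds since \<open>2\<^sup>q + 1 \<le> 3\<^sup>q\<close>.\<close>
  define L where "L = nat \<lceil>2 powr q\<rceil>"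
  have p2: "(2::real) powr q \<ge> 2" using powr_mono[of 1 q 2] assms by simp
  have L: "2 powr q \<le> real L" "real L \<le> 2 powr q + 1" unfolding L_def using p2 by linarith+
  have "(3::real) powr q = 2 powr q * (3/2) powr q" by (simp flip: powr_mult)
  moreover have "(3/2::real) powr q \<ge> 3/2" using powr_mono[of 1 q "3/2"] assms by simp
  then have "(2::real) powr q * (3/2) powr q \<ge> 2 powr q * (3/2)" by (intro mult_left_mono) auto
  ultimately have L3: "real L \<le> 3 powr q" using L(2) p2 by linarith
  have "(2 powr q) powr (1 / q) \<le> real L powr (1 / q)" using L assms by (intro powr_mono2) auto
  moreover have "real L powr (1 / q) \<le> (3 powr q) powr (1 / q)" using L3 assms by (intro powr_mono2) auto
  ultimately show ?thesis using L p2 assms by (intro exI[of _ L]) (auto simp: powr_powr)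
qed

lemma nn_integral_Ioc_Icc:
  fixes g :: "real \<Rightarrow> ennreal"
  shows "(\<integral>\<^sup>+t\<in>{e<..d}. g t \<partial>lborel) = (\<integral>\<^sup>+t\<in>{e..d}. g t \<partial>lborel)"
  using AE_lborel_singleton[of e] by (intro nn_integral_cong_AE) (auto elim!: eventually_mono simp: indicator_def)

lemma nn_integral_powr_coarse:
  fixes p :: real
  assumes "1 < p" "0 < e" "e \<le> d"
  shows "(\<integral>\<^sup>+t\<in>{e<..d}. ennreal (t powr (- 1 / p) / t) \<partial>lborel) = ennreal (p * (e powr (- 1 / p) - d powr (- 1 / p)))"
proof -
  have "(\<integral>\<^sup>+t\<in>{e..d}. ennreal (t powr (- 1 / p) / t) \<partial>lborel) = ennreal ((\<lambda>t. - p * t powr (- 1 / p)) d - (\<lambda>t. - p * t powr (- 1 / p)) e)"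
  proof (rule nn_integral_FTC_Icc)
    fix t assume "t \<in> {e..d}"
    then have "t > 0" using assms by simp
    then show "((\<lambda>t. - p * t powr (- 1 / p)) has_real_derivative t powr (- 1 / p) / t) (at t)"
      using assms by (auto intro!: derivative_eq_intros simp: powr_diff)
    show "0 \<le> t powr (- 1 / p) / t" using \<open>t > 0\<close> by simp
  qed (use assms in auto)
  then show ?thesis by (simp add: nn_integral_Ioc_Icc right_diff_distrib)
qed

lemma nn_integral_powr_fine:
  fixes p :: real
  assumes "1 < p" "0 < e" "e \<le> d"
  shows "(\<integral>\<^sup>+t\<in>{e<..d}. ennreal (t powr (- 1 / p)) \<partial>lborel) = ennreal ((d powr (1 - 1 / p) - e powr (1 - 1 / p)) / (1 - 1 / p))"
proof -
  have r: "1 - 1 / p > 0" using assms by simp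
  have "(\<integral>\<^sup>+t\<in>{e..d}. ennreal (t powr (- 1 / p)) \<partial>lborel) = ennreal ((\<lambda>t. t powr (1 - 1 / p) / (1 - 1 / p)) d - (\<lambda>t. t powr (1 - 1 / p) / (1 - 1 / p)) e)"
  proof (rule nn_integral_FTC_Icc)
    fix t assume "t \<in> {e..d}"
    then have "t > 0" using assms by simp
    then have "((\<lambda>t. t powr (1 - 1 / p) / (1 - 1 / p)) has_real_derivative ((1 - 1 / p) * t powr (1 - 1 / p - 1)) / (1 - 1 / p)) (at t)"
      by (intro DERIV_cdivide has_real_derivative_powr)
    then show "((\<lambda>t. t powr (1 - 1 / p) / (1 - 1 / p)) has_real_derivative t powr (- 1 / p)) (at t)"
      using r assms(1) by simp
  qed (use assms in auto)
  then show ?thesis by (simp add: nn_integral_Ioc_Icc diff_divide_distrib)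
qed

definition mesh :: "nat \<Rightarrow> nat \<Rightarrow> real" where
  "mesh L n = (1 / real L) ^ n"

lemma sum_indicator_disjoint_le:
  fixes X :: "nat \<Rightarrow> ennreal"
  assumes "disjoint_family D" "\<And>n. n < K \<Longrightarrow> x \<in> D n \<Longrightarrow> X n \<le> Y"
  shows "(\<Sum>n<K. X n * indicator (D n) x) \<le> Y"
proof (cases "\<exists>n<K. x \<in> D n")
  case True
  then obtain n where n: "n < K" "x \<in> D n" by blast
  \<comment> \<open>At most one summand is different from zero.\<close>
  have uniq: "(x \<in> D k) = (k = n)" for k
    using assms(1) n(2) by (auto simp: disjoint_family_on_def)
  have "(\<Sum>k<K. X k * indicator (D k) x) = (\<Sum>k<K. if k = n then X n else 0)"
    by (intro sum.cong refl) (simp add: indicator_def uniq)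
  then show ?thesis using n assms(2) by simp
qed (auto simp: indicator_def)

context
  fixes L :: nat
  assumes L: "2 \<le> L"
begin

lemma mesh_pos: "0 < mesh L n" using L by (simp add: mesh_def)

lemma mesh_0: "mesh L 0 = 1" by (simp add: mesh_def)

lemma mesh_Suc: "real L * mesh L (Suc n) = mesh L n" using L by (simp add: mesh_def)

lemma mesh_antimono: "m \<le> n \<Longrightarrow> mesh L n \<le> mesh L m"
  unfolding mesh_def using L by (intro power_decreasing) auto

lemma mesh_le_1: "mesh L n \<le> 1" using mesh_antimono[of 0 n] by (simp add: mesh_0)

definition octave :: "nat \<Rightarrow> real set" where
  "octave n = {mesh L (Suc n)<..mesh L n}"

lemma octave_disjoint: "disjoint_family octave"
proof -
  have "octave m \<inter> octave n = {}" if "m < n" for m n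
    using mesh_antimono[of "Suc m" n] that by (auto simp: octave_def)
  then show ?thesis unfolding disjoint_family_on_def by (metis Int_commute linorder_neqE_nat)
qed

lemma octave_subset: "octave n \<subseteq> {0<..1}"
  using mesh_pos[of "Suc n"] mesh_le_1[of n] by (auto simp: octave_def)

lemma octave_sets [measurable]: "octave n \<in> sets borel" by (simp add: octave_def)

text \<open>Here the gain is the factor \<open>p\<close>: the octave is so long that the antiderivative \<open>-p t\<^bsup>-1/p\<^esup>\<close> of the weight loses at
least half of its size.\<close>
lemma octave_weight_coarse:
  assumes "1 < p" "2 \<le> real L powr (1 / p)"
  shows "ennreal (p / 2 * mesh L (Suc n) powr (- 1 / p)) \<le> (\<integral>\<^sup>+t\<in>octave n. ennreal (t powr (- 1 / p) / t) \<partial>lborel)"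
proof -
  let ?e = "mesh L (Suc n)"
  have "mesh L n powr (- 1 / p) = real L powr (- 1 / p) * ?e powr (- 1 / p)"
    using mesh_Suc[of n] mesh_pos[of "Suc n"] by (metis less_imp_le of_nat_0_le_iff powr_mult)
  also have "\<dots> \<le> (1 / 2) * ?e powr (- 1 / p)"
    using assms L by (intro mult_right_mono) (auto simp: powr_minus_divide intro!: divide_left_mono[where b=2 and c=1, simplified])
  finally have "p / 2 * ?e powr (- 1 / p) \<le> p * (?e powr (- 1 / p) - mesh L n powr (- 1 / p))"
    using assms by (simp add: field_simps)
  then show ?thesis
    unfolding octave_def by (subst nn_integral_powr_coarse[OF assms(1) mesh_pos mesh_antimono]) (auto intro: ennreal_leI)
qed

text \<open>The counterpart for the weight \<open>t\<^bsup>-1/p\<^esup>\<close>, with the gain \<open>p' = 1 / (1 - 1/p)\<close>.\<close>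
lemma octave_weight_fine:
  assumes "1 < p" "2 \<le> real L powr (1 - 1 / p)"
  shows "ennreal (mesh L n powr (1 - 1 / p) / (2 * (1 - 1 / p))) \<le> (\<integral>\<^sup>+t\<in>octave n. ennreal (t powr (- 1 / p)) \<partial>lborel)"
proof -
  let ?r = "1 - 1 / p" and ?e = "mesh L (Suc n)"
  have r: "?r > 0" using assms by simp
  have "mesh L n powr ?r = real L powr ?r * ?e powr ?r"
    using mesh_Suc[of n] mesh_pos[of "Suc n"] by (metis less_imp_le of_nat_0_le_iff powr_mult)
  moreover have "\<dots> \<ge> 2 * ?e powr ?r" using assms by (intro mult_right_mono) auto
  ultimately have "mesh L n powr ?r / 2 \<le> mesh L n powr ?r - ?e powr ?r" by linarith
  then have "mesh L n powr ?r / 2 / ?r \<le> (mesh L n powr ?r - ?e powr ?r) / ?r"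
    using r by (intro divide_right_mono) auto
  then show ?thesis
    unfolding octave_def by (subst nn_integral_powr_fine[OF assms(1) mesh_pos mesh_antimono]) (auto intro: ennreal_leI)
qed

end

context Lp_periodic begin

text \<open>The integral is bounded from below by integrating a step function on the products of octaves. Monotonicity of the
integral holds for arbitrary integrands, hence also for the modulus as a function of both variables, while additivity is
applied to the step function alone.\<close>
lemma I_fun_lower:
  assumes L: "2 \<le> L" and [measurable]: "w \<in> borel_measurable borel" and w: "\<And>t. 0 \<le> w t" and c: "\<And>n m. 0 \<le> c n m"
    and le: "\<And>n m u v. u \<in> octave L n \<Longrightarrow> v \<in> octave L m \<Longrightarrow>
      c n m * w u * w v \<le> (u * v) powr (- 1 / p) / (u * v) * \<omega> u v"
    and J: "\<And>n. ennreal (j n) \<le> (\<integral>\<^sup>+t\<in>octave L n. ennreal (w t) \<partial>lborel)" and j: "\<And>n. 0 \<le> j n"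
  shows "ennreal (\<Sum>n<K. \<Sum>m<K. c n m * j n * j m) \<le> I_fun p f"
proof -
  define J' where "J' n = (\<integral>\<^sup>+t\<in>octave L n. ennreal (w t) \<partial>lborel)" for n
  note [measurable] = octave_sets[OF L]
  have oct: "t \<in> octave L n \<Longrightarrow> 0 < t \<and> t \<le> 1" for t n using octave_subset[OF L, of n] by auto
  define X where "X u v = ennreal ((u * v) powr (- 1 / p) / (u * v)) * mixed_modulus p f u v" for u v
  have Xle: "ennreal (c n m * w v) * ennreal (w u) \<le> X u v" if "u \<in> octave L n" "v \<in> octave L m" for u v n m
  proof -
    have "ennreal (c n m * w v) * ennreal (w u) = ennreal (c n m * w u * w v)"
      using w c by (simp add: ennreal_mult[symmetric] mult_ac)
    also have "\<dots> \<le> ennreal ((u * v) powr (- 1 / p) / (u * v) * \<omega> u v)" using le[OF that] by (rule ennreal_leI)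
    also have "\<dots> = X u v" unfolding X_def mixed_modulus_omega
      using octave_subset[OF L, of n] octave_subset[OF L, of m] that
      by (intro ennreal_mult) (auto simp: omega_nonneg subset_iff intro!: divide_nonneg_nonneg mult_nonneg_nonneg)
    finally show ?thesis .
  qed
  have inner: "(\<Sum>n<K. ennreal (c n m) * J' n) * ennreal (w v) \<le> (\<integral>\<^sup>+u\<in>{0<..1}. X u v \<partial>lborel)" if v: "v \<in> octave L m" for m v
  proof -
    have "(\<Sum>n<K. ennreal (c n m) * J' n) * ennreal (w v) = (\<Sum>n<K. ennreal (c n m * w v) * J' n)"
      using w c by (subst sum_distrib_right) (auto intro!: sum.cong simp: ennreal_mult mult_ac)
    also have "\<dots> = (\<integral>\<^sup>+u. (\<Sum>n<K. ennreal (c n m * w v) * (ennreal (w u) * indicator (octave L n) u)) \<partial>lborel)"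
      unfolding J'_def by (subst nn_integral_sum) (auto simp: nn_integral_cmult)
    also have "\<dots> \<le> (\<integral>\<^sup>+u. X u v * indicator {0<..1} u \<partial>lborel)"
    proof (intro nn_integral_mono)
      fix u
      have "(\<Sum>n<K. (ennreal (c n m * w v) * ennreal (w u)) * indicator (octave L n) u) \<le> X u v * indicator {0<..1} u"
        using Xle[OF _ v] by (intro sum_indicator_disjoint_le[OF octave_disjoint[OF L]]) (auto simp: indicator_def dest: oct)
      then show "(\<Sum>n<K. ennreal (c n m * w v) * (ennreal (w u) * indicator (octave L n) u)) \<le> X u v * indicator {0<..1} u"
        by (simp add: mult.assoc)
    qed
    finally show ?thesis .
  qed
  have "ennreal (\<Sum>n<K. \<Sum>m<K. c n m * j n * j m) = (\<Sum>m<K. \<Sum>n<K. ennreal (c n m) * ennreal (j n) * ennreal (j m))"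
  proof -
    have "ennreal (c n m) * ennreal (j n) * ennreal (j m) = ennreal (c n m * j n * j m)" for n m
      using c j by (simp add: ennreal_mult)
    moreover have "0 \<le> c n m * j n * j m" for n m using c j by simp
    ultimately show ?thesis by (subst sum.swap) (simp add: sum_nonneg)
  qed
  also have "\<dots> \<le> (\<Sum>m<K. \<Sum>n<K. ennreal (c n m) * J' n * J' m)"
    using J unfolding J'_def by (intro sum_mono mult_mono) auto
  also have "\<dots> = (\<Sum>m<K. (\<Sum>n<K. ennreal (c n m) * J' n) * J' m)"
    by (simp add: sum_distrib_right)
  also have "\<dots> = (\<integral>\<^sup>+v. (\<Sum>m<K. (\<Sum>n<K. ennreal (c n m) * J' n) * (ennreal (w v) * indicator (octave L m) v)) \<partial>lborel)"
    by (subst nn_integral_sum) (auto simp: nn_integral_cmult J'_def[symmetric])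
  also have "\<dots> \<le> (\<integral>\<^sup>+v. (\<integral>\<^sup>+u\<in>{0<..1}. X u v \<partial>lborel) * indicator {0<..1} v \<partial>lborel)"
  proof (intro nn_integral_mono)
    fix v
    have "(\<Sum>m<K. ((\<Sum>n<K. ennreal (c n m) * J' n) * ennreal (w v)) * indicator (octave L m) v) \<le> (\<integral>\<^sup>+u\<in>{0<..1}. X u v \<partial>lborel) * indicator {0<..1} v"
      using inner by (intro sum_indicator_disjoint_le[OF octave_disjoint[OF L]]) (auto simp: indicator_def dest: oct)
    then show "(\<Sum>m<K. (\<Sum>n<K. ennreal (c n m) * J' n) * (ennreal (w v) * indicator (octave L m) v)) \<le> (\<integral>\<^sup>+u\<in>{0<..1}. X u v \<partial>lborel) * indicator {0<..1} v"
      by (simp add: mult.assoc)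
  qed
  also have "\<dots> = I_fun p f" by (simp add: I_fun_def X_def)
  finally show ?thesis .
qed

lemma K_fun_lower:
  assumes L: "2 \<le> L"
    and J: "\<And>n. ennreal (j n) \<le> (\<integral>\<^sup>+t\<in>octave L n. ennreal (t powr (- 1 / p) / t) \<partial>lborel)" and j: "\<And>n. 0 \<le> j n"
  shows "ennreal (\<Sum>n<K. (\<omega> (mesh L (Suc n)) 1 + \<omega> 1 (mesh L (Suc n))) * j n) \<le> K_fun p f"
proof -
  let ?w = "\<lambda>t. t powr (- 1 / p) / t"
  let ?c = "\<lambda>n. \<omega> (mesh L (Suc n)) 1 + \<omega> 1 (mesh L (Suc n))"
  note [measurable] = octave_sets[OF L]
  have "ennreal (\<Sum>n<K. ?c n * j n) = (\<Sum>n<K. ennreal (?c n) * ennreal (j n))"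
  proof -
    have "ennreal (?c n) * ennreal (j n) = ennreal (?c n * j n)" for n
      by (rule ennreal_mult[symmetric]) (auto simp: omega_nonneg j)
    then show ?thesis by (simp only:) (subst sum_ennreal, auto simp: omega_nonneg j)
  qed
  also have "\<dots> \<le> (\<Sum>n<K. ennreal (?c n) * (\<integral>\<^sup>+t\<in>octave L n. ennreal (?w t) \<partial>lborel))"
    using J by (intro sum_mono mult_left_mono) auto
  also have "\<dots> = (\<integral>\<^sup>+t. (\<Sum>n<K. ennreal (?c n) * (ennreal (?w t) * indicator (octave L n) t)) \<partial>lborel)"
    by (subst nn_integral_sum) (auto simp: nn_integral_cmult)
  also have "\<dots> \<le> (\<integral>\<^sup>+t. (ennreal (?w t) * (mixed_modulus p f t 1 + mixed_modulus p f 1 t)) * indicator {0<..1} t \<partial>lborel)"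
  proof (intro nn_integral_mono)
    fix t
    have "(\<Sum>n<K. (ennreal (?c n) * ennreal (?w t)) * indicator (octave L n) t) \<le> (ennreal (?w t) * (mixed_modulus p f t 1 + mixed_modulus p f 1 t)) * indicator {0<..1} t"
    proof (rule sum_indicator_disjoint_le[OF octave_disjoint[OF L]])
      fix n assume t: "t \<in> octave L n"
      then have "t \<in> {0<..1}" using octave_subset[OF L] by blast
      moreover have "?c n \<le> \<omega> t 1 + \<omega> 1 t" using t by (intro add_mono omega_mono) (auto simp: octave_def[OF L])
      then have "ennreal (?c n) \<le> mixed_modulus p f t 1 + mixed_modulus p f 1 t"
        unfolding mixed_modulus_omega by (simp add: omega_nonneg flip: ennreal_plus)
      then have "ennreal (?w t) * ennreal (?c n) \<le> ennreal (?w t) * (mixed_modulus p f t 1 + mixed_modulus p f 1 t)"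
        by (rule mult_left_mono) simp
      ultimately show "ennreal (?c n) * ennreal (?w t) \<le> (ennreal (?w t) * (mixed_modulus p f t 1 + mixed_modulus p f 1 t)) * indicator {0<..1} t"
        by (simp add: mult.commute)
    qed
    then show "(\<Sum>n<K. ennreal (?c n) * (ennreal (?w t) * indicator (octave L n) t)) \<le> (ennreal (?w t) * (mixed_modulus p f t 1 + mixed_modulus p f 1 t)) * indicator {0<..1} t"
      by (simp add: mult.assoc)
  qed
  also have "\<dots> = K_fun p f" by (simp add: K_fun_def)
  finally show ?thesis .
qed

text \<open>The quantities whose double sum over the mesh discretizes \<open>I\<^sub>p(f)\<close>.\<close>
definition wmod :: "nat \<Rightarrow> nat \<Rightarrow> nat \<Rightarrow> real" where
  "wmod L n m = (mesh L n * mesh L m) powr (- 1 / p) * \<omega> (mesh L n) (mesh L m)"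

lemma wmod_nonneg: "0 \<le> wmod L n m" by (simp add: wmod_def omega_nonneg)

text \<open>Monotonicity of the modulus bounds the integrand from below by its value at the lower corner of a product of octaves.\<close>
lemma wmod_sum_coarse:
  assumes L: "2 \<le> L" "2 \<le> real L powr (1 / p)"
  shows "ennreal ((p / 2)\<^sup>2 * (\<Sum>n<K. \<Sum>m<K. wmod L (Suc n) (Suc m))) \<le> I_fun p f"
proof -
  let ?s = "mesh L"
  have "ennreal (\<Sum>n<K. \<Sum>m<K. \<omega> (?s (Suc n)) (?s (Suc m)) * (p / 2 * ?s (Suc n) powr (- 1 / p)) * (p / 2 * ?s (Suc m) powr (- 1 / p))) \<le> I_fun p f"
  proof (rule I_fun_lower[OF L(1), where w = "\<lambda>t. \<bar>t powr (- 1 / p) / t\<bar>"])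
    fix n m u v assume uv: "u \<in> octave L n" "v \<in> octave L m"
    then have pos: "0 < u" "0 < v" using octave_subset[OF L(1), of n] octave_subset[OF L(1), of m] by auto
    have "\<omega> (?s (Suc n)) (?s (Suc m)) \<le> \<omega> u v" using uv by (intro omega_mono) (auto simp: octave_def[OF L(1)])
    then have "\<omega> (?s (Suc n)) (?s (Suc m)) * ((u * v) powr (- 1 / p) / (u * v)) \<le> \<omega> u v * ((u * v) powr (- 1 / p) / (u * v))"
      using pos by (intro mult_right_mono) auto
    then show "\<omega> (?s (Suc n)) (?s (Suc m)) * \<bar>u powr (- 1 / p) / u\<bar> * \<bar>v powr (- 1 / p) / v\<bar> \<le> (u * v) powr (- 1 / p) / (u * v) * \<omega> u v"
      using pos by (simp add: powr_mult mult_ac)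
  next
    fix n
    have abs: "\<bar>t\<bar> = t" if "t \<in> octave L n" for t using octave_subset[OF L(1), of n] that by auto
    have "(\<integral>\<^sup>+t\<in>octave L n. ennreal (t powr (- 1 / p) / t) \<partial>lborel) = (\<integral>\<^sup>+t\<in>octave L n. ennreal \<bar>t powr (- 1 / p) / t\<bar> \<partial>lborel)"
      by (intro nn_integral_cong) (auto simp: indicator_def abs)
    then show "ennreal (p / 2 * ?s (Suc n) powr (- 1 / p)) \<le> (\<integral>\<^sup>+t\<in>octave L n. ennreal \<bar>t powr (- 1 / p) / t\<bar> \<partial>lborel)"
      using octave_weight_coarse[OF L(1) p L(2), of n] by simp
  qed (use p omega_nonneg in auto)
  also have "(\<Sum>n<K. \<Sum>m<K. \<omega> (?s (Suc n)) (?s (Suc m)) * (p / 2 * ?s (Suc n) powr (- 1 / p)) * (p / 2 * ?s (Suc m) powr (- 1 / p)))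
      = (p / 2)\<^sup>2 * (\<Sum>n<K. \<Sum>m<K. wmod L (Suc n) (Suc m))"
    using mesh_pos[OF L(1)] by (simp add: sum_distrib_left wmod_def powr_mult less_imp_le power2_eq_square mult_ac)
  finally show ?thesis .
qed

text \<open>The almost decreasing quotient \<open>\<omega>(u, v) / (u v)\<close> is bounded from below by its value at the upper corner of a product of
octaves; the two doubling inequalities cost a factor 4, the two masses of octaves another 4.\<close>
lemma wmod_sum_fine:
  assumes L: "2 \<le> L" "2 \<le> real L powr (1 - 1 / p)"
  shows "ennreal (1 / (4 * (1 - 1 / p))\<^sup>2 * (\<Sum>n<K. \<Sum>m<K. wmod L n m)) \<le> I_fun p f"
proof -
  let ?s = "mesh L" and ?r = "1 - 1 / p"
  have r: "?r > 0" using p by simp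
  have spos: "?s n > 0" for n by (rule mesh_pos[OF L(1)])
  have "ennreal (\<Sum>n<K. \<Sum>m<K. (\<omega> (?s n) (?s m) / (4 * ?s n * ?s m)) * (?s n powr ?r / (2 * ?r)) * (?s m powr ?r / (2 * ?r))) \<le> I_fun p f"
  proof (rule I_fun_lower[OF L(1), where w = "\<lambda>t. t powr (- 1 / p)"])
    fix n m u v assume uv: "u \<in> octave L n" "v \<in> octave L m"
    then have pos: "0 < u" "0 < v" using octave_subset[OF L(1), of n] octave_subset[OF L(1), of m] by auto
    have "\<omega> (?s n) (?s m) / ?s n \<le> 2 * \<omega> u (?s m) / u"
      using uv pos by (intro omega_doubling1) (auto simp: octave_def[OF L(1)])
    then have "\<omega> (?s n) (?s m) / ?s n / ?s m \<le> 2 * \<omega> u (?s m) / u / ?s m"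
      using spos by (intro divide_right_mono) (auto simp: less_imp_le)
    also have "\<dots> = 2 / u * (\<omega> u (?s m) / ?s m)" by simp
    also have "\<dots> \<le> 2 / u * (2 * \<omega> u v / v)"
      using uv pos by (intro mult_left_mono omega_doubling2) (auto simp: octave_def[OF L(1)])
    finally have "\<omega> (?s n) (?s m) / (4 * ?s n * ?s m) \<le> \<omega> u v / (u * v)" by simp
    then have "\<omega> (?s n) (?s m) / (4 * ?s n * ?s m) * (u * v) powr (- 1 / p) \<le> \<omega> u v / (u * v) * (u * v) powr (- 1 / p)"
      by (rule mult_right_mono) simp
    then show "\<omega> (?s n) (?s m) / (4 * ?s n * ?s m) * u powr (- 1 / p) * v powr (- 1 / p) \<le> (u * v) powr (- 1 / p) / (u * v) * \<omega> u v"
      using pos by (simp add: powr_mult mult_ac)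
  next
    show "ennreal (?s n powr ?r / (2 * ?r)) \<le> (\<integral>\<^sup>+t\<in>octave L n. ennreal (t powr (- 1 / p)) \<partial>lborel)" for n
      by (rule octave_weight_fine[OF L(1) p L(2)])
  qed (use r omega_nonneg spos in \<open>auto simp: less_imp_le\<close>)
  also have "(\<Sum>n<K. \<Sum>m<K. (\<omega> (?s n) (?s m) / (4 * ?s n * ?s m)) * (?s n powr ?r / (2 * ?r)) * (?s m powr ?r / (2 * ?r)))
      = 1 / (4 * ?r)\<^sup>2 * (\<Sum>n<K. \<Sum>m<K. wmod L n m)"
    unfolding sum_distrib_left
  proof (intro sum.cong refl)
    fix n m
    have algebra: "(A / (4 * a * b)) * (a * \<alpha> / (2 * r)) * (b * \<beta> / (2 * r)) = 1 / (4 * r)\<^sup>2 * (\<alpha> * \<beta> * A)"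
      if "a > 0" "b > 0" for A a b \<alpha> \<beta> r :: real
      using that by (simp add: power2_eq_square)
    have "?s k powr ?r = ?s k * ?s k powr (- 1 / p)" for k
      using spos[of k] powr_add[of "?s k" 1 "- 1 / p"] by simp
    then have "(\<omega> (?s n) (?s m) / (4 * ?s n * ?s m)) * (?s n powr ?r / (2 * ?r)) * (?s m powr ?r / (2 * ?r))
      = (\<omega> (?s n) (?s m) / (4 * ?s n * ?s m)) * (?s n * ?s n powr (- 1 / p) / (2 * ?r)) * (?s m * ?s m powr (- 1 / p) / (2 * ?r))" by simp
    also have "\<dots> = 1 / (4 * ?r)\<^sup>2 * (?s n powr (- 1 / p) * ?s m powr (- 1 / p) * \<omega> (?s n) (?s m))"
      by (rule algebra[OF spos spos])
    finally show "(\<omega> (?s n) (?s m) / (4 * ?s n * ?s m)) * (?s n powr ?r / (2 * ?r)) * (?s m powr ?r / (2 * ?r)) = 1 / (4 * ?r)\<^sup>2 * wmod L n m"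
      using spos[of n] spos[of m] by (simp add: wmod_def powr_mult)
  qed
  finally show ?thesis .
qed

end

section \<open>Variation of the blocks\<close>

context Lp_periodic begin

text \<open>The general term of the double telescoping series.\<close>
definition block :: "nat \<Rightarrow> nat \<Rightarrow> nat \<Rightarrow> real \<times> real \<Rightarrow> real" where
  "block L n m = steklov_diff2 (mesh L (Suc n)) L (mesh L (Suc m)) L f"

text \<open>Terms with an index 0 are controlled by terms with positive indices. So finiteness of \<open>I\<^sub>p(f)\<close> alone makes all the
sums finite, including those that correspond to \<open>K\<^sub>p(f)\<close>.\<close>
lemma wmod_Suc:
  assumes L: "2 \<le> L"
  shows "wmod L n m \<le> (real L)\<^sup>2 * wmod L (Suc n) (Suc m)"
proof -
  let ?s = "mesh L"
  have pos: "?s k > 0" for k by (rule mesh_pos[OF L])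
  have "\<omega> (?s n) (?s m) = \<omega> (real L * ?s (Suc n)) (real L * ?s (Suc m))" by (simp add: mesh_Suc[OF L])
  also have "\<dots> \<le> real L * \<omega> (?s (Suc n)) (real L * ?s (Suc m))" using L by (intro omega_scale1) auto
  also have "\<dots> \<le> real L * (real L * \<omega> (?s (Suc n)) (?s (Suc m)))"
    using L by (intro mult_left_mono omega_scale2) auto
  finally have \<omega>: "\<omega> (?s n) (?s m) \<le> (real L)\<^sup>2 * \<omega> (?s (Suc n)) (?s (Suc m))"
    by (simp add: power2_eq_square)
  have "?s (Suc n) * ?s (Suc m) \<le> ?s n * ?s m"
    using pos by (intro mult_mono mesh_antimono[OF L]) (auto simp: less_imp_le)
  then have "(?s n * ?s m) powr (- 1 / p) \<le> (?s (Suc n) * ?s (Suc m)) powr (- 1 / p)"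
    using pos p by (intro powr_mono2') auto
  then have "wmod L n m \<le> (?s (Suc n) * ?s (Suc m)) powr (- 1 / p) * ((real L)\<^sup>2 * \<omega> (?s (Suc n)) (?s (Suc m)))"
    unfolding wmod_def using \<omega> by (intro mult_mono) (auto simp: omega_nonneg)
  then show ?thesis by (simp add: wmod_def mult_ac)
qed

text \<open>Passing from the fine to the coarse step costs \<open>L\<^bsup>1/p\<^esup> \<le> 3\<close> in each variable, whence \<open>144 = 16 \<cdot> 9\<close>.\<close>
lemma block_variation_coarse:
  assumes L: "2 \<le> L" "real L powr (1 / p) \<le> 3"
  shows "p_variation2 p (block L n m) \<le> ennreal (144 * wmod L n m)"
proof -
  let ?s = "mesh L"
  have pos: "?s k > 0" for k by (rule mesh_pos[OF L(1)])
  have root: "?s (Suc k) powr (- 1 / p) = real L powr (1 / p) * ?s k powr (- 1 / p)" for k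
  proof -
    have "?s k powr (- 1 / p) = (real L * ?s (Suc k)) powr (- 1 / p)" by (simp only: mesh_Suc[OF L(1)])
    also have "\<dots> = real L powr (- 1 / p) * ?s (Suc k) powr (- 1 / p)"
      using pos[of "Suc k"] by (simp add: powr_mult)
    finally have "real L powr (1 / p) * ?s k powr (- 1 / p)
      = (real L powr (1 / p) * real L powr (- 1 / p)) * ?s (Suc k) powr (- 1 / p)" by (simp only: mult.assoc)
    moreover have "real L powr (1 / p) * real L powr (- 1 / p) = 1"
      using L by (simp add: powr_add[symmetric])
    ultimately show ?thesis by (simp only: mult_1)
  qed
  have "p_variation2 p (block L n m) \<le> ennreal (16 * (?s (Suc n) * ?s (Suc m)) powr (- 1 / p) * \<omega> (real L * ?s (Suc n)) (real L * ?s (Suc m)))"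
    unfolding block_def using L pos mesh_le_1[OF L(1)] by (intro steklov_diff2_p_variation2_coarse) (auto simp: mesh_Suc)
  also have "\<dots> \<le> ennreal (144 * wmod L n m)"
  proof (rule ennreal_leI)
    have "(?s (Suc n) * ?s (Suc m)) powr (- 1 / p) = (real L powr (1 / p) * real L powr (1 / p)) * (?s n * ?s m) powr (- 1 / p)"
    proof -
      have prod: "(?s a * ?s b) powr (- 1 / p) = ?s a powr (- 1 / p) * ?s b powr (- 1 / p)" for a b
        using pos[of a] pos[of b] by (simp add: powr_mult)
      show ?thesis unfolding prod root by (simp only: mult_ac)
    qed
    also have "\<dots> \<le> (3 * 3) * (?s n * ?s m) powr (- 1 / p)"
      using L by (intro mult_right_mono mult_mono) auto
    finally have "16 * (?s (Suc n) * ?s (Suc m)) powr (- 1 / p) * \<omega> (?s n) (?s m) \<le> 16 * ((3 * 3) * (?s n * ?s m) powr (- 1 / p)) * \<omega> (?s n) (?s m)"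
      by (intro mult_right_mono mult_left_mono) (auto simp: omega_nonneg)
    then show "16 * (?s (Suc n) * ?s (Suc m)) powr (- 1 / p) * \<omega> (real L * ?s (Suc n)) (real L * ?s (Suc m)) \<le> 144 * wmod L n m"
      by (simp add: mesh_Suc[OF L(1)] wmod_def)
  qed
  finally show ?thesis .
qed

lemma block_variation_fine:
  assumes L: "2 \<le> L" "real L powr (1 - 1 / p) \<le> 3"
  shows "p_variation2 p (block L n m) \<le> ennreal (144 * wmod L (Suc n) (Suc m))"
proof -
  let ?s = "mesh L"
  have pos: "?s k > 0" for k by (rule mesh_pos[OF L(1)])
  have "p_variation2 p (block L n m) \<le> ennreal (16 * (real L powr (1 - 1 / p) * real L powr (1 - 1 / p)) * (?s (Suc n) * ?s (Suc m)) powr (- 1 / p) * \<omega> (?s (Suc n)) (?s (Suc m)))"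
    unfolding block_def using L pos mesh_le_1[OF L(1)] by (intro steklov_diff2_p_variation2_fine) (auto simp: mesh_Suc)
  also have "\<dots> \<le> ennreal (144 * wmod L (Suc n) (Suc m))"
  proof (rule ennreal_leI)
    have "16 * (real L powr (1 - 1 / p) * real L powr (1 - 1 / p)) * ((?s (Suc n) * ?s (Suc m)) powr (- 1 / p) * \<omega> (?s (Suc n)) (?s (Suc m)))
      \<le> 16 * (3 * 3) * ((?s (Suc n) * ?s (Suc m)) powr (- 1 / p) * \<omega> (?s (Suc n)) (?s (Suc m)))"
      using L by (intro mult_right_mono mult_left_mono mult_mono) (auto simp: omega_nonneg)
    then show "16 * (real L powr (1 - 1 / p) * real L powr (1 - 1 / p)) * (?s (Suc n) * ?s (Suc m)) powr (- 1 / p) * \<omega> (?s (Suc n)) (?s (Suc m)) \<le> 144 * wmod L (Suc n) (Suc m)"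
      by (simp add: wmod_def mult.assoc)
  qed
  finally show ?thesis .
qed

text \<open>The bracket of the theorem, with \<open>1/(p p')\<close> written as \<open>(1/p)(1 - 1/p)\<close>.\<close>
definition main_bound :: ennreal where
  "main_bound = mixed_modulus p f 1 1 + ennreal (1 / p * (1 - 1 / p)) * K_fun p f + ennreal ((1 / p * (1 - 1 / p))\<^sup>2) * I_fun p f"

lemma sum_square_Suc:
  fixes a :: "nat \<Rightarrow> nat \<Rightarrow> real"
  shows "(\<Sum>n<Suc K. \<Sum>m<Suc K. a n m) = a 0 0 + (\<Sum>n<K. a (Suc n) 0 + a 0 (Suc n)) + (\<Sum>n<K. \<Sum>m<K. a (Suc n) (Suc m))"
  unfolding sum.lessThan_Suc_shift by (simp add: sum.distrib)

lemma sum_square_mono: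
  fixes a :: "nat \<Rightarrow> nat \<Rightarrow> real"
  assumes "\<And>n m. 0 \<le> a n m" "K \<le> K'"
  shows "(\<Sum>n<K. \<Sum>m<K. a n m) \<le> (\<Sum>n<K'. \<Sum>m<K'. a n m)"
proof -
  have "(\<Sum>n<K. \<Sum>m<K. a n m) \<le> (\<Sum>n<K. \<Sum>m<K'. a n m)"
    using assms by (intro sum_mono sum_mono2) auto
  also have "\<dots> \<le> (\<Sum>n<K'. \<Sum>m<K'. a n m)"
    using assms by (intro sum_mono2) (auto intro: sum_nonneg)
  finally show ?thesis .
qed

text \<open>For \<open>p \<ge> 2\<close> the block \<open>(n, m)\<close> is bounded by the weighted modulus at \<open>(n, m)\<close>: the corner \<open>n = m = 0\<close> is
\<open>\<omega>(1, 1)\<close>, the two edges belong to \<open>K\<^sub>p(f)\<close> and the rest to \<open>I\<^sub>p(f)\<close>. For \<open>p < 2\<close> it is bounded by the weighted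
modulus at \<open>(n + 1, m + 1)\<close>, and all of these terms belong to \<open>I\<^sub>p(f)\<close>. The constant is \<open>9216 = 144 \<cdot> 64\<close>.\<close>
lemma block_bounds:
  assumes fin: "I_fun p f < \<infinity>"
  obtains L b T where "2 \<le> L" "\<And>n m. 0 \<le> b n m" "\<And>n m. p_variation2 p (block L n m) \<le> ennreal (b n m)"
    "\<And>K. ennreal (\<Sum>n<K. \<Sum>m<K. b n m) \<le> ennreal 9216 * main_bound"
    "\<And>K. (\<Sum>n<K. \<Sum>m<K. b n m) \<le> T" "\<And>K. (\<Sum>n<K. \<Sum>m<K. wmod L (Suc n) (Suc m)) \<le> T"
proof -
  obtain i where i: "I_fun p f = ennreal i" "0 \<le> i" using fin by (cases "I_fun p f") auto
  define \<kappa> where "\<kappa> = 1 / p * (1 - 1 / p)"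
  have r: "0 < 1 - 1 / p" using p by simp
  have \<kappa>: "\<kappa> > 0" unfolding \<kappa>_def using p by (intro mult_pos_pos) auto
  have main_bound: "main_bound = ennreal (\<omega> 1 1) + ennreal \<kappa> * K_fun p f + ennreal (\<kappa>\<^sup>2 * i)"
    unfolding main_bound_def \<kappa>_def[symmetric] mixed_modulus_omega i(1) using i(2) by (simp add: ennreal_mult)
  show ?thesis
  proof (cases "p \<ge> 2")
    case True
    obtain L :: nat where L: "2 \<le> L" "2 \<le> real L powr (1 / p)" "real L powr (1 / p) \<le> 3"
      using exists_scale[of p] p by auto
    \<comment> \<open>Here \<open>p \<ge> 2\<close> enters: \<open>1 - 1/p \<ge> 1/2\<close>.\<close>
    have \<kappa>p: "1 / p \<le> 2 * \<kappa>"
    proof -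
      have "1 / p * 1 \<le> 1 / p * (2 * (1 - 1 / p))" using True by (intro mult_left_mono) auto
      then show ?thesis by (simp add: \<kappa>_def)
    qed
    let ?S = "\<lambda>K. \<Sum>n<K. \<Sum>m<K. wmod L (Suc n) (Suc m)"
    let ?B = "\<lambda>K. \<Sum>n<K. wmod L (Suc n) 0 + wmod L 0 (Suc n)"
    have S: "?S K \<le> (2 / p)\<^sup>2 * i" for K
    proof -
      have "(p / 2)\<^sup>2 * ?S K \<le> i" using wmod_sum_coarse[OF L(1,2), of K] i by (simp add: ennreal_le_iff)
      then have "(2 / p)\<^sup>2 * ((p / 2)\<^sup>2 * ?S K) \<le> (2 / p)\<^sup>2 * i" by (intro mult_left_mono) auto
      moreover have "(2 / p)\<^sup>2 * (p / 2)\<^sup>2 = 1" using p by (simp flip: power_mult_distrib)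
      ultimately show ?thesis by (simp flip: mult.assoc)
    qed
    have S': "?S K \<le> 16 * \<kappa>\<^sup>2 * i" for K
    proof -
      have "(2 / p)\<^sup>2 \<le> (4 * \<kappa>)\<^sup>2" using \<kappa>p p by (intro power_mono) auto
      then have "(2 / p)\<^sup>2 * i \<le> (4 * \<kappa>)\<^sup>2 * i" using i by (intro mult_right_mono) auto
      then show ?thesis using S[of K] by (simp add: power_mult_distrib)
    qed
    have B: "ennreal (?B K) \<le> ennreal (4 * \<kappa>) * K_fun p f" for K
    proof -
      have "ennreal (\<Sum>n<K. (\<omega> (mesh L (Suc n)) 1 + \<omega> 1 (mesh L (Suc n))) * (p / 2 * mesh L (Suc n) powr (- 1 / p))) \<le> K_fun p f"
        using p by (intro K_fun_lower[OF L(1)] octave_weight_coarse[OF L(1) p L(2)]) auto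
      also have "(\<Sum>n<K. (\<omega> (mesh L (Suc n)) 1 + \<omega> 1 (mesh L (Suc n))) * (p / 2 * mesh L (Suc n) powr (- 1 / p))) = p / 2 * ?B K"
        unfolding sum_distrib_left by (intro sum.cong) (simp_all add: wmod_def mesh_0[OF L(1)] algebra_simps)
      finally have "ennreal (2 / p) * ennreal (p / 2 * ?B K) \<le> ennreal (2 / p) * K_fun p f"
        by (rule mult_left_mono) simp
      also have "ennreal (2 / p) * ennreal (p / 2 * ?B K) = ennreal (?B K)"
        using p by (subst ennreal_mult[symmetric]) (auto intro!: sum_nonneg mult_nonneg_nonneg add_nonneg_nonneg wmod_nonneg)
      also have "ennreal (2 / p) * K_fun p f \<le> ennreal (4 * \<kappa>) * K_fun p f"
        using \<kappa>p by (intro mult_right_mono ennreal_leI) auto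
      finally show ?thesis .
    qed
    have W11: "wmod L 0 0 = \<omega> 1 1" by (simp add: wmod_def mesh_0[OF L(1)])
    define T where "T = max (144 * (real L)\<^sup>2 * ((2 / p)\<^sup>2 * i)) ((2 / p)\<^sup>2 * i)"
    show ?thesis
    proof (rule that[of L "\<lambda>n m. 144 * wmod L n m" T])
      show "p_variation2 p (block L n m) \<le> ennreal (144 * wmod L n m)" for n m
        by (rule block_variation_coarse[OF L(1,3)])
      show "ennreal (\<Sum>n<K. \<Sum>m<K. 144 * wmod L n m) \<le> ennreal 9216 * main_bound" for K
      proof -
        have "(\<Sum>n<K. \<Sum>m<K. 144 * wmod L n m) \<le> (\<Sum>n<Suc K. \<Sum>m<Suc K. 144 * wmod L n m)"
          by (rule sum_square_mono) (auto simp: wmod_nonneg)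
        also have "\<dots> = 144 * (\<omega> 1 1 + ?B K + ?S K)"
          unfolding sum_square_Suc[symmetric] W11[symmetric] by (simp only: sum_distrib_left)
        finally have "ennreal (\<Sum>n<K. \<Sum>m<K. 144 * wmod L n m) \<le> ennreal (144 * (\<omega> 1 1 + ?B K + ?S K))" by (rule ennreal_leI)
        also have "\<dots> = ennreal 144 * (ennreal (\<omega> 1 1) + ennreal (?B K) + ennreal (?S K))"
        proof -
          have "0 \<le> ?B K" "0 \<le> ?S K" by (auto intro!: sum_nonneg add_nonneg_nonneg wmod_nonneg)
          then show ?thesis using omega_nonneg[of 1 1] by (simp only: ennreal_mult ennreal_plus add_nonneg_nonneg zero_le_numeral)
        qed
        also have "\<dots> \<le> ennreal 144 * (ennreal 64 * ennreal (\<omega> 1 1) + ennreal 64 * (ennreal \<kappa> * K_fun p f) + ennreal 64 * ennreal (\<kappa>\<^sup>2 * i))"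
        proof (intro mult_left_mono add_mono)
          show "ennreal (\<omega> 1 1) \<le> ennreal 64 * ennreal (\<omega> 1 1)"
            using omega_nonneg[of 1 1] by (subst ennreal_mult[symmetric]) (auto intro: ennreal_leI)
          have "ennreal (4 * \<kappa>) * K_fun p f \<le> ennreal (64 * \<kappa>) * K_fun p f"
            using \<kappa> by (intro mult_right_mono ennreal_leI) auto
          then show "ennreal (?B K) \<le> ennreal 64 * (ennreal \<kappa> * K_fun p f)"
            using B[of K] \<kappa> by (simp add: ennreal_mult mult.assoc)
          have "0 \<le> \<kappa>\<^sup>2 * i" using i by simp
          then have "?S K \<le> 64 * (\<kappa>\<^sup>2 * i)" using S'[of K] unfolding mult.assoc by linarith
          then show "ennreal (?S K) \<le> ennreal 64 * ennreal (\<kappa>\<^sup>2 * i)"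
            using i by (subst ennreal_mult[symmetric]) (auto intro: ennreal_leI)
        qed auto
        also have "\<dots> = ennreal 144 * ennreal 64 * main_bound"
          by (simp only: main_bound distrib_left mult.assoc)
        also have "ennreal 144 * ennreal 64 = ennreal 9216" by (subst ennreal_mult[symmetric]) auto
        finally show ?thesis .
      qed
      show "(\<Sum>n<K. \<Sum>m<K. 144 * wmod L n m) \<le> T" for K
      proof -
        have "(\<Sum>n<K. \<Sum>m<K. 144 * wmod L n m) \<le> (\<Sum>n<K. \<Sum>m<K. 144 * ((real L)\<^sup>2 * wmod L (Suc n) (Suc m)))"
          by (intro sum_mono mult_left_mono wmod_Suc L) auto
        also have "\<dots> = 144 * (real L)\<^sup>2 * ?S K" by (simp add: sum_distrib_left mult.assoc)
        also have "\<dots> \<le> 144 * (real L)\<^sup>2 * ((2 / p)\<^sup>2 * i)" by (intro mult_left_mono S) auto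
        finally show ?thesis by (simp add: T_def)
      qed
      show "?S K \<le> T" for K using S[of K] by (simp add: T_def)
    qed (auto simp: L wmod_nonneg)
  next
    case False
    define q where "q = 1 / (1 - 1 / p)"
    have q: "1 \<le> q" "1 / q = 1 - 1 / p" using p r unfolding q_def by (simp_all add: field_simps)
    obtain L :: nat where L: "2 \<le> L" "2 \<le> real L powr (1 - 1 / p)" "real L powr (1 - 1 / p) \<le> 3"
      using exists_scale[OF q(1)] unfolding q(2) by auto
    \<comment> \<open>Here \<open>p < 2\<close> enters: \<open>1/p > 1/2\<close>.\<close>
    have \<kappa>r: "1 - 1 / p \<le> 2 * \<kappa>"
    proof -
      have "1 * (1 - 1 / p) \<le> 2 / p * (1 - 1 / p)" using False p r by (intro mult_right_mono) (auto simp: field_simps)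
      then show ?thesis by (simp add: \<kappa>_def)
    qed
    let ?S = "\<lambda>K. \<Sum>n<K. \<Sum>m<K. wmod L (Suc n) (Suc m)"
    have S: "?S K \<le> 64 * \<kappa>\<^sup>2 * i" for K
    proof -
      define s where "s = 1 - 1 / p"
      have s: "s > 0" "s \<le> 2 * \<kappa>" using r \<kappa>r by (auto simp: s_def)
      have "?S K \<le> (\<Sum>n<Suc K. \<Sum>m<Suc K. wmod L n m)"
        unfolding sum_square_Suc by (simp add: wmod_nonneg add_nonneg_nonneg sum_nonneg)
      moreover have "1 / (4 * s)\<^sup>2 * (\<Sum>n<Suc K. \<Sum>m<Suc K. wmod L n m) \<le> i"
        using wmod_sum_fine[OF L(1,2), of "Suc K"] i unfolding s_def[symmetric] by (simp add: ennreal_le_iff del: sum.lessThan_Suc)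
      then have "(\<Sum>n<Suc K. \<Sum>m<Suc K. wmod L n m) \<le> (4 * s)\<^sup>2 * i"
        using s by (simp add: field_simps del: sum.lessThan_Suc)
      moreover have "(4 * s)\<^sup>2 * i \<le> (8 * \<kappa>)\<^sup>2 * i" using s i by (intro mult_right_mono power_mono) auto
      moreover have "(8 * \<kappa>)\<^sup>2 * i = 64 * \<kappa>\<^sup>2 * i" by (simp add: power_mult_distrib)
      ultimately show ?thesis by linarith
    qed
    define T where "T = max (144 * (64 * \<kappa>\<^sup>2 * i)) (64 * \<kappa>\<^sup>2 * i)"
    show ?thesis
    proof (rule that[of L "\<lambda>n m. 144 * wmod L (Suc n) (Suc m)" T])
      show "p_variation2 p (block L n m) \<le> ennreal (144 * wmod L (Suc n) (Suc m))" for n m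
        by (rule block_variation_fine[OF L(1,3)])
      have le: "(\<Sum>n<K. \<Sum>m<K. 144 * wmod L (Suc n) (Suc m)) \<le> 144 * (64 * \<kappa>\<^sup>2 * i)" for K
        unfolding sum_distrib_left[symmetric] using S[of K] by linarith
      show "(\<Sum>n<K. \<Sum>m<K. 144 * wmod L (Suc n) (Suc m)) \<le> T" for K
        using le[of K] by (simp add: T_def)
      show "ennreal (\<Sum>n<K. \<Sum>m<K. 144 * wmod L (Suc n) (Suc m)) \<le> ennreal 9216 * main_bound" for K
      proof -
        have "ennreal (\<Sum>n<K. \<Sum>m<K. 144 * wmod L (Suc n) (Suc m)) \<le> ennreal (9216 * (\<kappa>\<^sup>2 * i))"
          using le[of K] by (intro ennreal_leI) simp
        also have "\<dots> = ennreal 9216 * ennreal (\<kappa>\<^sup>2 * i)" using i by (intro ennreal_mult) auto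
        also have "\<dots> \<le> ennreal 9216 * main_bound"
          unfolding main_bound by (intro mult_left_mono) (auto simp: add_increasing)
        finally show ?thesis .
      qed
      show "?S K \<le> T" for K using S[of K] by (simp add: T_def)
    qed (auto simp: L wmod_nonneg)
  qed
qed

text \<open>The entries with one index equal to 1 are summable, hence tend to zero, and they dominate the modulus at \<open>(h(n), 1)\<close>
up to the factor \<open>L\<close>.\<close>
lemma wmod_tendsto_modulus:
  assumes L: "2 \<le> L" and T: "\<And>K. (\<Sum>n<K. \<Sum>m<K. wmod L (Suc n) (Suc m)) \<le> T"
  shows "(\<lambda>n. \<omega> (mesh L n) 1) \<longlonglongrightarrow> 0" "(\<lambda>n. \<omega> 1 (mesh L n)) \<longlonglongrightarrow> 0"
proof -
  let ?s = "mesh L"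
  have pos: "?s k > 0" for k by (rule mesh_pos[OF L])
  have root: "1 \<le> (?s n * ?s m) powr (- 1 / p)" for n m
  proof -
    have "?s n * ?s m \<le> 1 * 1" using pos by (intro mult_mono mesh_le_1[OF L]) (auto simp: less_imp_le)
    then have "1 powr (- 1 / p) \<le> (?s n * ?s m) powr (- 1 / p)" using pos p by (intro powr_mono2') auto
    then show ?thesis by simp
  qed
  have small: "\<omega> (?s n) (?s m) \<le> wmod L n m" for n m
    unfolding wmod_def using mult_right_mono[OF root omega_nonneg] by simp
  have one: "1 = real L * ?s 1" using mesh_Suc[OF L, of 0] mesh_0[OF L] by simp
  have 1: "\<omega> (?s n) 1 \<le> real L * wmod L n 1" for n
  proof -
    have "\<omega> (?s n) 1 \<le> real L * \<omega> (?s n) (?s 1)" using L by (subst one) (intro omega_scale2, auto)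
    also have "\<dots> \<le> real L * wmod L n 1" by (intro mult_left_mono small) auto
    finally show ?thesis .
  qed
  have 2: "\<omega> 1 (?s n) \<le> real L * wmod L 1 n" for n
  proof -
    have "\<omega> 1 (?s n) \<le> real L * \<omega> (?s 1) (?s n)" using L by (subst one) (intro omega_scale1, auto)
    also have "\<dots> \<le> real L * wmod L 1 n" by (intro mult_left_mono small) auto
    finally show ?thesis .
  qed
  have sum1: "(\<Sum>n<K. wmod L (Suc n) 1) \<le> T" for K
  proof -
    have "(\<Sum>n<K. wmod L (Suc n) 1) \<le> (\<Sum>n<K. \<Sum>m<K. wmod L (Suc n) (Suc m))"
      using member_le_sum[of 0 "{..<K}" "\<lambda>m. wmod L (Suc _) (Suc m)"] by (intro sum_mono) (auto simp: wmod_nonneg)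
    also note T
    finally show ?thesis .
  qed
  have sum2: "(\<Sum>n<K. wmod L 1 (Suc n)) \<le> T" for K
  proof -
    have "(\<Sum>n<K. wmod L 1 (Suc n)) \<le> (\<Sum>m<K. \<Sum>n<K. wmod L (Suc n) (Suc m))"
      using member_le_sum[of 0 "{..<K}" "\<lambda>n. wmod L (Suc n) (Suc _)"] by (intro sum_mono) (auto simp: wmod_nonneg)
    also have "\<dots> = (\<Sum>n<K. \<Sum>m<K. wmod L (Suc n) (Suc m))" by (rule sum.swap)
    also note T
    finally show ?thesis .
  qed
  have "summable (\<lambda>n. wmod L (Suc n) 1)"
    by (rule summableI_nonneg_bounded[OF wmod_nonneg sum1])
  then have lim1: "(\<lambda>n. real L * wmod L (Suc n) 1) \<longlonglongrightarrow> 0"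
    using summable_LIMSEQ_zero tendsto_mult_right_zero by blast
  have "(\<lambda>n. \<omega> (?s (Suc n)) 1) \<longlonglongrightarrow> 0"
    by (rule real_tendsto_sandwich[OF _ _ tendsto_const lim1]) (use 1 in \<open>auto simp: omega_nonneg\<close>)
  then show "(\<lambda>n. \<omega> (?s n) 1) \<longlonglongrightarrow> 0" by (rule LIMSEQ_imp_Suc)
  have "summable (\<lambda>n. wmod L 1 (Suc n))"
    by (rule summableI_nonneg_bounded[OF wmod_nonneg sum2])
  then have lim2: "(\<lambda>n. real L * wmod L 1 (Suc n)) \<longlonglongrightarrow> 0"
    using summable_LIMSEQ_zero tendsto_mult_right_zero by blast
  have "(\<lambda>n. \<omega> 1 (?s (Suc n))) \<longlonglongrightarrow> 0"
    by (rule real_tendsto_sandwich[OF _ _ tendsto_const lim2]) (use 2 in \<open>auto simp: omega_nonneg\<close>)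
  then show "(\<lambda>n. \<omega> 1 (?s n)) \<longlonglongrightarrow> 0" by (rule LIMSEQ_imp_Suc)
qed

end

section \<open>Partial sums of the double telescoping series\<close>

lemma integral_unit_shift:
  assumes G: "G \<in> Lper1"
  shows "(\<integral>s. G (s + c) \<partial>unit_leb) = (\<integral>s. G s \<partial>unit_leb)"
proof -
  note [measurable] = Lper1_measurable[OF G]
  have 1: "integrable unit_leb (\<lambda>s. G (s + c))" using Lper1_integrable[OF Lper1_shift[OF G]] .
  have "(\<integral>\<^sup>+s. ennreal (G (s + c)) \<partial>unit_leb) = (\<integral>\<^sup>+s. ennreal (G s) \<partial>unit_leb)"
    by (rule nn_integral_unit_shift[of "\<lambda>s. ennreal (G s)"]) (auto simp: Lper1_periodic[OF G])
  moreover have "(\<integral>\<^sup>+s. ennreal (- G (s + c)) \<partial>unit_leb) = (\<integral>\<^sup>+s. ennreal (- G s) \<partial>unit_leb)"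
    by (rule nn_integral_unit_shift[of "\<lambda>s. ennreal (- G s)"]) (auto simp: Lper1_periodic[OF G])
  ultimately show ?thesis
    using real_lebesgue_integral_def[OF 1] real_lebesgue_integral_def[OF Lper1_integrable[OF G]] by simp
qed

lemma steklov_1:
  assumes G: "G \<in> Lper1" shows "steklov 1 G x = (\<integral>s. G s \<partial>unit_leb)"
  using integral_unit_shift[OF G, of x] by (simp add: steklov_def add.commute)

lemma unit_pair_integrable:
  fixes H :: "real \<Rightarrow> real \<Rightarrow> real"
  assumes H: "(\<lambda>z. H (fst z) (snd z)) \<in> borel_measurable (borel \<Otimes>\<^sub>M borel)"
    and fin: "(\<integral>\<^sup>+x. (\<integral>\<^sup>+y. ennreal \<bar>H x y\<bar> \<partial>unit_leb) \<partial>unit_leb) < \<infinity>"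
  shows "integrable (unit_leb \<Otimes>\<^sub>M unit_leb) (\<lambda>(x, y). H x y)"
proof -
  have s: "sets (unit_leb \<Otimes>\<^sub>M unit_leb) = sets (borel \<Otimes>\<^sub>M (borel :: real measure))"
    by (intro sets_pair_measure_cong) auto
  have m: "(\<lambda>(x, y). H x y) \<in> borel_measurable (unit_leb \<Otimes>\<^sub>M unit_leb)"
    using H by (simp add: case_prod_beta' measurable_cong_sets[OF s refl])
  then have "(\<integral>\<^sup>+z. ennreal \<bar>case z of (x, y) \<Rightarrow> H x y\<bar> \<partial>(unit_leb \<Otimes>\<^sub>M unit_leb)) = (\<integral>\<^sup>+x. (\<integral>\<^sup>+y. ennreal \<bar>H x y\<bar> \<partial>unit_leb) \<partial>unit_leb)"
    by (subst unit_leb.nn_integral_fst[symmetric]) auto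
  then show ?thesis using m fin by (intro integrableI_bounded) auto
qed

lemma unit_Fubini:
  fixes H :: "real \<Rightarrow> real \<Rightarrow> real"
  assumes "(\<lambda>z. H (fst z) (snd z)) \<in> borel_measurable (borel \<Otimes>\<^sub>M borel)"
    and "(\<integral>\<^sup>+x. (\<integral>\<^sup>+y. ennreal \<bar>H x y\<bar> \<partial>unit_leb) \<partial>unit_leb) < \<infinity>"
  shows "(\<integral>x. (\<integral>y. H x y \<partial>unit_leb) \<partial>unit_leb) = (\<integral>y. (\<integral>x. H x y \<partial>unit_leb) \<partial>unit_leb)"
  using unit_pair.Fubini_integral[OF unit_pair_integrable[OF assms]] by simp

lemma steklov_mean:
  assumes G: "G \<in> Lper1"
  shows "integrable unit_leb (steklov h G)" and "(\<integral>x. steklov h G x \<partial>unit_leb) = (\<integral>s. G s \<partial>unit_leb)"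
proof -
  note [measurable] = Lper1_measurable[OF G]
  have m: "(\<lambda>z. G (fst z + h * snd z)) \<in> borel_measurable (borel \<Otimes>\<^sub>M borel)" by measurable
  have "(\<integral>\<^sup>+x. (\<integral>\<^sup>+s. ennreal \<bar>G (x + h * s)\<bar> \<partial>unit_leb) \<partial>unit_leb) = (\<integral>\<^sup>+s. (\<integral>\<^sup>+x. ennreal \<bar>G (x + h * s)\<bar> \<partial>unit_leb) \<partial>unit_leb)"
    using m by (intro nn_integral_unit_swap) (auto simp flip: borel_prod)
  also have "\<dots> = (\<integral>\<^sup>+s. (\<integral>\<^sup>+x. ennreal \<bar>G x\<bar> \<partial>unit_leb) \<partial>unit_leb)"
    by (intro nn_integral_cong nn_integral_unit_shift[of "\<lambda>x. ennreal \<bar>G x\<bar>"]) (auto simp: Lper1_periodic[OF G])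
  also have "\<dots> < \<infinity>" using Lper1_integrable[OF G] by (simp add: integrable_iff_bounded)
  finally have fin: "(\<integral>\<^sup>+x. (\<integral>\<^sup>+s. ennreal \<bar>G (x + h * s)\<bar> \<partial>unit_leb) \<partial>unit_leb) < \<infinity>" .
  show "integrable unit_leb (steklov h G)"
    using unit_pair.integrable_fst'[OF unit_pair_integrable[OF m fin]] by (simp add: steklov_def[abs_def])
  have "(\<integral>x. steklov h G x \<partial>unit_leb) = (\<integral>s. (\<integral>x. G (x + h * s) \<partial>unit_leb) \<partial>unit_leb)"
    unfolding steklov_def by (rule unit_Fubini[OF m fin])
  also have "\<dots> = (\<integral>s. G s \<partial>unit_leb)" by (simp add: integral_unit_shift[OF G])
  finally show "(\<integral>x. steklov h G x \<partial>unit_leb) = (\<integral>s. G s \<partial>unit_leb)" .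
qed

definition steklov2 :: "real \<Rightarrow> real \<Rightarrow> (real \<times> real \<Rightarrow> real) \<Rightarrow> real \<times> real \<Rightarrow> real" where
  "steklov2 h k f = (\<lambda>(x, y). steklov h (steklov_y k f y) x)"

text \<open>Fubini: the order of averaging is immaterial. Facts about the first variable carry over to the second in this way.\<close>
lemma steklov2_swap:
  assumes f: "f \<in> Lper2" and h: "0 < h" "h \<le> 1" and k: "0 < k" "k \<le> 1"
  shows "steklov2 h k (\<lambda>z. f (snd z, fst z)) (x, y) = steklov2 k h f (y, x)"
proof -
  note [measurable] = Lper2_measurable[OF f]
  have m: "(\<lambda>z. f (y + k * snd z, x + h * fst z)) \<in> borel_measurable (borel \<Otimes>\<^sub>M borel)" by measurable
  have "(\<integral>\<^sup>+s. (\<integral>\<^sup>+t. ennreal \<bar>f (y + k * t, x + h * s)\<bar> \<partial>unit_leb) \<partial>unit_leb)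
      \<le> (\<integral>\<^sup>+s. ennreal (1 / k) * (\<integral>\<^sup>+t. ennreal \<bar>f (t, x + h * s)\<bar> \<partial>unit_leb) \<partial>unit_leb)"
    by (intro nn_integral_mono nn_integral_affine_le[of "\<lambda>t. ennreal \<bar>f (t, _)\<bar>"] k) (auto simp: Lper2_periodic[OF f])
  also have "\<dots> = ennreal (1 / k) * (\<integral>\<^sup>+s. (\<integral>\<^sup>+t. ennreal \<bar>f (t, x + h * s)\<bar> \<partial>unit_leb) \<partial>unit_leb)"
    by (rule nn_integral_cmult) measurable
  also have "\<dots> \<le> ennreal (1 / k) * (ennreal (1 / h) * (\<integral>\<^sup>+s. (\<integral>\<^sup>+t. ennreal \<bar>f (t, s)\<bar> \<partial>unit_leb) \<partial>unit_leb))"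
    by (intro mult_left_mono nn_integral_affine_le[of "\<lambda>s. \<integral>\<^sup>+t. ennreal \<bar>f (t, s)\<bar> \<partial>unit_leb"] h) (auto simp: Lper2_periodic[OF f])
  also have "\<dots> < \<infinity>"
    using Lper2_swap[OF f] by (auto simp: Lper2_def ennreal_mult_less_top)
  finally have "(\<integral>s. (\<integral>t. f (y + k * t, x + h * s) \<partial>unit_leb) \<partial>unit_leb) = (\<integral>t. (\<integral>s. f (y + k * t, x + h * s) \<partial>unit_leb) \<partial>unit_leb)"
    by (intro unit_Fubini m)
  then show ?thesis by (simp add: steklov2_def steklov_y_def steklov_def)
qed

text \<open>The expansion of \<open>(S\<^sub>s - S\<^sub>1)(T\<^sub>s - T\<^sub>1) f\<close>, which is what the double series telescopes to (\<open>block_sum\<close>).\<close>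
definition fine_part :: "real \<Rightarrow> (real \<times> real \<Rightarrow> real) \<Rightarrow> real \<times> real \<Rightarrow> real" where
  "fine_part s f = (\<lambda>z. steklov2 s s f z - steklov2 s 1 f z - steklov2 1 s f z + steklov2 1 1 f z)"

lemma fine_part_swap:
  assumes "f \<in> Lper2" "0 < s" "s \<le> 1"
  shows "fine_part s (\<lambda>z. f (snd z, fst z)) (x, y) = fine_part s f (y, x)"
  using assms by (simp add: fine_part_def steklov2_swap)

lemma fine_part_eq:
  assumes f: "f \<in> Lper2" and s: "0 < s" "s \<le> 1"
  defines "V \<equiv> \<lambda>y x'. steklov_y s f y x' - steklov_y 1 f y x'"
  shows "fine_part s f (x, y) = steklov s (V y) x - steklov 1 (V y) x" and "V y \<in> Lper1"
proof -
  have 1: "steklov_y s f y \<in> Lper1" "steklov_y 1 f y \<in> Lper1" using f s by (auto intro: steklov_y_Lper1)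
  then show "V y \<in> Lper1" unfolding V_def by (rule Lper1_diff)
  show "fine_part s f (x, y) = steklov s (V y) x - steklov 1 (V y) x"
    using 1 s by (simp add: fine_part_def steklov2_def V_def steklov_minus)
qed

text \<open>A Steklov mean has the same mean over a period as the function itself, whatever the step.\<close>
lemma fine_part_mean:
  assumes f: "f \<in> Lper2" and s: "0 < s" "s \<le> 1"
  shows "integrable unit_leb (\<lambda>x. fine_part s f (x, y))" "(\<integral>x. fine_part s f (x, y) \<partial>unit_leb) = 0"
  using steklov_mean[OF fine_part_eq(2)[OF assms, of y], of s] steklov_mean[OF fine_part_eq(2)[OF assms, of y], of 1]
  by (simp_all add: fine_part_eq(1)[OF assms])

lemma fine_part_mean':
  assumes f: "f \<in> Lper2" and s: "0 < s" "s \<le> 1"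
  shows "integrable unit_leb (\<lambda>y. fine_part s f (x, y))" "(\<integral>y. fine_part s f (x, y) \<partial>unit_leb) = 0"
  using fine_part_mean[OF Lper2_swap[OF f] s, of x] by (simp_all add: fine_part_swap[OF assms])

lemma fine_part_periodic:
  assumes f: "f \<in> Lper2" and s: "0 < s" "s \<le> 1" shows "periodic2 (fine_part s f)"
proof -
  have v: "steklov_y k f y (x + 1) = steklov_y k f y x" "steklov_y k f (y + 1) x = steklov_y k f y x" for k x y
  proof -
    have "f (x, y + 1 + t) = f (x, y + t)" for t
      using Lper2_periodic(2)[OF f, of x "y + t"] by (simp add: add_ac)
    then show "steklov_y k f y (x + 1) = steklov_y k f y x" "steklov_y k f (y + 1) x = steklov_y k f y x"
      using Lper2_periodic(1)[OF f] by (simp_all add: steklov_y_def steklov_def)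
  qed
  have "steklov2 h k f (x + 1, y) = steklov2 h k f (x, y)" "steklov2 h k f (x, y + 1) = steklov2 h k f (x, y)" for h k x y
  proof -
    have "steklov_y k f y (x + 1 + t) = steklov_y k f y (x + t)" for t
      using v(1)[of k y "x + t"] by (simp add: add_ac)
    then show "steklov2 h k f (x + 1, y) = steklov2 h k f (x, y)" "steklov2 h k f (x, y + 1) = steklov2 h k f (x, y)"
      using v(2) by (simp_all add: steklov2_def steklov_def)
  qed
  then show ?thesis by (simp add: periodic2_def fine_part_def)
qed

text \<open>Dominated convergence with a moving interval of integration. It is used once in each variable: first for a fixed function
and moving end points, then for the resulting averages in \<open>y\<close>.\<close>
lemma steklov_tendsto:
  assumes W: "\<And>n. W n \<in> Lper1" "V \<in> Lper1" and D: "D \<in> Lper1" and h: "h > 0"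
    and lim: "AE x in lborel. (\<lambda>n. W n x) \<longlonglongrightarrow> V x"
    and dom: "\<And>n. AE x in lborel. \<bar>W n x\<bar> \<le> D x"
    and xs: "xs \<longlonglongrightarrow> x"
  shows "(\<lambda>n. steklov h (W n) (xs n)) \<longlonglongrightarrow> steklov h V x"
proof -
  note [measurable] = Lper1_measurable[OF W(1)] Lper1_measurable[OF W(2)] Lper1_measurable[OF D]
  \<comment> \<open>A convergent sequence is bounded, so all intervals of integration lie in a fixed one.\<close>
  obtain B where B: "\<And>n. \<bar>xs n\<bar> \<le> B"
    using Bseq_def convergent_imp_Bseq[OF convergentI[OF xs]] by (metis real_norm_def)
  have "(\<lambda>n. \<integral>z. indicator {xs n..xs n + h} z *\<^sub>R W n z \<partial>lborel) \<longlonglongrightarrow> (\<integral>z. indicator {x..x + h} z *\<^sub>R V z \<partial>lborel)"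
  proof (rule integral_dominated_convergence[where w = "\<lambda>z. indicator {- B..B + h} z *\<^sub>R D z"])
    show "integrable lborel (\<lambda>z. indicator {- B..B + h} z *\<^sub>R D z)"
      using Lper1_set_integrable[OF D] by (simp add: set_integrable_def)
    show "AE z in lborel. norm (indicator {xs n..xs n + h} z *\<^sub>R W n z) \<le> indicator {- B..B + h} z *\<^sub>R D z" for n
      using dom[of n]
    proof eventually_elim
      case (elim z)
      then have "0 \<le> D z" by linarith
      then show ?case using elim B[of n] by (auto simp: indicator_def)
    qed
    show "AE z in lborel. (\<lambda>n. indicator {xs n..xs n + h} z *\<^sub>R W n z) \<longlonglongrightarrow> indicator {x..x + h} z *\<^sub>R V z"
      using lim AE_lborel_singleton[of x] AE_lborel_singleton[of "x + h"]
    proof eventually_elim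
      case (elim z)
      have xh: "(\<lambda>n. xs n + h) \<longlonglongrightarrow> x + h" using xs by (intro tendsto_intros)
      have "\<forall>\<^sub>F n in sequentially. (indicator {xs n..xs n + h} z :: real) = indicator {x..x + h} z"
      proof -
        consider "z < x" | "x < z" "z < x + h" | "x + h < z" using elim by linarith
        then show ?thesis
        proof cases
          case 1
          then show ?thesis using order_tendstoD(1)[OF xs, of z] by (auto elim!: eventually_mono simp: indicator_def)
        next
          case 2
          then show ?thesis using eventually_conj[OF order_tendstoD(2)[OF xs, of z] order_tendstoD(1)[OF xh, of z]]
            by (auto elim!: eventually_mono simp: indicator_def)
        next
          case 3
          then show ?thesis using order_tendstoD(2)[OF xh, of z] h by (auto elim!: eventually_mono simp: indicator_def)
        qed
      qed
      then have "(\<lambda>n. indicator {xs n..xs n + h} z :: real) \<longlonglongrightarrow> indicator {x..x + h} z"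
        by (rule tendsto_eventually)
      then show ?case using elim(1) by (intro tendsto_scaleR)
    qed
  qed auto
  then have "(\<lambda>n. (LINT z:{xs n..xs n + h}|lborel. W n z) / h) \<longlonglongrightarrow> (LINT z:{x..x + h}|lborel. V z) / h"
    unfolding set_lebesgue_integral_def using h by (intro tendsto_divide) auto
  then show ?thesis
    unfolding steklov_def Lper1_affine_integrable(2)[OF W(1) h] Lper1_affine_integrable(2)[OF W(2) h] .
qed

lemma Lper2_abs: "f \<in> Lper2 \<Longrightarrow> (\<lambda>z. \<bar>f z\<bar>) \<in> Lper2"
  by (auto simp: Lper2_def periodic2_def)

text \<open>One dominating function serves for all \<open>y\<close>.\<close>
lemma steklov_y_abs_le:
  assumes f: "f \<in> Lper2" and k: "0 < k" "k \<le> 1"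
  shows "AE x in lborel. \<forall>y. \<bar>steklov_y k f y x\<bar> \<le> (1 / k) * steklov_y 1 (\<lambda>z. \<bar>f z\<bar>) 0 x"
  using Lper2_AE_section[OF f]
proof eventually_elim
  case (elim x)
  have int: "integrable unit_leb (\<lambda>t. \<bar>f (x, t)\<bar>)" using Lper1_integrable[OF elim] by simp
  show ?case
  proof
    fix y
    have "ennreal \<bar>steklov_y k f y x\<bar> \<le> ennreal (1 / k) * (\<integral>\<^sup>+t. ennreal \<bar>f (x, t)\<bar> \<partial>unit_leb)"
      by (rule steklov_y_bound[OF f k])
    also have "\<dots> = ennreal ((1 / k) * steklov_y 1 (\<lambda>z. \<bar>f z\<bar>) 0 x)"
      using k by (simp add: nn_integral_eq_integral[OF int] steklov_y_def steklov_def ennreal_mult[symmetric])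
    finally show "\<bar>steklov_y k f y x\<bar> \<le> (1 / k) * steklov_y 1 (\<lambda>z. \<bar>f z\<bar>) 0 x"
      using k by (subst (asm) ennreal_le_iff) (auto simp: steklov_y_def steklov_def)
  qed
qed

lemma steklov2_continuous:
  assumes f: "f \<in> Lper2" and h: "0 < h" and k: "0 < k" "k \<le> 1"
  shows "continuous_on UNIV (steklov2 h k f)"
proof -
  have "(\<lambda>n. steklov2 h k f (zs n)) \<longlonglongrightarrow> steklov2 h k f z" if zs: "zs \<longlonglongrightarrow> z" for zs z
  proof -
    have xs: "(\<lambda>n. fst (zs n)) \<longlonglongrightarrow> fst z" and ys: "(\<lambda>n. snd (zs n)) \<longlonglongrightarrow> snd z"
      using zs by (auto intro: tendsto_fst tendsto_snd)
    define D where "D x = (1 / k) * steklov_y 1 (\<lambda>z. \<bar>f z\<bar>) 0 x" for x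
    have D: "D \<in> Lper1"
      using steklov_y_Lper1[OF Lper2_abs[OF f], of 1 0] unfolding D_def[abs_def] by (auto simp: Lper1_def periodic1_def)
    have "(\<lambda>n. steklov h (steklov_y k f (snd (zs n))) (fst (zs n))) \<longlonglongrightarrow> steklov h (steklov_y k f (snd z)) (fst z)"
    proof (rule steklov_tendsto[OF _ _ D h _ _ xs])
      show "AE x in lborel. (\<lambda>n. steklov_y k f (snd (zs n)) x) \<longlonglongrightarrow> steklov_y k f (snd z) x"
        using Lper2_AE_section[OF f]
      proof eventually_elim
        case (elim x)
        have "(\<lambda>t. \<bar>f (x, t)\<bar>) \<in> Lper1" using elim by (auto simp: Lper1_def periodic1_def)
        then show ?case unfolding steklov_y_def
          by (intro steklov_tendsto[where W = "\<lambda>n t. f (x, t)", OF elim elim _ k(1) _ _ ys]) auto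
      qed
      show "AE x in lborel. \<bar>steklov_y k f (snd (zs n)) x\<bar> \<le> D x" for n
        using steklov_y_abs_le[OF f k] unfolding D_def by eventually_elim blast
    qed (use f k in \<open>auto intro: steklov_y_Lper1\<close>)
    then show ?thesis by (simp add: steklov2_def case_prod_beta')
  qed
  then show ?thesis by (auto simp: continuous_on_sequentially o_def)
qed

lemma fine_part_continuous:
  assumes "f \<in> Lper2" "0 < s" "s \<le> 1" shows "continuous_on UNIV (fine_part s f)"
  unfolding fine_part_def using assms by (intro continuous_intros steklov2_continuous) auto

lemma (in Lp_periodic) block_sum:
  assumes L: "2 \<le> L"
  shows "(\<Sum>n<N. \<Sum>m<N. block L n m z) = fine_part (mesh L N) f z"
proof (cases z)
  case (Pair x y)
  have pos: "0 < mesh L n" "mesh L n \<le> 1" for n using mesh_pos[OF L] mesh_le_1[OF L] by auto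
  have sd: "steklov_diff (mesh L (Suc n)) L G t = steklov (mesh L (Suc n)) G t - steklov (mesh L n) G t" for n G t
    by (simp add: steklov_diff_def mesh_Suc[OF L])
  have tel: "(\<Sum>n<N. steklov_diff (mesh L (Suc n)) L G t) = steklov (mesh L N) G t - steklov 1 G t" for G t
    unfolding sd using sum_lessThan_telescope[of "\<lambda>n. steklov (mesh L n) G t" N] by (simp add: mesh_0[OF L])
  let ?V = "\<lambda>m. steklov_diff_y (mesh L (Suc m)) L f y"
  have V: "?V m \<in> Lper1" for m
    using L pos mesh_Suc[OF L] by (intro steklov_diff_y_Lper1[OF Lper2]) auto
  have Vsum: "(\<lambda>x'. \<Sum>m<N. ?V m x') = (\<lambda>x'. steklov_y (mesh L N) f y x' - steklov_y 1 f y x')"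
    unfolding steklov_diff_y_def steklov_y_def tel ..
  have "(\<Sum>n<N. \<Sum>m<N. block L n m z) = (\<Sum>n<N. steklov_diff (mesh L (Suc n)) L (\<lambda>x'. \<Sum>m<N. ?V m x') x)"
    using V pos by (simp add: block_def steklov_diff2_def Pair sd steklov_sum sum_subtractf)
  also have "\<dots> = steklov (mesh L N) (\<lambda>x'. \<Sum>m<N. ?V m x') x - steklov 1 (\<lambda>x'. \<Sum>m<N. ?V m x') x" by (rule tel)
  also have "\<dots> = fine_part (mesh L N) f z"
    unfolding Vsum Pair by (rule fine_part_eq(1)[OF Lper2 pos, symmetric])
  finally show ?thesis .
qed

section \<open>Convergence in the mean\<close>

lemma nn_integral_unit_swap4:
  fixes H :: "(real \<times> real) \<times> (real \<times> real) \<Rightarrow> ennreal"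
  assumes H: "H \<in> borel_measurable ((borel \<Otimes>\<^sub>M borel) \<Otimes>\<^sub>M (borel \<Otimes>\<^sub>M borel))"
  shows "(\<integral>\<^sup>+x. \<integral>\<^sup>+y. \<integral>\<^sup>+s. \<integral>\<^sup>+t. H ((x, y), (s, t)) \<partial>unit_leb \<partial>unit_leb \<partial>unit_leb \<partial>unit_leb)
    = (\<integral>\<^sup>+s. \<integral>\<^sup>+t. \<integral>\<^sup>+x. \<integral>\<^sup>+y. H ((x, y), (s, t)) \<partial>unit_leb \<partial>unit_leb \<partial>unit_leb \<partial>unit_leb)"
proof -
  let ?U = "unit_leb \<Otimes>\<^sub>M unit_leb"
  have s: "sets ?U = sets (borel \<Otimes>\<^sub>M (borel :: real measure))"
    by (intro sets_pair_measure_cong) auto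
  have s4: "sets (?U \<Otimes>\<^sub>M ?U) = sets ((borel \<Otimes>\<^sub>M borel) \<Otimes>\<^sub>M (borel \<Otimes>\<^sub>M (borel :: real measure)))"
    by (intro sets_pair_measure_cong s)
  have [measurable]: "H \<in> borel_measurable (?U \<Otimes>\<^sub>M ?U)" using H by (simp add: measurable_cong_sets[OF s4 refl])
  interpret U: sigma_finite_measure ?U by (rule sigma_finite_pair_measure) (rule unit_leb.sigma_finite_measure_axioms)+
  interpret UU: pair_sigma_finite ?U ?U ..
  have iter: "(\<integral>\<^sup>+x. \<integral>\<^sup>+y. G (x, y) \<partial>unit_leb \<partial>unit_leb) = (\<integral>\<^sup>+z. G z \<partial>?U)"
    if "G \<in> borel_measurable ?U" for G
    by (rule unit_leb.nn_integral_fst[OF that])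
  have "(\<integral>\<^sup>+x. \<integral>\<^sup>+y. \<integral>\<^sup>+s. \<integral>\<^sup>+t. H ((x, y), (s, t)) \<partial>unit_leb \<partial>unit_leb \<partial>unit_leb \<partial>unit_leb)
    = (\<integral>\<^sup>+x. \<integral>\<^sup>+y. (\<integral>\<^sup>+w. H ((x, y), w) \<partial>?U) \<partial>unit_leb \<partial>unit_leb)"
    by (intro nn_integral_cong iter) measurable
  also have "\<dots> = (\<integral>\<^sup>+z. (\<integral>\<^sup>+w. H (z, w) \<partial>?U) \<partial>?U)"
    by (rule iter[of "\<lambda>z. \<integral>\<^sup>+w. H (z, w) \<partial>?U"]) measurable
  also have "\<dots> = (\<integral>\<^sup>+w. (\<integral>\<^sup>+z. H (z, w) \<partial>?U) \<partial>?U)"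
    by (rule UU.Fubini'[symmetric]) measurable
  also have "\<dots> = (\<integral>\<^sup>+s. \<integral>\<^sup>+t. (\<integral>\<^sup>+z. H (z, (s, t)) \<partial>?U) \<partial>unit_leb \<partial>unit_leb)"
    by (rule iter[of "\<lambda>w. \<integral>\<^sup>+z. H (z, w) \<partial>?U", symmetric]) measurable
  also have "\<dots> = (\<integral>\<^sup>+s. \<integral>\<^sup>+t. \<integral>\<^sup>+x. \<integral>\<^sup>+y. H ((x, y), (s, t)) \<partial>unit_leb \<partial>unit_leb \<partial>unit_leb \<partial>unit_leb)"
    by (intro nn_integral_cong iter[symmetric]) measurable
  finally show ?thesis .
qed

text \<open>This is \<open>(S\<^sub>h - 1)(T\<^sub>k - 1) f\<close>, the average of the mixed differences of steps up to \<open>h\<close> and \<open>k\<close>.\<close>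
definition steklov_error2 :: "real \<Rightarrow> real \<Rightarrow> (real \<times> real \<Rightarrow> real) \<Rightarrow> real \<times> real \<Rightarrow> real" where
  "steklov_error2 h k f = (\<lambda>(x, y). steklov2 h k f (x, y) - steklov h (\<lambda>x'. f (x', y)) x - steklov k (\<lambda>t. f (x, t)) y + f (x, y))"

lemma steklov_error2_le:
  assumes f: "f \<in> Lper2" and h: "0 < h" and k: "0 < k" "k \<le> 1"
    and x: "(\<lambda>t. f (x, t)) \<in> Lper1" and y: "(\<lambda>x'. f (x', y)) \<in> Lper1"
  shows "ennreal \<bar>steklov_error2 h k f (x, y)\<bar> \<le> (\<integral>\<^sup>+s. \<integral>\<^sup>+t. ennreal \<bar>mixed_diff (h * s) (k * t) f (x, y)\<bar> \<partial>unit_leb \<partial>unit_leb)"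
proof -
  define g where "g s = steklov_y k f y (x + h * s) - f (x + h * s, y) - steklov_y k f y x + f (x, y)" for s
  have int: "integrable unit_leb (\<lambda>s. steklov_y k f y (x + h * s))" "integrable unit_leb (\<lambda>s. f (x + h * s, y))"
    using Lper1_affine_integrable(1)[OF steklov_y_Lper1[OF f k] h] Lper1_affine_integrable(1)[OF y h] by auto
  have g: "integrable unit_leb g" unfolding g_def using int by auto
  have "steklov_error2 h k f (x, y) = (\<integral>s. g s \<partial>unit_leb)"
    unfolding g_def using int by (simp add: steklov_error2_def steklov2_def steklov_def[of h] steklov_y_def[symmetric])
  then have "ennreal \<bar>steklov_error2 h k f (x, y)\<bar> \<le> (\<integral>\<^sup>+s. ennreal \<bar>g s\<bar> \<partial>unit_leb)"
    using integral_norm_bound_ennreal[OF g] by simp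
  also have "\<dots> \<le> (\<integral>\<^sup>+s. \<integral>\<^sup>+t. ennreal \<bar>mixed_diff (h * s) (k * t) f (x, y)\<bar> \<partial>unit_leb \<partial>unit_leb)"
  proof (intro nn_integral_mono_AE AE_unit_measureI)
    have "AE s in lborel. (\<lambda>t. f (x + h * s, t)) \<in> Lper1"
      using AE_lborel_affine[OF Lper2_AE_section[OF f], of h x] h by simp
    then show "AE s in lborel. ennreal \<bar>g s\<bar> \<le> (\<integral>\<^sup>+t. ennreal \<bar>mixed_diff (h * s) (k * t) f (x, y)\<bar> \<partial>unit_leb)"
    proof eventually_elim
      case (elim s)
      have int: "integrable unit_leb (\<lambda>t. f (x + h * s, y + k * t))" "integrable unit_leb (\<lambda>t. f (x, y + k * t))"
        using Lper1_affine_integrable(1)[OF elim k(1)] Lper1_affine_integrable(1)[OF x k(1)] by auto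
      have "integrable unit_leb (\<lambda>t. mixed_diff (h * s) (k * t) f (x, y))"
        unfolding mixed_diff_def using int by simp
      moreover have "(\<integral>t. mixed_diff (h * s) (k * t) f (x, y) \<partial>unit_leb) = g s"
        unfolding mixed_diff_def g_def steklov_y_def steklov_def using int by simp
      ultimately show ?case
        using integral_norm_bound_ennreal[of unit_leb "\<lambda>t. mixed_diff (h * s) (k * t) f (x, y)"] by simp
    qed
  qed
  finally show ?thesis .
qed

lemma AE_AE_sections:
  assumes f: "f \<in> Lper2" and P: "\<And>x y. (\<lambda>t. f (x, t)) \<in> Lper1 \<Longrightarrow> (\<lambda>x'. f (x', y)) \<in> Lper1 \<Longrightarrow> P x y"
  shows "AE x in unit_leb. AE y in unit_leb. P x y"
proof (rule eventually_mono[OF AE_unit_measureI[OF Lper2_AE_section[OF f]]])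
  fix x assume x: "(\<lambda>t. f (x, t)) \<in> Lper1"
  show "AE y in unit_leb. P x y"
    by (rule eventually_mono[OF AE_unit_measureI[OF Lper2_AE_section'[OF f]]]) (rule P[OF x])
qed

lemma nn_integral_unit_mono_sections:
  assumes f: "f \<in> Lper2" and P: "\<And>x y. (\<lambda>t. f (x, t)) \<in> Lper1 \<Longrightarrow> (\<lambda>x'. f (x', y)) \<in> Lper1 \<Longrightarrow> F x y \<le> G x y"
  shows "(\<integral>\<^sup>+x. \<integral>\<^sup>+y. F x y \<partial>unit_leb \<partial>unit_leb) \<le> (\<integral>\<^sup>+x. \<integral>\<^sup>+y. G x y \<partial>unit_leb \<partial>unit_leb)"
proof (rule nn_integral_mono_AE)
  have "AE x in unit_leb. AE y in unit_leb. F x y \<le> G x y"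
    by (rule AE_AE_sections[OF f P])
  then show "AE x in unit_leb. (\<integral>\<^sup>+y. F x y \<partial>unit_leb) \<le> (\<integral>\<^sup>+y. G x y \<partial>unit_leb)"
    by eventually_elim (rule nn_integral_mono_AE)
qed

lemma steklov_error2_L1:
  assumes f: "f \<in> Lper2" and h: "0 < h" and k: "0 < k" "k \<le> 1"
    and c: "\<And>s t. 0 \<le> s \<Longrightarrow> s \<le> h \<Longrightarrow> 0 \<le> t \<Longrightarrow> t \<le> k \<Longrightarrow>
      (\<integral>\<^sup>+x. \<integral>\<^sup>+y. ennreal \<bar>mixed_diff s t f (x, y)\<bar> \<partial>unit_leb \<partial>unit_leb) \<le> c"
  shows "(\<integral>\<^sup>+x. \<integral>\<^sup>+y. ennreal \<bar>steklov_error2 h k f (x, y)\<bar> \<partial>unit_leb \<partial>unit_leb) \<le> c"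
proof -
  note [measurable] = Lper2_measurable[OF f]
  define H where "H = (\<lambda>z. ennreal \<bar>mixed_diff (h * fst (snd z)) (k * snd (snd z)) f (fst (fst z), snd (fst z))\<bar>)"
  have H: "H \<in> borel_measurable ((borel \<Otimes>\<^sub>M borel) \<Otimes>\<^sub>M (borel \<Otimes>\<^sub>M borel))"
    unfolding H_def mixed_diff_def prod.case by measurable
  have "(\<integral>\<^sup>+x. \<integral>\<^sup>+y. ennreal \<bar>steklov_error2 h k f (x, y)\<bar> \<partial>unit_leb \<partial>unit_leb)
    \<le> (\<integral>\<^sup>+x. \<integral>\<^sup>+y. \<integral>\<^sup>+s. \<integral>\<^sup>+t. H ((x, y), (s, t)) \<partial>unit_leb \<partial>unit_leb \<partial>unit_leb \<partial>unit_leb)"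
    unfolding H_def fst_conv snd_conv by (intro nn_integral_unit_mono_sections[OF f] steklov_error2_le f h k)
  also have "\<dots> = (\<integral>\<^sup>+s. \<integral>\<^sup>+t. \<integral>\<^sup>+x. \<integral>\<^sup>+y. H ((x, y), (s, t)) \<partial>unit_leb \<partial>unit_leb \<partial>unit_leb \<partial>unit_leb)"
    by (rule nn_integral_unit_swap4[OF H])
  also have "\<dots> \<le> (\<integral>\<^sup>+s. \<integral>\<^sup>+t. c \<partial>unit_leb \<partial>unit_leb)"
  proof (intro nn_integral_mono_AE)
    have in01: "AE s in unit_leb. s \<in> {0..1}" by (subst AE_unit_leb) auto
    show "AE s in unit_leb. (\<integral>\<^sup>+t. \<integral>\<^sup>+x. \<integral>\<^sup>+y. H ((x, y), (s, t)) \<partial>unit_leb \<partial>unit_leb \<partial>unit_leb) \<le> (\<integral>\<^sup>+t. c \<partial>unit_leb)"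
      using in01
    proof eventually_elim
      case (elim s)
      show ?case
      proof (intro nn_integral_mono_AE eventually_mono[OF in01])
        fix t :: real assume t: "t \<in> {0..1}"
        have "h * s \<le> h * 1" "k * t \<le> k * 1" using elim t h k by (auto intro!: mult_left_mono)
        then show "(\<integral>\<^sup>+x. \<integral>\<^sup>+y. H ((x, y), (s, t)) \<partial>unit_leb \<partial>unit_leb) \<le> c"
          unfolding H_def fst_conv snd_conv using elim t h k by (intro c) auto
      qed
    qed
  qed
  also have "\<dots> = c" by simp
  finally show ?thesis .
qed

lemma L1_le_Lp:
  assumes p: "1 < p" and g: "g \<in> borel_measurable borel" and c: "0 \<le> c" "powint2 p g \<le> ennreal (c powr p)"
  shows "(\<integral>\<^sup>+x. \<integral>\<^sup>+y. ennreal \<bar>g (x, y)\<bar> \<partial>unit_leb \<partial>unit_leb) \<le> ennreal c"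
proof (rule ennreal_le_epsilon)
  have [measurable]: "g \<in> borel_measurable (borel \<Otimes>\<^sub>M borel)" using g by (simp add: borel_prod)
  fix e :: real assume e: "0 < e"
  \<comment> \<open>The tangent needs a positive point, and \<open>c\<close> may vanish.\<close>
  define d where "d = c + e"
  have d: "d > 0" "powint2 p g \<le> ennreal (d powr p)"
    using c e p by (auto simp: d_def intro!: order_trans[OF c(2)] ennreal_leI powr_mono2)
  \<comment> \<open>Young's inequality, from the tangent of \<open>t\<^sup>p\<close> at \<open>d\<close>.\<close>
  have young: "\<bar>a\<bar> \<le> 1 / (p * d powr (p - 1)) * \<bar>a\<bar> powr p + (1 - 1 / p) * d" for a
  proof -
    have "d powr p + p * d powr (p - 1) * (\<bar>a\<bar> - d) \<le> \<bar>a\<bar> powr p" using d p by (intro powr_tangent) auto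
    moreover have "d powr p = d powr (p - 1) * d" using d by (simp add: powr_diff)
    ultimately have "p * d powr (p - 1) * \<bar>a\<bar> \<le> \<bar>a\<bar> powr p + (p - 1) * (d powr (p - 1) * d)" by (simp add: algebra_simps)
    then have "p * d powr (p - 1) * \<bar>a\<bar> / (p * d powr (p - 1)) \<le> (\<bar>a\<bar> powr p + (p - 1) * (d powr (p - 1) * d)) / (p * d powr (p - 1))"
      using d p by (intro divide_right_mono) auto
    also have "\<dots> = 1 / (p * d powr (p - 1)) * \<bar>a\<bar> powr p + (1 - 1 / p) * d"
      using d p by (simp add: field_simps)
    finally show ?thesis using d p by simp
  qed
  define A where "A = 1 / (p * d powr (p - 1))"
  define B where "B = (1 - 1 / p) * d"
  have AB: "0 \<le> A" "0 \<le> B" using d p by (auto simp: A_def B_def)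
  have "(\<integral>\<^sup>+x. \<integral>\<^sup>+y. ennreal \<bar>g (x, y)\<bar> \<partial>unit_leb \<partial>unit_leb)
    \<le> (\<integral>\<^sup>+x. \<integral>\<^sup>+y. ennreal A * ennreal (\<bar>g (x, y)\<bar> powr p) + ennreal B \<partial>unit_leb \<partial>unit_leb)"
  proof (intro nn_integral_mono)
    fix x y
    have "ennreal \<bar>g (x, y)\<bar> \<le> ennreal (A * \<bar>g (x, y)\<bar> powr p + B)"
      unfolding A_def B_def by (intro ennreal_leI young)
    then show "ennreal \<bar>g (x, y)\<bar> \<le> ennreal A * ennreal (\<bar>g (x, y)\<bar> powr p) + ennreal B"
      using AB by (simp add: ennreal_mult)
  qed
  also have "\<dots> = ennreal A * powint2 p g + ennreal B"
    unfolding powint2_def by (simp add: nn_integral_add nn_integral_cmult)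
  also have "\<dots> \<le> ennreal A * ennreal (d powr p) + ennreal B"
    by (intro add_mono mult_left_mono d) auto
  also have "\<dots> = ennreal (A * d powr p + B)" using AB by (simp add: ennreal_mult)
  also have "A * d powr p + B = d" using d p by (simp add: A_def B_def powr_diff field_simps)
  finally show "(\<integral>\<^sup>+x. \<integral>\<^sup>+y. ennreal \<bar>g (x, y)\<bar> \<partial>unit_leb \<partial>unit_leb) \<le> ennreal c + ennreal e"
    using c e by (simp add: d_def)
qed

text \<open>This is \<open>(1 - S\<^sub>1)(1 - T\<^sub>1) f\<close>.\<close>
definition centered :: "(real \<times> real \<Rightarrow> real) \<Rightarrow> real \<times> real \<Rightarrow> real" where
  "centered f = (\<lambda>(x, y). f (x, y) - (\<integral>t. f (x, t) \<partial>unit_leb) - (\<integral>s. f (s, y) \<partial>unit_leb)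
     + (\<integral>s. \<integral>t. f (s, t) \<partial>unit_leb \<partial>unit_leb))"

lemma steklov2_one:
  assumes f: "f \<in> Lper2"
  shows "steklov2 1 1 f (x, y) = (\<integral>s. \<integral>t. f (s, t) \<partial>unit_leb \<partial>unit_leb)"
proof -
  note [measurable] = Lper2_measurable[OF f]
  have V: "steklov_y 1 f y \<in> Lper1" by (rule steklov_y_Lper1[OF f]) auto
  note [measurable] = Lper1_measurable[OF V]
  have "steklov2 1 1 f (x, y) = (\<integral>s. steklov_y 1 f y s \<partial>unit_leb)"
    unfolding steklov2_def prod.case by (rule steklov_1[OF V])
  also have "\<dots> = (\<integral>s. \<integral>t. f (s, t) \<partial>unit_leb \<partial>unit_leb)"
  proof (rule integral_cong_AE)
    show "AE s in unit_leb. steklov_y 1 f y s = (\<integral>t. f (s, t) \<partial>unit_leb)"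
      using AE_unit_measureI[OF Lper2_AE_section[OF f]] by eventually_elim (simp add: steklov_y_def steklov_1)
  qed measurable
  finally show ?thesis .
qed

text \<open>From \<open>S\<^sub>s - S\<^sub>1 = (S\<^sub>s - 1) - (S\<^sub>1 - 1)\<close> and its analogue for \<open>T\<close>: of the four products, the one with
both steps equal to 1 is \<open>centered f\<close>.\<close>
lemma fine_part_minus_centered:
  assumes f: "f \<in> Lper2" and x: "(\<lambda>t. f (x, t)) \<in> Lper1" and y: "(\<lambda>x'. f (x', y)) \<in> Lper1"
  shows "fine_part s f (x, y) - centered f (x, y) = steklov_error2 s s f (x, y) - steklov_error2 s 1 f (x, y) - steklov_error2 1 s f (x, y)"
  using steklov_1[OF x, of y] steklov_1[OF y, of x] steklov2_one[OF f, of x y]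
  by (simp add: fine_part_def centered_def steklov_error2_def)

lemma centered_measurable:
  assumes f: "f \<in> Lper2" shows "centered f \<in> borel_measurable borel"
proof -
  note [measurable] = Lper2_measurable[OF f]
  have "centered f \<in> borel_measurable (borel \<Otimes>\<^sub>M borel)"
    unfolding centered_def case_prod_beta' by measurable
  then show ?thesis by (simp add: borel_prod)
qed

lemma centered_periodic: "periodic2 f \<Longrightarrow> periodic2 (centered f)"
  by (simp add: periodic2_def centered_def)

lemma AE_lborel_of_unit:
  assumes g: "g \<in> borel_measurable borel" "periodic2 g"
    and 0: "(\<integral>\<^sup>+x. \<integral>\<^sup>+y. ennreal \<bar>g (x, y)\<bar> \<partial>unit_leb \<partial>unit_leb) = 0"
  shows "AE z in lborel. g z = 0"
proof -
  have [measurable]: "g \<in> borel_measurable (borel \<Otimes>\<^sub>M borel)" using g by (simp add: borel_prod)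
  have per: "g (x + 1, y) = g (x, y)" "g (x, y + 1) = g (x, y)" for x y using g by (auto simp: periodic2_def)
  have "AE x in unit_leb. (\<integral>\<^sup>+y. ennreal \<bar>g (x, y)\<bar> \<partial>unit_leb) = 0"
    using 0 by (subst (asm) nn_integral_0_iff_AE) auto
  then have "AE x in lborel. (\<integral>\<^sup>+y. ennreal \<bar>g (x, y)\<bar> \<partial>unit_leb) = 0"
    by (rule AE_unit_periodic[rotated 2]) (auto simp: per)
  then have "AE x in lborel. (\<integral>\<^sup>+y. ennreal \<bar>g (x, y)\<bar> \<partial>lborel) = 0"
  proof eventually_elim
    case (elim x)
    then have "AE y in unit_leb. g (x, y) = 0" by (subst (asm) nn_integral_0_iff_AE) auto
    then have "AE y in lborel. g (x, y) = 0" by (rule AE_unit_periodic[rotated 2]) (auto simp: per)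
    then show ?case by (subst nn_integral_0_iff_AE) auto
  qed
  then have "(\<integral>\<^sup>+x. \<integral>\<^sup>+y. ennreal \<bar>g (x, y)\<bar> \<partial>lborel \<partial>lborel) = 0"
    by (subst nn_integral_0_iff_AE) auto
  then have "(\<integral>\<^sup>+z. ennreal \<bar>g z\<bar> \<partial>(lborel \<Otimes>\<^sub>M lborel)) = 0"
    by (subst lborel.nn_integral_fst[symmetric]) auto
  then have "(\<integral>\<^sup>+z. ennreal \<bar>g z\<bar> \<partial>lborel) = 0" by (simp add: lborel_prod)
  then show ?thesis using g by (subst (asm) nn_integral_0_iff_AE) auto
qed

context Lp_periodic begin

lemma mixed_diff_L1:
  assumes "0 \<le> s" "s \<le> u" "0 \<le> t" "t \<le> v"
  shows "(\<integral>\<^sup>+x. \<integral>\<^sup>+y. ennreal \<bar>mixed_diff s t f (x, y)\<bar> \<partial>unit_leb \<partial>unit_leb) \<le> ennreal (\<omega> u v)"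
  by (rule L1_le_Lp[OF p mixed_diff_measurable[OF f] omega_nonneg omega_bound[OF assms]])

lemma fine_part_L1:
  assumes s: "0 < s" "s \<le> 1"
  shows "(\<integral>\<^sup>+x. \<integral>\<^sup>+y. ennreal \<bar>fine_part s f (x, y) - centered f (x, y)\<bar> \<partial>unit_leb \<partial>unit_leb) \<le> ennreal (\<omega> s 1 + \<omega> s 1 + \<omega> 1 s)"
proof -
  note [measurable] = Lper2_measurable[OF Lper2]
  let ?I = "\<lambda>h k. (\<integral>\<^sup>+x. \<integral>\<^sup>+y. ennreal \<bar>steklov_error2 h k f (x, y)\<bar> \<partial>unit_leb \<partial>unit_leb)"
  have I: "?I h k \<le> ennreal (\<omega> h k)" if "0 < h" "h \<le> 1" "0 < k" "k \<le> 1" for h k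
    by (rule steklov_error2_L1[OF Lper2 that(1,3,4) mixed_diff_L1])
  have m: "steklov_error2 h k f \<in> borel_measurable (borel \<Otimes>\<^sub>M borel)" if "0 < h" "0 < k" "k \<le> 1" for h k
  proof -
    have [measurable]: "steklov2 h k f \<in> borel_measurable (borel \<Otimes>\<^sub>M borel)"
      using steklov2_continuous[OF Lper2 that] by (simp add: borel_prod borel_measurable_continuous_onI)
    show ?thesis unfolding steklov_error2_def steklov_def case_prod_beta' by measurable
  qed
  note [measurable] = m[OF s(1) s] m[OF s(1), of 1] m[of 1, OF _ s]
  have "(\<integral>\<^sup>+x. \<integral>\<^sup>+y. ennreal \<bar>fine_part s f (x, y) - centered f (x, y)\<bar> \<partial>unit_leb \<partial>unit_leb)
    \<le> (\<integral>\<^sup>+x. \<integral>\<^sup>+y. ennreal \<bar>steklov_error2 s s f (x, y)\<bar> + ennreal \<bar>steklov_error2 s 1 f (x, y)\<bar> + ennreal \<bar>steklov_error2 1 s f (x, y)\<bar> \<partial>unit_leb \<partial>unit_leb)"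
    by (intro nn_integral_unit_mono_sections[OF Lper2])
       (auto simp: fine_part_minus_centered[OF Lper2] ennreal_plus[symmetric] simp del: ennreal_plus intro!: ennreal_leI)
  also have "\<dots> = ?I s s + ?I s 1 + ?I 1 s"
    by (simp add: nn_integral_add)
  also have "\<dots> \<le> ennreal (\<omega> s s) + ennreal (\<omega> s 1) + ennreal (\<omega> 1 s)"
    using s by (intro add_mono I) auto
  also have "\<dots> \<le> ennreal (\<omega> s 1) + ennreal (\<omega> s 1) + ennreal (\<omega> 1 s)"
    using s by (intro add_mono ennreal_leI omega_mono) auto
  also have "\<dots> = ennreal (\<omega> s 1 + \<omega> s 1 + \<omega> 1 s)"
    by (simp only: ennreal_plus omega_nonneg add_nonneg_nonneg)
  finally show ?thesis .
qed

text \<open>Convergence in the mean is a consequence of the decay of the modulus at \<open>(h, 1)\<close> and \<open>(1, h)\<close> alone, by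
\<open>fine_part_L1\<close>; it identifies the uniform limit.\<close>
lemma uniform_limit_eq_centered:
  assumes s: "\<And>N. 0 < s N" "\<And>N. s N \<le> 1"
    and lim1: "(\<lambda>N. \<omega> (s N) 1) \<longlonglongrightarrow> 0" and lim2: "(\<lambda>N. \<omega> 1 (s N)) \<longlonglongrightarrow> 0"
    and g: "g \<in> borel_measurable borel" "periodic2 g"
    and unif: "\<And>N z. \<bar>g z - fine_part (s N) f z\<bar> \<le> \<delta> N" and \<delta>: "\<delta> \<longlonglongrightarrow> 0"
  shows "AE z in lborel. g z = centered f z"
proof -
  have [measurable]: "g \<in> borel_measurable (borel \<Otimes>\<^sub>M borel)" "centered f \<in> borel_measurable (borel \<Otimes>\<^sub>M borel)"
    using g centered_measurable[OF Lper2] by (simp_all add: borel_prod)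
  have [measurable]: "fine_part (s N) f \<in> borel_measurable (borel \<Otimes>\<^sub>M borel)" for N
    using fine_part_continuous[OF Lper2 s] by (simp add: borel_prod borel_measurable_continuous_onI)
  let ?d = "\<lambda>z. g z - centered f z"
  let ?I = "(\<integral>\<^sup>+x. \<integral>\<^sup>+y. ennreal \<bar>?d (x, y)\<bar> \<partial>unit_leb \<partial>unit_leb)"
  have \<delta>0: "0 \<le> \<delta> N" for N using unif[of undefined N] by linarith
  have bound: "?I \<le> ennreal (\<delta> N + (\<omega> (s N) 1 + \<omega> (s N) 1 + \<omega> 1 (s N)))" for N
  proof -
    have "?I \<le> (\<integral>\<^sup>+x. \<integral>\<^sup>+y. ennreal (\<delta> N) + ennreal \<bar>fine_part (s N) f (x, y) - centered f (x, y)\<bar> \<partial>unit_leb \<partial>unit_leb)"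
    proof (intro nn_integral_mono)
      fix x y
      have "\<bar>?d (x, y)\<bar> \<le> \<delta> N + \<bar>fine_part (s N) f (x, y) - centered f (x, y)\<bar>" using unif[of "(x, y)" N] by linarith
      then show "ennreal \<bar>?d (x, y)\<bar> \<le> ennreal (\<delta> N) + ennreal \<bar>fine_part (s N) f (x, y) - centered f (x, y)\<bar>"
        using \<delta>0 by (simp add: ennreal_plus[symmetric] ennreal_leI del: ennreal_plus)
    qed
    also have "\<dots> = ennreal (\<delta> N) + (\<integral>\<^sup>+x. \<integral>\<^sup>+y. ennreal \<bar>fine_part (s N) f (x, y) - centered f (x, y)\<bar> \<partial>unit_leb \<partial>unit_leb)"
      by (simp add: nn_integral_add)
    also have "\<dots> \<le> ennreal (\<delta> N) + ennreal (\<omega> (s N) 1 + \<omega> (s N) 1 + \<omega> 1 (s N))"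
      by (intro add_left_mono fine_part_L1 s)
    finally show ?thesis by (simp add: \<delta>0 omega_nonneg)
  qed
  have "(\<lambda>N. \<delta> N + (\<omega> (s N) 1 + \<omega> (s N) 1 + \<omega> 1 (s N))) \<longlonglongrightarrow> 0 + (0 + 0 + 0)"
    by (intro tendsto_add \<delta> lim1 lim2)
  then have "(\<lambda>N. ennreal (\<delta> N + (\<omega> (s N) 1 + \<omega> (s N) 1 + \<omega> 1 (s N)))) \<longlonglongrightarrow> ennreal 0"
    by (intro tendsto_ennrealI) simp
  then have "?I \<le> ennreal 0" by (rule LIMSEQ_le_const) (use bound in blast)
  then have "?I = 0" by simp
  then have "AE z in lborel. ?d z = 0"
    using g centered_measurable[OF Lper2] centered_periodic[OF per]
    by (intro AE_lborel_of_unit) (auto simp: periodic2_def)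
  then show ?thesis by eventually_elim simp
qed

end

section \<open>The continuous representative\<close>

lemma p_variation_limit:
  assumes p: "1 \<le> p" and C: "0 \<le> C" "\<And>N. p_variation p (G N) \<le> ennreal C" and lim: "\<And>z. (\<lambda>N. G N z) \<longlonglongrightarrow> g z"
  shows "p_variation p g \<le> ennreal C"
  unfolding p_variation_le_iff[OF p C(1)]
proof safe
  fix n x assume x: "(n, x :: nat \<Rightarrow> real) \<in> period_partitions"
  have "(\<lambda>N. \<Sum>k<n. \<bar>G N (x (Suc k)) - G N (x k)\<bar> powr p) \<longlonglongrightarrow> (\<Sum>k<n. \<bar>g (x (Suc k)) - g (x k)\<bar> powr p)"
    using p by (intro tendsto_sum tendsto_powr' tendsto_rabs tendsto_diff lim tendsto_const) auto
  moreover have "(\<Sum>k<n. \<bar>G N (x (Suc k)) - G N (x k)\<bar> powr p) \<le> C powr p" for N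
    using C(2)[of N] x unfolding p_variation_le_iff[OF p C(1)] by fast
  ultimately show "(\<Sum>k<n. \<bar>g (x (Suc k)) - g (x k)\<bar> powr p) \<le> C powr p"
    by (intro LIMSEQ_le_const2) auto
qed

context Lp_periodic begin

text \<open>Partial sums over squares are used, so each increment is the finite sum of the blocks on a shell
\<open>max n m = N\<close>. The shell sums of the bounds form a convergent series, to which Weierstrass' test applies.\<close>
lemma exists_continuous_centered:
  assumes fin: "I_fun p f < \<infinity>"
  shows "\<exists>g. continuous_on UNIV g \<and> g \<in> H2_space p \<and> (AE z in lborel. g z = centered f z) \<and> p_variation2 p g \<le> ennreal 9216 * main_bound"
proof -
  obtain L b T where L: "2 \<le> L" and b: "\<And>n m. 0 \<le> b n m" "\<And>n m. p_variation2 p (block L n m) \<le> ennreal (b n m)"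
    and btot: "\<And>K. ennreal (\<Sum>n<K. \<Sum>m<K. b n m) \<le> ennreal 9216 * main_bound"
    and bT: "\<And>K. (\<Sum>n<K. \<Sum>m<K. b n m) \<le> T" and wT: "\<And>K. (\<Sum>n<K. \<Sum>m<K. wmod L (Suc n) (Suc m)) \<le> T"
    using block_bounds[OF fin] by metis
  define s where "s = mesh L"
  have s: "0 < s N" "s N \<le> 1" for N unfolding s_def using mesh_pos[OF L] mesh_le_1[OF L] by auto
  define R where "R N = fine_part (s N) f" for N
  define I :: "nat \<Rightarrow> (nat \<times> nat) set" where "I N = {..<N} \<times> {..<N}" for N
  have I: "finite (I N)" "I N \<subseteq> I (Suc N)" for N by (auto simp: I_def)
  \<comment> \<open>The bounds of the blocks on the shell \<open>max n m = N\<close>.\<close>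
  define c where "c N = (\<Sum>(n, m)\<in>I (Suc N) - I N. b n m)" for N
  define D where "D N z = R (Suc N) z - R N z" for N z
  have Rsum: "R N z = (\<Sum>(n, m)\<in>I N. block L n m z)" for N z
    unfolding R_def s_def I_def block_sum[OF L, symmetric] by (rule sum.cartesian_product)
  have Dsum: "D N = (\<lambda>z. \<Sum>(n, m)\<in>I (Suc N) - I N. block L n m z)" for N
    unfolding D_def[abs_def] Rsum by (rule ext, rule sum_diff[OF I(1) I(2), symmetric])
  have bsum: "(\<Sum>(n, m)\<in>I N. b n m) = (\<Sum>n<N. \<Sum>m<N. b n m)" for N
    unfolding I_def by (rule sum.cartesian_product[symmetric])
  have c: "0 \<le> c N" for N unfolding c_def by (auto intro: sum_nonneg b)
  have csum: "(\<Sum>k<N. c k) = (\<Sum>n<N. \<Sum>m<N. b n m)" for N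
  proof -
    have "c k = (\<Sum>(n, m)\<in>I (Suc k). b n m) - (\<Sum>(n, m)\<in>I k. b n m)" for k
      unfolding c_def by (rule sum_diff[OF I(1) I(2)])
    then have "(\<Sum>k<N. c k) = (\<Sum>(n, m)\<in>I N. b n m) - (\<Sum>(n, m)\<in>I 0. b n m)"
      by (simp only:) (rule sum_lessThan_telescope)
    then show ?thesis by (simp add: bsum)
  qed
  have sc: "summable c" by (rule summableI_nonneg_bounded[OF c, of _ T]) (simp add: csum bT)
  have T: "0 \<le> T" using bT[of 0] by simp
  have vD: "p_variation2 p (D N) \<le> ennreal (c N)" for N
  proof -
    have "p_variation2 p (\<lambda>z. \<Sum>q\<in>I (Suc N) - I N. (case q of (n, m) \<Rightarrow> block L n m) z) \<le> ennreal (\<Sum>q\<in>I (Suc N) - I N. case q of (n, m) \<Rightarrow> b n m)"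
      by (rule p_variation2_sum_le[OF p1]) (auto simp: I b)
    moreover have "(\<lambda>z. \<Sum>q\<in>I (Suc N) - I N. (case q of (n, m) \<Rightarrow> block L n m) z) = D N"
      unfolding Dsum by (intro ext sum.cong) (auto)
    ultimately show ?thesis by (simp add: c_def)
  qed
  have vR: "p_variation2 p (R N) \<le> ennreal (\<Sum>n<N. \<Sum>m<N. b n m)" for N
  proof -
    have "p_variation2 p (\<lambda>z. \<Sum>q\<in>I N. (case q of (n, m) \<Rightarrow> block L n m) z) \<le> ennreal (\<Sum>q\<in>I N. case q of (n, m) \<Rightarrow> b n m)"
      by (rule p_variation2_sum_le[OF p1]) (auto simp: I b)
    moreover have "(\<lambda>z. \<Sum>q\<in>I N. (case q of (n, m) \<Rightarrow> block L n m) z) = R N"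
      unfolding Rsum[abs_def] by (intro ext sum.cong) (auto)
    ultimately show ?thesis by (simp add: bsum)
  qed
  have vRT: "p_variation2 p (R N) \<le> ennreal T" for N
    using vR[of N] by (rule order_trans) (intro ennreal_leI bT)
  have perR: "periodic2 (R N)" for N unfolding R_def by (rule fine_part_periodic[OF Lper2 s])
  have Rx: "integrable unit_leb (\<lambda>x. R N (x, y))" "(\<integral>x. R N (x, y) \<partial>unit_leb) = 0" for N y
    unfolding R_def by (rule fine_part_mean[OF Lper2 s])+
  have Ry: "integrable unit_leb (\<lambda>y. R N (x, y))" "(\<integral>y. R N (x, y) \<partial>unit_leb) = 0" for N x
    unfolding R_def by (rule fine_part_mean'[OF Lper2 s])+
  have supD: "\<bar>D N z\<bar> \<le> c N" for N z
  proof (cases z)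
    case (Pair x y)
    have "\<bar>D N (x, y)\<bar> \<le> c N"
    proof (rule mean_zero_sup_le[OF p1 c vD])
      show "periodic2 (D N)" using perR[of N] perR[of "Suc N"] by (simp add: periodic2_def D_def)
    qed (simp_all add: D_def Rx Ry)
    then show ?thesis by (simp add: Pair)
  qed
  have R0: "R 0 z = 0" for z by (simp add: Rsum I_def)
  have RD: "(\<Sum>k<N. D k z) = R N z" for N z
    unfolding D_def using sum_lessThan_telescope[of "\<lambda>k. R k z" N] by (simp add: R0)
  define g where "g z = (\<Sum>k. D k z)" for z
  have unif: "uniform_limit UNIV (\<lambda>N z. R N z) g sequentially"
    using Weierstrass_m_test[of UNIV D c, OF _ sc] supD by (simp add: RD g_def[abs_def])
  have lim: "(\<lambda>N. R N z) \<longlonglongrightarrow> g z" for z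
    by (rule tendsto_uniform_limitI[OF unif]) simp
  have cont: "continuous_on UNIV g"
    by (rule uniform_limit_theorem[OF _ unif]) (auto simp: R_def intro!: always_eventually fine_part_continuous[OF Lper2 s])
  have perg: "periodic2 g" using perR by (simp add: periodic2_def g_def D_def)
  have vgC: "p_variation2 p g \<le> ennreal C" if "0 \<le> C" "\<And>N. (\<Sum>n<N. \<Sum>m<N. b n m) \<le> C" for C
    by (rule p_variation2_limit[OF p1 that(1) _ lim])
       (rule order_trans[OF vR], intro ennreal_leI that)
  have "g \<in> H2_space p"
  proof -
    have "p_variation p (\<lambda>y. g (x, y)) \<le> ennreal T" for x
      by (rule p_variation_limit[OF p1 T _ lim])
         (rule mean_zero_section_variation[OF p1 T vRT perR Rx])
    moreover have "p_variation p (\<lambda>x. g (x, y)) \<le> ennreal T" for y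
    proof (rule p_variation_limit[OF p1 T _ lim])
      fix N
      have per': "periodic2 (\<lambda>z. R N (snd z, fst z))" using perR[of N] by (simp add: periodic2_def)
      have "p_variation p (\<lambda>x. (\<lambda>z. R N (snd z, fst z)) (y, x)) \<le> ennreal T"
        by (rule mean_zero_section_variation[OF p1 T p_variation2_swap[OF p1 T vRT] per']) (simp_all add: Ry)
      then show "p_variation p (\<lambda>x. R N (x, y)) \<le> ennreal T" by simp
    qed
    ultimately show ?thesis
      using perg vgC[OF T bT] unfolding H2_space_def V_space_def
      by (auto simp: periodic1_def periodic2_def intro: le_less_trans[OF _ ennreal_less_top])
  qed
  moreover have "AE z in lborel. g z = centered f z"
  proof (rule uniform_limit_eq_centered[OF s])
    show "(\<lambda>N. \<omega> (s N) 1) \<longlonglongrightarrow> 0" "(\<lambda>N. \<omega> 1 (s N)) \<longlonglongrightarrow> 0"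
      unfolding s_def by (rule wmod_tendsto_modulus[OF L wT])+
    show "g \<in> borel_measurable borel" by (rule borel_measurable_continuous_onI[OF cont])
    show "\<bar>g z - fine_part (s N) f z\<bar> \<le> (\<Sum>k. c (k + N))" for N z
    proof -
      have "summable (\<lambda>k. D k z)" by (rule summable_comparison_test[OF _ sc]) (use supD in auto)
      from suminf_minus_initial_segment[OF this, of N]
      have "g z - fine_part (s N) f z = (\<Sum>k. D (k + N) z)" by (simp add: g_def RD R_def)
      moreover have "norm (\<Sum>k. D (k + N) z) \<le> (\<Sum>k. c (k + N))"
        by (rule norm_suminf_le) (use supD sc in \<open>auto simp: summable_iff_shift\<close>)
      ultimately show ?thesis by simp
    qed
    have "(\<lambda>N. suminf c - (\<Sum>k<N. c k)) \<longlonglongrightarrow> suminf c - suminf c"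
      by (intro tendsto_diff tendsto_const summable_LIMSEQ sc)
    then show "(\<lambda>N. \<Sum>k. c (k + N)) \<longlonglongrightarrow> 0" by (simp add: suminf_minus_initial_segment[OF sc])
  qed (rule perg)
  moreover have "p_variation2 p g \<le> ennreal 9216 * main_bound"
  proof (cases main_bound)
    case (real t)
    then have eq: "ennreal 9216 * main_bound = ennreal (9216 * t)" by (simp add: ennreal_mult)
    have "p_variation2 p g \<le> ennreal (9216 * t)"
    proof (rule vgC)
      show "(\<Sum>n<N. \<Sum>m<N. b n m) \<le> 9216 * t" for N
        using btot[of N, unfolded eq] real by (subst (asm) ennreal_le_iff) auto
    qed (use real in auto)
    then show ?thesis by (simp only: eq)
  next
    case top
    then show ?thesis by (simp add: ennreal_mult_top)
  qed
  ultimately show ?thesis using cont by blast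
qed

end


lemma AE_lborel_translate2:
  fixes P :: "'a::euclidean_space \<Rightarrow> bool"
  assumes "AE z in lborel. P z"
  shows "AE z in lborel. P (c + z)"
proof -
  obtain N where N: "{x \<in> space lborel. \<not> P x} \<subseteq> N" "emeasure lborel N = 0" "N \<in> sets lborel"
    using assms(1) by (rule AE_E)
  have d: "distr lborel borel (\<lambda>x. c + x) = (lborel :: 'a measure)"
    using lborel_affine[of 1 c] by (simp add: density_1)
  have "AE x in lborel. x \<notin> N" using N by (intro AE_not_in) auto
  then have "AE x in distr lborel borel (\<lambda>x. c + x). x \<notin> N" unfolding d .
  then have "AE x in lborel. c + x \<notin> N" using N(3) by (subst (asm) AE_distr_iff) auto
  then show ?thesis using N(1) by (auto elim!: eventually_mono)
qed

lemma periodic2_of_int: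
  assumes "periodic2 f"
  shows "f (x + of_int k, y + of_int l) = f (x, y)"
  using periodic_of_int[of "\<lambda>x. f (x, y + of_int l)" x k] periodic_of_int[of "\<lambda>y. f (x, y)" y l] assms
  by (simp add: periodic2_def)

text \<open>A Borel function that agrees with \<open>f\<close> almost everywhere need not be periodic; it is restricted to the unit square and
extended periodically. Agreement survives since countably many translates of a null set form a null set.\<close>
lemma exists_borel_periodic:
  assumes f: "f \<in> borel_measurable lebesgue" and per: "periodic2 f"
  shows "\<exists>f0. f0 \<in> borel_measurable borel \<and> periodic2 f0 \<and> (AE z in lborel. f z = f0 z)"
proof -
  obtain f1 where f1: "f1 \<in> borel_measurable lborel" and eq: "AE z in lborel. f z = f1 z"
    using completion_ex_borel_measurable_real[OF f] by blast
  have [measurable]: "f1 \<in> borel_measurable borel" using f1 by simp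
  define f0 where "f0 z = f1 (fst z - of_int \<lfloor>fst z\<rfloor>, snd z - of_int \<lfloor>snd z\<rfloor>)" for z :: "real \<times> real"
  have "f0 \<in> borel_measurable (borel \<Otimes>\<^sub>M borel)" unfolding f0_def by measurable
  then have "f0 \<in> borel_measurable borel" by (simp add: borel_prod)
  moreover have "periodic2 f0" by (simp add: periodic2_def f0_def)
  moreover have "AE z in lborel. f z = f0 z"
  proof -
    \<comment> \<open>All integer translates at once, so that the integers may depend on the point.\<close>
    have "AE z in lborel. \<forall>k::int. \<forall>l::int. f ((- of_int k, - of_int l) + z) = f1 ((- of_int k, - of_int l) + z)"
      unfolding AE_all_countable using AE_lborel_translate2[OF eq] by blast
    then show ?thesis
    proof eventually_elim
      case (elim z)
      obtain x y where z: "z = (x, y)" by (cases z)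
      have "f (x, y) = f (x + of_int (- \<lfloor>x\<rfloor>), y + of_int (- \<lfloor>y\<rfloor>))" by (rule periodic2_of_int[OF per, symmetric])
      also have "\<dots> = f0 (x, y)" using elim[rule_format, of "\<lfloor>x\<rfloor>" "\<lfloor>y\<rfloor>"] by (simp add: z f0_def)
      finally show ?case by (simp add: z)
    qed
  qed
  ultimately show ?thesis by blast
qed

lemma Lp_norm_cong_AE:
  assumes "AE z in lborel. f z = g z" shows "Lp_norm p f = Lp_norm p g"
  unfolding Lp_norm_def nn_integral_completion
  by (intro arg_cong[where f = "proot p"] nn_integral_cong_AE) (use assms in \<open>auto elim!: eventually_mono\<close>)

lemma mixed_modulus_cong_AE:
  assumes eq: "AE z in lborel. f z = g z" shows "mixed_modulus p f u v = mixed_modulus p g u v"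
proof -
  have "Lp_norm p (mixed_diff s t f) = Lp_norm p (mixed_diff s t g)" for s t
  proof (rule Lp_norm_cong_AE)
    show "AE z in lborel. mixed_diff s t f z = mixed_diff s t g z"
      using eq AE_lborel_translate2[OF eq, of "(s, t)"] AE_lborel_translate2[OF eq, of "(s, 0)"] AE_lborel_translate2[OF eq, of "(0, t)"]
    proof eventually_elim
      case (elim z)
      then show ?case by (cases z) (simp add: mixed_diff_def add.commute)
    qed
  qed
  then show ?thesis by (simp add: mixed_modulus_def)
qed

text \<open>By Fubini almost every section of \<open>f\<close> agrees almost everywhere with the section of its Borel representative and is
thus Lebesgue measurable by completeness.\<close>
lemma section_mean_cong_AE:
  fixes f f0 :: "real \<times> real \<Rightarrow> real"
  assumes f0: "f0 \<in> borel_measurable borel" and eq: "AE z in lborel. f z = f0 z"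
  shows "AE x in lborel. (LINT t:{0..1}|lebesgue. f (x, t)) = (\<integral>t. f0 (x, t) \<partial>unit_leb)"
proof -
  have [measurable]: "f0 \<in> borel_measurable (borel \<Otimes>\<^sub>M borel)" using f0 by (simp add: borel_prod)
  have "AE z in lborel \<Otimes>\<^sub>M lborel. f z = f0 z" unfolding lborel_prod by (rule eq)
  from lborel_pair.AE_pair[OF this] show ?thesis
  proof eventually_elim
    case (elim x)
    have m0: "(\<lambda>t. f0 (x, t)) \<in> borel_measurable lborel" by simp
    have e: "AE t in lebesgue. f0 (x, t) = f (x, t)" using elim by (auto simp: AE_completion_iff)
    have m: "(\<lambda>t. f (x, t)) \<in> borel_measurable lebesgue"
      by (rule borel_measurable_AE[OF measurable_completion[OF m0]]) (rule e)
    have "(LINT t:{0..1}|lebesgue. f (x, t)) = (LINT t:{0..1}|lebesgue. f0 (x, t))"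
      unfolding set_lebesgue_integral_def
      using m measurable_completion[OF m0] e
      by (intro integral_cong_AE borel_measurable_scaleR borel_measurable_indicator) (auto elim!: eventually_mono)
    also have "\<dots> = (LINT t:{0..1}|lborel. f0 (x, t))"
      unfolding set_lebesgue_integral_def by (rule integral_completion) measurable
    also have "\<dots> = (\<integral>t. f0 (x, t) \<partial>unit_leb)"
      unfolding set_lebesgue_integral_def unit_leb_def by (subst integral_density) auto
    finally show ?case .
  qed
qed

lemma AE_lborel_fst:
  assumes "Measurable.pred borel P" "AE x in lborel. P x"
  shows "AE z in lborel. P (fst z :: real)" "AE z in lborel. P (snd z :: real)"
proof -
  note [measurable] = assms(1)
  have "AE z in lborel \<Otimes>\<^sub>M lborel. P (fst z)"
  proof (rule lborel_pair.AE_pair_measure)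
    show "{z \<in> space (lborel \<Otimes>\<^sub>M lborel). P (fst z)} \<in> sets (lborel \<Otimes>\<^sub>M lborel)" by measurable
  qed (use assms(2) in auto)
  then show "AE z in lborel. P (fst z :: real)" unfolding lborel_prod .
  have "AE z in lborel \<Otimes>\<^sub>M lborel. P (snd z)"
  proof (rule lborel_pair.AE_pair_measure)
    show "{z \<in> space (lborel \<Otimes>\<^sub>M lborel). P (snd z)} \<in> sets (lborel \<Otimes>\<^sub>M lborel)" by measurable
  qed (use assms(2) in auto)
  then show "AE z in lborel. P (snd z :: real)" unfolding lborel_prod .
qed

text \<open>If both partial means vanish, so does the total mean, and centering changes \<open>f\<close> only on a null set.\<close>
lemma centered_eq_Lp0:
  assumes f: "f \<in> Lp0 p" and f0: "f0 \<in> Lper2" and eq: "AE z in lborel. f z = f0 z"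
  shows "AE z in lborel. f z = centered f0 z"
proof -
  note [measurable] = Lper2_measurable[OF f0]
  have eq': "AE z in lborel. f (snd z, fst z) = f0 (snd z, fst z)"
  proof -
    have "AE z in lborel \<Otimes>\<^sub>M lborel. f z = f0 z" unfolding lborel_prod by (rule eq)
    then have "AE z in distr (lborel \<Otimes>\<^sub>M lborel) (lborel \<Otimes>\<^sub>M lborel) (\<lambda>(x, y). (y, x)). f z = f0 z"
      by (subst lborel_pair.distr_pair_swap[symmetric])
    then have "AE z in lborel \<Otimes>\<^sub>M lborel. f ((\<lambda>(x, y). (y, x)) z) = f0 ((\<lambda>(x, y). (y, x)) z)"
      by (rule AE_distrD[rotated]) measurable
    then show ?thesis unfolding lborel_prod case_prod_beta' fst_conv snd_conv .
  qed
  have A: "AE x in lborel. (\<integral>t. f0 (x, t) \<partial>unit_leb) = 0"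
    using section_mean_cong_AE[OF Lper2_measurable[OF f0] eq] f
    by (auto simp: Lp0_def AE_completion_iff)
  have B: "AE y in lborel. (\<integral>s. f0 (s, y) \<partial>unit_leb) = 0"
    using section_mean_cong_AE[OF Lper2_measurable[OF Lper2_swap[OF f0]] eq'] f
    by (auto simp: Lp0_def AE_completion_iff)
  have "(\<integral>s. \<integral>t. f0 (s, t) \<partial>unit_leb \<partial>unit_leb) = (\<integral>s. 0 \<partial>unit_leb)"
    by (rule integral_cong_AE) (use AE_unit_measureI[OF A] in auto)
  then have C: "(\<integral>s. \<integral>t. f0 (s, t) \<partial>unit_leb \<partial>unit_leb) = 0" by simp
  have "AE z in lborel. (\<integral>t. f0 (fst z, t) \<partial>unit_leb) = 0"
    by (rule AE_lborel_fst(1)[OF _ A]) measurable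
  moreover have "AE z in lborel. (\<integral>s. f0 (s, snd z) \<partial>unit_leb) = 0"
    by (rule AE_lborel_fst(2)[OF _ B]) measurable
  ultimately show ?thesis using eq
    by eventually_elim (simp add: centered_def case_prod_beta' C)
qed

theorem theorem4p2:
  shows "\<exists>A::real. A > 0 \<and>
    (\<forall>(p::real) (p'::real) (f :: real \<times> real \<Rightarrow> real).
      1 < p \<longrightarrow> p' = p / (p - 1) \<longrightarrow> f \<in> Lp p \<longrightarrow> I_fun p f < \<infinity> \<longrightarrow>
      (\<exists>(g :: real \<times> real \<Rightarrow> real) (\<phi>1 :: real \<Rightarrow> real) (\<phi>2 :: real \<Rightarrow> real).
        continuous_on UNIV g \<and> g \<in> H2_space p \<and>
        (AE z in lebesgue. f z = g z + \<phi>1 (fst z) + \<phi>2 (snd z)) \<and>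
        p_variation2 p g \<le> ennreal A *
          (mixed_modulus p f 1 1 + ennreal (1 / (p * p')) * K_fun p f
            + ennreal ((1 / (p * p'))\<^sup>2) * I_fun p f) \<and>
        (f \<in> Lp0 p \<longrightarrow> (\<forall>x. \<phi>1 x = 0) \<and> (\<forall>y. \<phi>2 y = 0))))"
proof (intro exI[of _ "9216::real"] conjI allI impI)
  fix p p' :: real and f :: "real \<times> real \<Rightarrow> real"
  assume p: "1 < p" and p': "p' = p / (p - 1)" and f: "f \<in> Lp p" and fin: "I_fun p f < \<infinity>"
  obtain f0 where f0: "f0 \<in> borel_measurable borel" "periodic2 f0" and eq: "AE z in lborel. f z = f0 z"
    using exists_borel_periodic[of f] f by (auto simp: Lp_def)
  have mod: "mixed_modulus p f = mixed_modulus p f0"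
    by (intro ext mixed_modulus_cong_AE eq)
  have IK: "I_fun p f = I_fun p f0" "K_fun p f = K_fun p f0"
    by (simp_all add: I_fun_def K_fun_def mod)
  interpret Lp_periodic p f0
  proof
    have "proot p (powint2 p f0) < \<infinity>"
      using f Lp_norm_cong_AE[OF eq, of p] Lp_norm_eq_powint2[OF f0(1), of p] by (auto simp: Lp_def)
    then show "powint2 p f0 < \<infinity>" by (auto simp: proot_def less_top split: if_splits)
  qed (use p f0 in auto)
  obtain g where g: "continuous_on UNIV g" "g \<in> H2_space p" "AE z in lborel. g z = centered f0 z"
    "p_variation2 p g \<le> ennreal 9216 * main_bound"
    using exists_continuous_centered fin unfolding IK by blast
  have "1 / (p * p') = 1 / p * (1 - 1 / p)" using p by (simp add: p' field_simps)
  then have tot: "main_bound = mixed_modulus p f 1 1 + ennreal (1 / (p * p')) * K_fun p f + ennreal ((1 / (p * p'))\<^sup>2) * I_fun p f"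
    by (simp only: main_bound_def mod IK)
  define \<phi>1 where "\<phi>1 x = (if f \<in> Lp0 p then 0 else (\<integral>t. f0 (x, t) \<partial>unit_leb))" for x
  define \<phi>2 where "\<phi>2 y = (if f \<in> Lp0 p then 0 else (\<integral>s. f0 (s, y) \<partial>unit_leb)
     - (\<integral>s. \<integral>t. f0 (s, t) \<partial>unit_leb \<partial>unit_leb))" for y
  have "AE z in lborel. f z = g z + \<phi>1 (fst z) + \<phi>2 (snd z)"
  proof (cases "f \<in> Lp0 p")
    case True
    show ?thesis
      using centered_eq_Lp0[OF True Lper2 eq] g(3) by eventually_elim (simp add: True \<phi>1_def \<phi>2_def)
  next
    case False
    show ?thesis
      using eq g(3) by eventually_elim (simp add: False \<phi>1_def \<phi>2_def centered_def case_prod_beta')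
  qed
  then show "\<exists>g \<phi>1 \<phi>2. continuous_on UNIV g \<and> g \<in> H2_space p \<and>
        (AE z in lebesgue. f z = g z + \<phi>1 (fst z) + \<phi>2 (snd z)) \<and>
        p_variation2 p g \<le> ennreal 9216 *
          (mixed_modulus p f 1 1 + ennreal (1 / (p * p')) * K_fun p f
            + ennreal ((1 / (p * p'))\<^sup>2) * I_fun p f) \<and>
        (f \<in> Lp0 p \<longrightarrow> (\<forall>x. \<phi>1 x = 0) \<and> (\<forall>y. \<phi>2 y = 0))"
    using g(1,2,4) unfolding tot
    by (intro exI[of _ g] exI[of _ \<phi>1] exI[of _ \<phi>2]) (auto simp: AE_completion_iff \<phi>1_def \<phi>2_def)
qed simp

end
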